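(* Let $d\ge2$ and let $T\in\mathcal X^3_d$ be a GIET satisfying the Regular Diophantine Condition (RDC), and let $(n_k)_{k\in\mathbb N}$, $(k_m)_{m\in\mathbb N}$ and the splittings $\mathbb R^d=\Gamma^{(n)}_s\oplus\Gamma^{(n)}_c\oplus\Gamma^{(n)}_u$ be the data given by the RDC. Let $\omega_n=\omega(\mathcal Z^n(T))$ be the shape log-slope vectors of the orbit of $T$ under Zorich renormalization. Then one has the following dichotomy. Either Case 1 (recurrence): the sequence $(\omega_n)$ is bounded along the times $n_{k_m}$, i.e. there exists $V>0$ such that $\|\omega_{n_{k_m}}\|\le V$ for all $m\in\mathbb N$; or, alternatively, Case 2 (affine shadowing): there exists a (nonzero) vector $v\in\Gamma^{(0)}_u$ such that, setting $v^{(n)}:=Q(0,n)v$, $$\lim_{n\to\infty}\frac{\|\omega_n-v^{(n)}\|}{\|v^{(n)}\|}=0 .$$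
   Context: GIETs. A $\mathcal C^r$ generalized interval exchange transformation (GIET) on $d\ge 2$ intervals is a map $T$ of $[0,1]$ (defined up to finitely many points) together with two partitions, up to finitely many points, of $[0,1]$ into open intervals $I^t_1,\dots,I^t_d$ (top) and $I^b_1,\dots,I^b_d$ (bottom), such that for each $i$ the map $T$ restricts to an orientation-preserving $\mathcal C^r$-diffeomorphism $I^t_i\to I^b_i$ extending to a $\mathcal C^r$-diffeomorphism of the closures. Its combinatorial datum is the pair $\pi=(\pi_t,\pi_b)$ of permutations of $\{1,\dots,d\}$ such that, from left to right, the top intervals are $I^t_{\pi_t(1)},\dots,I^t_{\pi_t(d)}$ and the bottom ones $I^b_{\pi_b(1)},\dots,I^b_{\pi_b(d)}$; $\pi$ is irreducible if $\pi_t\{1,\dots,k\}\neq\pi_b\{1,\dots,k\}$ for $1\le k<d$. $\mathcal X^r_d$ is the set of $\mathcal C^r$ GIETs on $d$ intervals with irreducible datum. A standard IET is a GIET whose branches are translations. The shape log-slope vector of $T$ is $\omega(T)=\big(\log(|I^b_j|/|I^t_j|)\big)_{1\le j\le d}$. Renormalization. Let $I^t_\alpha,I^b_\beta$ ($\alpha=\pi_t(d)$, $\beta=\pi_b(d)$) be the rightmost top and bottom intervals. If their lengths differ, the label of the longer one is the winner and the other the loser; the elementary Rauzy–Veech step $\mathcal V(T)$ is the first return map of $T$ to $[0,1]$ minus the shorter of the two, rescaled affinely to $[0,1]$. It is a GIET on $d$ intervals, where points with first return time $2$ get the loser's label and other points keep their label. $T$ is infinitely renormalizable if all $\mathcal V^n(T)$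 are defined; its rotation number $\gamma(T)$ is the infinite sequence of combinatorial data and types (top or bottom winner) of the steps; it is irrational if every label wins infinitely often. The Zorich acceleration $\mathcal Z$ performs together a maximal block of consecutive steps of the same type. $\mathcal Z^n(T)$ is the affine rescaling of the first return map $T_n$ of $T$ to some interval $I^{(n)}=[0,\lambda_n]$, with continuity intervals $I^{(n)}_j$ and first return times $q^{(n)}_j$. For $m\le n$, $Q(m,n)\in SL(d,\mathbb Z)$ is the matrix whose $(i,j)$ entry is the number of visits to $I^{(m)}_j$ of the $T_m$-orbit of a point of $I^{(n)}_i$ (starting point included) before its first return to $I^{(n)}$; thus $q^{(n)}=Q(m,n)q^{(m)}$ and $Q(m,p)=Q(n,p)Q(m,n)$. These matrices depend only on $\gamma(T)$. RDC. Let $g$ be the genus of the surface obtained by suspending $T$ (determined by $\pi$). An Oseledets generic extension is a sequence of splittings $\mathbb R^d=\Gamma^{(n)}_s\oplus\Gamma^{(n)}_c\oplus\Gamma^{(n)}_u$, $n\ge0$, with $Q(m,n)\Gamma_x^{(m)}=\Gamma_x^{(n)}$, $\dim\Gamma_s^{(n)}=\dim\Gamma_u^{(n)}=g$, such that for some $\theta,C>0$ and all $n$: $\|Q(0,n)v\|\le Ce^{-\theta n}\|v\|$ for $v\in\Gamma_s^{(0)}$; $\|Q(0,n)^{-1}v\|\le Ce^{-\theta n}\|v\|$ for $v\in\Gamma_u^{(n)}$; $\lim_n\frac1n\log\|Q(0,n)v\|=0$ for $0\ne v\in\Gamma_c^{(0)}$; and for every $\epsilon>0$ there is $c(\epsilon)>0$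 with $|\sin\angle(\Gamma^{(n)}_x,\Gamma^{(n)}_y)|\ge c(\epsilon)e^{-\epsilon n}$ for distinct $x,y\in\{s,c,u\}$ ($\angle$ is the minimal angle between nonzero vectors). $P_x^{(n)}$ denotes the projection onto $\Gamma_x^{(n)}$ along the splitting. A sequence $(n_k)$ is a sequence of good return times if there are $p\ge1$ and a matrix $A$ with strictly positive entries, a product of $p$ successive Zorich cocycle matrices ($A=Q(0,p)$ for some standard IET), with $Q(n_k,n_k+2p)=AA$ and $n_{k+1}-n_k\ge2p$ for all $k$. Write $\widetilde Q(k,k')=Q(n_k,n_{k'})$, $\widetilde Z_k=\widetilde Q(k,k+1)$, $\widetilde\Gamma^{(k)}_x=\Gamma^{(n_k)}_x$, $\widetilde P^{(k)}_x=P^{(n_k)}_x$ (with the convention $n_0=0$). A standard IET, and its rotation number, satisfies the RDC if (i) it has an Oseledets generic extension; (ii) there is a sequence $(n_k)$ of good return times with $\lim n_k/k<\infty$; (iii) there are constants $K^{\pm},\delta>0$ and an increasing sequence $(k_m)$ with $\limsup k_m/m<\infty$ such that for all $m$: [B] $\sum_{k=1}^{k_m}\|\widetilde Q(k,k_m)|_{\widetilde\Gamma_s^{(k)}}\|\,\|\widetilde P_s^{(k)}\|\,\|\widetilde Z_{k-1}\|\le K^-$; [F] $\sum_{k=k_m+1}^{\infty}\|\widetilde Q(k_m,k)^{-1}|_{\widetilde\Gamma_u^{(k)}}\|\,\|\widetilde P_u^{(k)}\|\,\|\widetilde Z_{k-1}\|\le K^+$; [S] $\lim_{m\to\infty}\frac1m\log\|\widetilde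 Q(k_m,k_{m+1})\|=0$; [A] $\angle(\widetilde\Gamma^{(k_m)}_{x},\widetilde\Gamma^{(k_m)}_{y})>\delta$ for distinct $x,y\in\{s,c,u\}$. A GIET satisfies the RDC if it is infinitely renormalizable, its rotation number is irrational, and its rotation number satisfies the RDC. *)

theory Defs
  imports "HOL-Analysis.Analysis"
begin

section \<open>Generalized interval exchange transformations\<close>

text \<open>
  Intervals are labelled by the elements of a finite type \<open>'d\<close>, so that \<open>d = CARD('d)\<close> and
  $\mathbb R^d$ is \<^typ>\<open>real ^ 'd\<close>; a combinatorial datum is a pair of enumerations of the labels
  by the positions \<open>1, \<dots>, d\<close>. Only the values of \<open>gmap\<close> on the open top intervals matter.
  The record also represents the induced maps on \<open>[0, L]\<close> before rescaling.
\<close>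

record 'd giet =
  gmap :: "real \<Rightarrow> real"
  top_int :: "'d \<Rightarrow> real set"
  bot_int :: "'d \<Rightarrow> real set"

type_synonym 'd datum = "(nat \<Rightarrow> 'd) \<times> (nat \<Rightarrow> 'd)"

datatype side = Top | Bot

text \<open>On a closed interval the derivatives at the end points are one-sided.\<close>

definition Cr_on :: "nat \<Rightarrow> (real \<Rightarrow> real) \<Rightarrow> real set \<Rightarrow> bool" where
  "Cr_on r f S \<longleftrightarrow>
     (\<exists>D :: nat \<Rightarrow> real \<Rightarrow> real.
        (\<forall>x\<in>S. D 0 x = f x) \<and>
        (\<forall>k<r. \<forall>x\<in>S. (D k has_real_derivative D (Suc k) x) (at x within S)) \<and>
        continuous_on S (D r))"

definition Cr_diffeo :: "nat \<Rightarrow> (real \<Rightarrow> real) \<Rightarrow> real set \<Rightarrow> real set \<Rightarrow> bool" where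
  "Cr_diffeo r f A B \<longleftrightarrow> bij_betw f A B \<and> Cr_on r f A \<and> Cr_on r (inv_into A f) B"

definition interval_partition :: "('d::finite \<Rightarrow> real set) \<Rightarrow> bool" where
  "interval_partition I \<longleftrightarrow>
     (\<forall>j. \<exists>a b. a < b \<and> I j = {a<..<b}) \<and>
     (\<forall>i j. i \<noteq> j \<longrightarrow> I i \<inter> I j = {}) \<and>
     (\<Union>j. I j) \<subseteq> {0..1} \<and> finite ({0..1} - (\<Union>j. I j))"

definition giet :: "nat \<Rightarrow> 'd::finite giet \<Rightarrow> bool" where
  "giet r T \<longleftrightarrow>
     interval_partition (top_int T) \<and> interval_partition (bot_int T) \<and>
     (\<forall>j. bij_betw (gmap T) (top_int T j) (bot_int T j) \<and>
          (\<exists>F. (\<forall>x\<in>top_int T j. F x = gmap T x) \<and>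
               strict_mono_on (closure (top_int T j)) F \<and>
               Cr_diffeo r F (closure (top_int T j)) (closure (bot_int T j))))"

text \<open>The label of the \<open>k\<close>-th interval from the left (junk unless \<open>1 \<le> k \<le> d\<close>).\<close>

definition left_to_right :: "('d::finite \<Rightarrow> real set) \<Rightarrow> nat \<Rightarrow> 'd" where
  "left_to_right I k = (THE j. card {i. Inf (I i) \<le> Inf (I j)} = k)"

definition datum :: "'d::finite giet \<Rightarrow> 'd datum" where
  "datum T = (left_to_right (top_int T), left_to_right (bot_int T))"

definition irreducible_datum :: "'d::finite datum \<Rightarrow> bool" where
  "irreducible_datum \<pi> \<longleftrightarrow> (\<forall>k. 1 \<le> k \<and> k < CARD('d) \<longrightarrow> fst \<pi> ` {1..k} \<noteq> snd \<pi> ` {1..k})"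

definition giet_space :: "nat \<Rightarrow> 'd::finite giet set" where
  "giet_space r = {T. giet r T \<and> irreducible_datum (datum T)}"

text \<open>Translations are smooth, so the regularity \<open>r\<close> is immaterial here.\<close>

definition standard_iet :: "'d::finite giet \<Rightarrow> bool" where
  "standard_iet T \<longleftrightarrow>
     (\<exists>r. T \<in> giet_space r) \<and> (\<forall>j. \<exists>c. \<forall>x\<in>top_int T j. gmap T x = x + c)"

definition shape_log_slope :: "'d::finite giet \<Rightarrow> real ^ 'd" where
  "shape_log_slope T =
     (\<chi> j. ln (measure lborel (bot_int T j) / measure lborel (top_int T j)))"

text \<open>
  Genus of the closed surface glued from a \<open>2d\<close>-gon. The vertices \<open>(Top, 0), \<dots>, (Top, d)\<close> and
  \<open>(Bot, 0), \<dots>, (Bot, d)\<close> run along the upper and the lower boundary (sharing both end points);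
  the upper side number \<open>p\<close> and the lower side number \<open>q\<close> are glued by translation if they carry
  the same label. With \<open>V\<close> vertex classes, \<open>d\<close> edges and one face, \<open>2 - 2g = V - d + 1\<close>.
\<close>

definition vertex_gluing :: "'d::finite datum \<Rightarrow> ((side \<times> nat) \<times> (side \<times> nat)) set" where
  "vertex_gluing \<pi> =
     {((Top, 0), (Bot, 0)), ((Top, CARD('d)), (Bot, CARD('d)))} \<union>
     {((Top, p - e), (Bot, q - e)) | p q e.
        p \<in> {1..CARD('d)} \<and> q \<in> {1..CARD('d)} \<and> e \<in> {0, 1} \<and> fst \<pi> p = snd \<pi> q}"

definition genus :: "'d::finite datum \<Rightarrow> nat" where
  "genus \<pi> =
     (CARD('d) + 1 -
       card ((UNIV \<times> {0..CARD('d)}) // (vertex_gluing \<pi> \<union> (vertex_gluing \<pi>)\<inverse>)\<^sup>*)) div 2"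

section \<open>Renormalization\<close>

text \<open>
  A step is recorded as (combinatorial datum, type), the type telling whether the rightmost top
  or the rightmost bottom interval is the winner.
\<close>

definition winner_of :: "'d::finite datum \<times> side \<Rightarrow> 'd" where
  "winner_of s = (case s of (\<pi>, Top) \<Rightarrow> fst \<pi> CARD('d) | (\<pi>, Bot) \<Rightarrow> snd \<pi> CARD('d))"

definition loser_of :: "'d::finite datum \<times> side \<Rightarrow> 'd" where
  "loser_of s = (case s of (\<pi>, Top) \<Rightarrow> snd \<pi> CARD('d) | (\<pi>, Bot) \<Rightarrow> fst \<pi> CARD('d))"

definition last_top :: "'d::finite giet \<Rightarrow> real" where
  "last_top T = measure lborel (top_int T (fst (datum T) CARD('d)))"

definition last_bot :: "'d::finite giet \<Rightarrow> real" where
  "last_bot T = measure lborel (bot_int T (snd (datum T) CARD('d)))"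

definition rv_type :: "'d::finite giet \<Rightarrow> side" where
  "rv_type T = (if last_top T > last_bot T then Top else Bot)"

definition return_time :: "real set \<Rightarrow> (real \<Rightarrow> real) \<Rightarrow> real \<Rightarrow> nat" where
  "return_time J f x = (LEAST k. 0 < k \<and> (f ^^ k) x \<in> J)"

definition first_return :: "real set \<Rightarrow> (real \<Rightarrow> real) \<Rightarrow> real \<Rightarrow> real" where
  "first_return J f x = (f ^^ return_time J f x) x"

definition total_length :: "'d::finite giet \<Rightarrow> real" where
  "total_length T = Sup (\<Union>j. top_int T j)"

text \<open>
  The elementary step without rescaling. Taking the interior only discards the (finitely many)
  end points of the new continuity intervals.
\<close>

definition rv_induce :: "'d::finite giet \<Rightarrow> 'd giet" where
  "rv_induce T =
     (let J = {0..total_length T - min (last_top T) (last_bot T)};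
          l = loser_of (datum T, rv_type T);
          R = first_return J (gmap T);
          I = (\<lambda>j. interior {x \<in> J \<inter> (\<Union>i. top_int T i).
                 if return_time J (gmap T) x = 2 then j = l else x \<in> top_int T j})
      in \<lparr>gmap = R, top_int = I, bot_int = (\<lambda>j. R ` I j)\<rparr>)"

definition rescale :: "'d::finite giet \<Rightarrow> 'd giet" where
  "rescale T =
     (let L = total_length T
      in \<lparr>gmap = (\<lambda>x. gmap T (L * x) / L),
          top_int = (\<lambda>j. (\<lambda>x. x / L) ` top_int T j),
          bot_int = (\<lambda>j. (\<lambda>x. x / L) ` bot_int T j)\<rparr>)"

definition rv_step :: "'d::finite giet \<Rightarrow> 'd giet" where
  "rv_step T = rescale (rv_induce T)"

definition inf_renormalizable :: "'d::finite giet \<Rightarrow> bool" where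
  "inf_renormalizable T \<longleftrightarrow>
     (\<forall>n. last_top ((rv_step ^^ n) T) \<noteq> last_bot ((rv_step ^^ n) T))"

definition rotation_number :: "'d::finite giet \<Rightarrow> nat \<Rightarrow> 'd datum \<times> side" where
  "rotation_number T n = (datum ((rv_step ^^ n) T), rv_type ((rv_step ^^ n) T))"

definition irrational_rotation :: "(nat \<Rightarrow> 'd::finite datum \<times> side) \<Rightarrow> bool" where
  "irrational_rotation \<gamma> \<longleftrightarrow> (\<forall>j. \<exists>\<^sub>\<infinity>n. winner_of (\<gamma> n) = j)"

definition zorich_block :: "'d::finite giet \<Rightarrow> nat" where
  "zorich_block T = (LEAST m. 0 < m \<and> rv_type ((rv_step ^^ m) T) \<noteq> rv_type T)"

definition zorich :: "'d::finite giet \<Rightarrow> 'd giet" where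
  "zorich T = (rv_step ^^ zorich_block T) T"

text \<open>
  \<open>zorich_return T n\<close> is the map $T_n$, i.e.\ the first return map of \<open>T\<close> to
  \<open>zorich_domain T n\<close> = $I^{(n)}$ before rescaling; its top intervals are the $I^{(n)}_j$.
\<close>

definition zorich_return :: "'d::finite giet \<Rightarrow> nat \<Rightarrow> 'd giet" where
  "zorich_return T n = (rv_induce ^^ (\<Sum>i<n. zorich_block ((zorich ^^ i) T))) T"

definition zorich_domain :: "'d::finite giet \<Rightarrow> nat \<Rightarrow> real set" where
  "zorich_domain T n = {0..total_length (zorich_return T n)}"

definition Q :: "'d::finite giet \<Rightarrow> nat \<Rightarrow> nat \<Rightarrow> real ^ 'd ^ 'd" where
  "Q T m n =
     (\<chi> i j. let f = gmap (zorich_return T m); x = (SOME x. x \<in> top_int (zorich_return T n) i)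
             in real (card {k. k < return_time (zorich_domain T n) f x \<and>
                               (f ^^ k) x \<in> top_int (zorich_return T m) j}))"

section \<open>The Regular Diophantine Condition\<close>

datatype osel = Stab | Cent | Unst

definition splitting :: "(osel \<Rightarrow> (real ^ 'd::finite) set) \<Rightarrow> bool" where
  "splitting E \<longleftrightarrow>
     (\<forall>x. subspace (E x)) \<and>
     (\<forall>v. \<exists>!f. (\<forall>x. f x \<in> E x) \<and> v = f Stab + f Cent + f Unst)"

definition split_proj ::
  "(osel \<Rightarrow> (real ^ 'd::finite) set) \<Rightarrow> osel \<Rightarrow> real ^ 'd \<Rightarrow> real ^ 'd" where
  "split_proj E x v = (THE f. (\<forall>y. f y \<in> E y) \<and> v = f Stab + f Cent + f Unst) x"

definition mnorm :: "real ^ 'd ^ 'd::finite \<Rightarrow> real" where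
  "mnorm A = onorm ((*v) A)"

definition mnorm_on :: "real ^ 'd ^ 'd::finite \<Rightarrow> (real ^ 'd) set \<Rightarrow> real" where
  "mnorm_on A S = (SUP v\<in>S. norm (A *v v) / norm v)"

definition subspace_angle :: "(real ^ 'd::finite) set \<Rightarrow> (real ^ 'd) set \<Rightarrow> real" where
  "subspace_angle E F =
     (INF (v, w) \<in> (E - {0}) \<times> (F - {0}). arccos (v \<bullet> w / (norm v * norm w)))"

text \<open>
  The central space may be trivial (when \<open>d = 2g\<close>); angles with a trivial space are not defined
  and the angle conditions, here and below, are void for them.
\<close>

definition oseledets_extension ::
  "'d::finite giet \<Rightarrow> (osel \<Rightarrow> nat \<Rightarrow> (real ^ 'd) set) \<Rightarrow> bool" where
  "oseledets_extension T \<Gamma> \<longleftrightarrow>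
     (\<forall>n. splitting (\<lambda>x. \<Gamma> x n)) \<and>
     (\<forall>x m n. m \<le> n \<longrightarrow> (*v) (Q T m n) ` \<Gamma> x m = \<Gamma> x n) \<and>
     (\<forall>n. dim (\<Gamma> Stab n) = genus (datum T) \<and> dim (\<Gamma> Unst n) = genus (datum T)) \<and>
     (\<exists>\<theta> C. \<theta> > 0 \<and> C > 0 \<and>
        (\<forall>n. \<forall>v\<in>\<Gamma> Stab 0. norm (Q T 0 n *v v) \<le> C * exp (- \<theta> * real n) * norm v) \<and>
        (\<forall>n. \<forall>v\<in>\<Gamma> Unst n.
           norm (matrix_inv (Q T 0 n) *v v) \<le> C * exp (- \<theta> * real n) * norm v)) \<and>
     (\<forall>v\<in>\<Gamma> Cent 0. v \<noteq> 0 \<longrightarrow> (\<lambda>n. 1 / real n * ln (norm (Q T 0 n *v v))) \<longlonglongrightarrow> 0) \<and>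
     (\<forall>\<epsilon>>0. \<exists>c>0. \<forall>n x y. x \<noteq> y \<and> \<Gamma> x n \<noteq> {0} \<and> \<Gamma> y n \<noteq> {0} \<longrightarrow>
        \<bar>sin (subspace_angle (\<Gamma> x n) (\<Gamma> y n))\<bar> \<ge> c * exp (- \<epsilon> * real n))"

text \<open>
  The good return times are $n_1 < n_2 < \dots$; the value $n_0 = 0$ is a convention,
  imposed in the definition of \<open>rdc_data\<close>, and need not be a good return time.
\<close>

definition good_return_times :: "'d::finite giet \<Rightarrow> (nat \<Rightarrow> nat) \<Rightarrow> bool" where
  "good_return_times T ns \<longleftrightarrow>
     (\<exists>p A. p \<ge> 1 \<and> (\<forall>i j. A $ i $ j > 0) \<and>
        (\<exists>S :: 'd giet. standard_iet S \<and> inf_renormalizable S \<and> A = Q S 0 p) \<and>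
        (\<forall>k\<ge>1. Q T (ns k) (ns k + 2 * p) = A ** A \<and> ns (Suc k) \<ge> ns k + 2 * p))"

definition rdc_data ::
  "'d::finite giet \<Rightarrow> (osel \<Rightarrow> nat \<Rightarrow> (real ^ 'd) set) \<Rightarrow> (nat \<Rightarrow> nat) \<Rightarrow> (nat \<Rightarrow> nat) \<Rightarrow> bool"
where
  "rdc_data T \<Gamma> ns ks \<longleftrightarrow>
     oseledets_extension T \<Gamma> \<and>
     ns 0 = 0 \<and> good_return_times T ns \<and> convergent (\<lambda>k. real (ns k) / real k) \<and>
     strict_mono ks \<and> limsup (\<lambda>m. ereal (real (ks m) / real m)) < \<infinity> \<and>
     (let QQ = (\<lambda>k k'. Q T (ns k) (ns k'));
          Z = (\<lambda>k. QQ k (Suc k));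
          G = (\<lambda>x k. \<Gamma> x (ns k));
          P = (\<lambda>x k. split_proj (\<lambda>y. G y k) x)
      in (\<exists>Km Kp \<delta>. Km > 0 \<and> Kp > 0 \<and> \<delta> > 0 \<and>
           (\<forall>m.
              (\<Sum>k = 1..ks m. mnorm_on (QQ k (ks m)) (G Stab k) * onorm (P Stab k)
                 * mnorm (Z (k - 1))) \<le> Km \<and>
              (let t = (\<lambda>k. mnorm_on (matrix_inv (QQ (ks m) k)) (G Unst k)
                          * onorm (P Unst k) * mnorm (Z (k - 1)))
               in summable (\<lambda>i. t (ks m + 1 + i)) \<and> (\<Sum>i. t (ks m + 1 + i)) \<le> Kp) \<and>
              (\<forall>x y. x \<noteq> y \<and> G x (ks m) \<noteq> {0} \<and> G y (ks m) \<noteq> {0} \<longrightarrow>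
                 subspace_angle (G x (ks m)) (G y (ks m)) > \<delta>))) \<and>
         (\<lambda>m. 1 / real m * ln (mnorm (QQ (ks m) (ks (Suc m))))) \<longlonglongrightarrow> 0)"

definition rotation_rdc_data ::
  "(nat \<Rightarrow> 'd::finite datum \<times> side) \<Rightarrow> (osel \<Rightarrow> nat \<Rightarrow> (real ^ 'd) set) \<Rightarrow>
   (nat \<Rightarrow> nat) \<Rightarrow> (nat \<Rightarrow> nat) \<Rightarrow> bool" where
  "rotation_rdc_data \<gamma> \<Gamma> ns ks \<longleftrightarrow>
     (\<exists>S. standard_iet S \<and> inf_renormalizable S \<and> rotation_number S = \<gamma> \<and> rdc_data S \<Gamma> ns ks)"

text \<open>\<open>T\<close> satisfies the RDC, and \<open>\<Gamma>\<close>, \<open>ns\<close>, \<open>ks\<close> are data witnessing it.\<close>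

definition giet_rdc_data ::
  "'d::finite giet \<Rightarrow> (osel \<Rightarrow> nat \<Rightarrow> (real ^ 'd) set) \<Rightarrow> (nat \<Rightarrow> nat) \<Rightarrow> (nat \<Rightarrow> nat) \<Rightarrow> bool"
where
  "giet_rdc_data T \<Gamma> ns ks \<longleftrightarrow>
     inf_renormalizable T \<and> irrational_rotation (rotation_number T) \<and>
     rotation_rdc_data (rotation_number T) \<Gamma> ns ks"

end

theory Submission
  imports Defs
begin

text \<open>
  Up to distortion, which is bounded uniformly along the whole orbit, the log-slope vectors obey
  \<open>\<omega>\<^sub>n = Q(m,n) \<omega>\<^sub>m + O(\<parallel>Q(m,n)\<parallel>)\<close>. Summing the errors over the good return
  times, condition [B] bounds the stable component of \<open>\<omega>\<close> along the times \<open>n(k\<^sub>m)\<close>, while condition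
  [F] makes the unstable errors pulled back to time \<open>0\<close> summable; their sum produces a vector
  \<open>v \<in> \<Gamma>\<^sub>u\<close> for which the unstable component of \<open>\<omega>\<^sub>n - Q(0,n) v\<close> stays bounded.

  The central component is controlled by the boundary of \<open>T\<close>: for each function on the vertices of
  the glued polygon, the logarithmic derivatives at the end points of the branches, weighted by its
  values, have a sum which renormalization preserves exactly. The coboundaries of these functions form a space
  of dimension at least \<open>d - 2g\<close> on whose elements the dual cocycle acts with bounded norms, so they vanish
  on \<open>\<Gamma>\<^sub>s\<close> and almost vanish on \<open>\<Gamma>\<^sub>u\<close> at late times, and hence detect the central component.

  So \<open>\<omega>\<^sub>n - Q(0,n) v\<close> is bounded along \<open>n(k\<^sub>m)\<close>. If \<open>v = 0\<close> this is recurrence; otherwise \<open>Q(0,n) v\<close> grows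
  exponentially and [S] extends the estimate to all times, which gives shadowing.
\<close>

section \<open>Tilings of an interval\<close>

text \<open>Two maps are involved: the Diophantine data belong to a standard exchange
  \<open>S\<close> with the rotation number of \<open>T\<close>, whereas the log-slopes belong to
  \<open>T\<close>. They meet in the matrices, which turn out to be products of elementary matrices
  read off the rotation number.

  Induction is followed without rescaling and on closed branches: log-slopes are invariant under
  dilations, and the boundary needs derivatives at end points, where \<open>gmap\<close> carries no
  information. The error is a multiple of the norm of Q(m,n) rather than a constant because every
  visit of a return orbit contributes its own distortion; this is what the factor for one return
  step in [B] and [F] pays for.

  In the central space the growth is merely subexponential and gives no summability of errors,
  whence the detour through the boundary. That it supplies enough functionals is a dimension count,
  in which the even rank of the intersection form makes up for the rounding in the definition of the
  genus.\<close>

definition tiling :: "real \<Rightarrow> ('d::finite \<Rightarrow> real) \<Rightarrow> ('d \<Rightarrow> real) \<Rightarrow> bool" where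
  "tiling L a b \<longleftrightarrow>
     (\<forall>j. 0 \<le> a j \<and> a j < b j \<and> b j \<le> L) \<and>
     (\<forall>i j. i \<noteq> j \<longrightarrow> b i \<le> a j \<or> b j \<le> a i) \<and> (\<Sum>j\<in>UNIV. b j - a j) = L"

lemma tilingD:
  assumes "tiling L a b"
  shows "0 \<le> a j" "a j < b j" "b j \<le> L" "i \<noteq> j \<Longrightarrow> b i \<le> a j \<or> b j \<le> a i"
    "(\<Sum>j\<in>UNIV. b j - a j) = L"
  using assms by (auto simp: tiling_def)

lemma tiling_pos: "tiling L a b \<Longrightarrow> 0 < L"
  using tilingD(1-3) by (metis le_less_trans less_le_trans)

lemma tiling_less_iff:
  assumes "tiling L a b" "i \<noteq> j"
  shows "a i < a j \<longleftrightarrow> b i \<le> a j"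
  using tilingD[OF assms(1)] assms(2) by (smt (verit))

lemma tiling_inj: "tiling L a b \<Longrightarrow> inj a"
  by (smt (verit, best) injI tilingD(2,4))

lemma sum_disjoint_lengths_le:
  fixes a b :: "'d::finite \<Rightarrow> real"
  assumes "\<And>j. 0 \<le> a j \<and> a j \<le> b j \<and> b j \<le> B" "\<And>i j. i \<noteq> j \<Longrightarrow> b i \<le> a j \<or> b j \<le> a i"
  shows "(\<Sum>j\<in>UNIV. b j - a j) \<le> B"
proof -
  have "(\<Sum>j\<in>UNIV. b j - a j) = (\<Sum>j\<in>UNIV. measure lborel {a j<..<b j})"
    using assms by (intro sum.cong) auto
  also have "\<dots> = measure lborel (\<Union>j. {a j<..<b j})"
  proof (rule measure_finite_Union[symmetric])
    show "disjoint_family_on (\<lambda>j. {a j<..<b j}) UNIV"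
      unfolding disjoint_family_on_def using assms(2) by (auto simp: disjoint_iff) (smt (verit))
  qed (use assms in auto)
  also have "\<dots> \<le> measure lborel {0..B}"
  proof (rule measure_mono_fmeasurable)
    show "(\<Union>j. {a j<..<b j}) \<subseteq> {0..B}"
    proof
      fix x assume "x \<in> (\<Union>j. {a j<..<b j})"
      then obtain j where "a j < x" "x < b j" by auto
      then show "x \<in> {0..B}" using assms(1)[of j] by auto
    qed
  qed (auto intro: fmeasurable_compact)
  also have "\<dots> = B"
    using assms(1)[of undefined] by auto
  finally show ?thesis .
qed

lemma tiling_last:
  assumes "tiling L a b"
  obtains w where "b w = L" "\<And>j. j \<noteq> w \<Longrightarrow> b j \<le> a w" "\<And>j. b j = L \<Longrightarrow> j = w"
proof -
  obtain w where w: "\<And>j. b j \<le> b w"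
  proof -
    have "Max (range b) \<in> range b" by (intro Max_in) auto
    then obtain w where "Max (range b) = b w" by (rule imageE)
    then show ?thesis using that[of w] by (metis Max_ge finite_class.finite_code finite_imageI rangeI)
  qed
  \<comment> \<open>If the largest right end fell short of \<open>L\<close>, disjoint tiles of total
    length \<open>L\<close> would fit into a shorter interval.\<close>
  have "L \<le> b w"
    unfolding tilingD(5)[OF assms, symmetric]
    by (rule sum_disjoint_lengths_le) (use tilingD[OF assms] w in \<open>auto simp: less_imp_le\<close>)
  then have "b w = L" using tilingD(3)[OF assms] by (simp add: antisym)
  moreover have "b j \<le> a w" if "j \<noteq> w" for j
    using tilingD[OF assms] that w by (metis le_less_trans linorder_not_less)
  ultimately show ?thesis using that[of w] by (metis tilingD(2) assms linorder_not_le)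
qed

lemma tiling_lastD:
  assumes "tiling L a b" "b w = L" "j \<noteq> w"
  shows "b j \<le> a w" "a j < a w" "b j < L"
  using tilingD[OF assms(1)] assms(2,3) by (smt (verit))+

lemma sum_update:
  fixes f :: "'d::finite \<Rightarrow> real"
  shows "(\<Sum>j\<in>UNIV. (f(w := x)) j) = (\<Sum>j\<in>UNIV. f j) - f w + x"
  by (simp add: sum.remove[of UNIV w])

lemma tiling_shrink:
  assumes t: "tiling L a b" and w: "b w = L" and x: "a w < x" "x \<le> L"
  shows "tiling x a (b(w := x))"
  unfolding tiling_def
proof (intro conjI allI impI)
  have "(\<Sum>j\<in>UNIV. (b(w := x)) j - a j) = (\<Sum>j\<in>UNIV. ((\<lambda>j. b j - a j)(w := x - a w)) j)"
    by (intro sum.cong) auto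
  then show "(\<Sum>j\<in>UNIV. (b(w := x)) j - a j) = x"
    unfolding sum_update by (simp add: tilingD(5)[OF t] w)
next
  fix i j :: 'a assume "i \<noteq> j"
  then show "(b(w := x)) i \<le> a j \<or> (b(w := x)) j \<le> a i"
    using tilingD(4)[OF t, of i j] tiling_lastD[OF t w] by auto
qed (use tilingD[OF t] tiling_lastD[OF t w] x in \<open>force+\<close>)

text \<open>The change on the side where the loser is last: its tile is discarded, and its label is
  reused for the right part of the winner's tile, cut at \<open>z\<close>. On the other side the
  winner is last and is merely truncated, as in \<open>tiling_shrink\<close>.\<close>

lemma tiling_split:
  assumes t: "tiling L a b" and l: "b l = L" and "l \<noteq> w" and z: "a w < z" "z < b w"
  shows "tiling (a l) (a(l := z)) (b(l := b w, w := z))"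
  unfolding tiling_def
proof (intro conjI allI impI)
  have "(\<Sum>j\<in>UNIV. (b(l := b w, w := z)) j - (a(l := z)) j) =
      (\<Sum>j\<in>UNIV. ((\<lambda>j. b j - a j)(l := b w - z, w := z - a w)) j)"
    using \<open>l \<noteq> w\<close> by (intro sum.cong) auto
  then show "(\<Sum>j\<in>UNIV. (b(l := b w, w := z)) j - (a(l := z)) j) = a l"
    unfolding sum_update using \<open>l \<noteq> w\<close> tilingD(5)[OF t] l by (simp add: sum_update)
next
  fix i j :: 'a assume "i \<noteq> j"
  then show "(b(l := b w, w := z)) i \<le> (a(l := z)) j \<or> (b(l := b w, w := z)) j \<le> (a(l := z)) i"
    using tilingD(4)[OF t, of i j] tilingD(4)[OF t, of w j] tilingD(4)[OF t, of w i]
      tilingD(2)[OF t, of i] tilingD(2)[OF t, of j] z \<open>l \<noteq> w\<close> by auto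
next
  fix j
  show "0 \<le> (a(l := z)) j" using tilingD(1)[OF t] z(1) by (smt (verit) fun_upd_apply)
  show "(a(l := z)) j < (b(l := b w, w := z)) j" using tilingD(2)[OF t] z \<open>l \<noteq> w\<close> by auto
  show "(b(l := b w, w := z)) j \<le> a l"
    using tiling_lastD(1)[OF t l] \<open>l \<noteq> w\<close> z(2) by (smt (verit) fun_upd_apply)
qed

lemma tiling_Union_Sup:
  assumes "tiling L a b"
  shows "Sup (\<Union>j. {a j<..<b j}) = L"
proof -
  obtain w where w: "b w = L" using tiling_last[OF assms] by metis
  show ?thesis
  proof (rule cSup_eq)
    fix y assume "\<And>x. x \<in> (\<Union>j. {a j<..<b j}) \<Longrightarrow> x \<le> y"
    then have "Sup {a w<..<b w} \<le> y"
      using tilingD(2)[OF assms, of w] by (intro cSup_least) auto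
    then show "L \<le> y" using tilingD(2)[OF assms, of w] w by simp
  next
    fix x assume "x \<in> (\<Union>j. {a j<..<b j})"
    then obtain j where "x < b j" by auto
    then show "x \<le> L" using tilingD(3)[OF assms, of j] by simp
  qed
qed

lemma left_to_right_last:
  fixes a b :: "'d::finite \<Rightarrow> real"
  assumes t: "tiling L a b" and w: "b w = L"
  shows "left_to_right (\<lambda>j. {a j<..<b j}) CARD('d) = w"
proof -
  have [simp]: "Inf {a j<..<b j} = a j" for j
    using tilingD(2)[OF t] by (simp add: cInf_greaterThanLessThan)
  have "{i. a i \<le> a w} = UNIV"
    using tiling_lastD(2)[OF t w] by (metis (mono_tags, lifting) UNIV_eq_I le_less mem_Collect_eq)
  moreover have "j = w" if "card {i. a i \<le> a j} = CARD('d)" for j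
    using that tiling_lastD(2)[OF t w] card_subset_eq[of UNIV "{i. a i \<le> a j}"]
    by (metis UNIV_I finite_class.finite_UNIV mem_Collect_eq not_less subset_UNIV)
  ultimately show ?thesis
    unfolding left_to_right_def by (intro the_equality) auto
qed

section \<open>One step of Rauzy--Veech induction\<close>

text \<open>
  The branch \<open>br j\<close> lives on the closed interval from \<open>lf j\<close> to \<open>rt j\<close>. The logarithm of its derivative is
  \<open>ld j\<close>, and the increments of \<open>vr j\<close> dominate those of \<open>ld j\<close>; both are irrelevant for standard
  interval exchanges.
\<close>

record 'd branches =
  len :: real
  lf :: "'d \<Rightarrow> real"
  rt :: "'d \<Rightarrow> real"
  br :: "'d \<Rightarrow> real \<Rightarrow> real"
  ld :: "'d \<Rightarrow> real \<Rightarrow> real"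
  vr :: "'d \<Rightarrow> real \<Rightarrow> real"

abbreviation "cl s j \<equiv> br s j (lf s j)"
abbreviation "cr s j \<equiv> br s j (rt s j)"

definition well_formed :: "'d::finite branches \<Rightarrow> bool" where
  "well_formed s \<longleftrightarrow> tiling (len s) (lf s) (rt s) \<and> tiling (len s) (cl s) (cr s) \<and>
     (\<forall>j. strict_mono_on {lf s j..rt s j} (br s j) \<and> continuous_on {lf s j..rt s j} (br s j))"

text \<open>Irreducibility without enumerations: no proper set of labels is initial in both orders
  of left end points. In this form its behaviour under a step can be checked directly.\<close>

definition indecomposable :: "'d::finite branches \<Rightarrow> bool" where
  "indecomposable s \<longleftrightarrow>
     \<not> (\<exists>A. A \<noteq> {} \<and> A \<noteq> UNIV \<and> (\<forall>i\<in>A. \<forall>j\<in>-A. lf s i < lf s j \<and> cl s i < cl s j))"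

definition represents :: "'d::finite branches \<Rightarrow> 'd giet \<Rightarrow> bool" where
  "represents s T \<longleftrightarrow>
     (\<forall>j. top_int T j = {lf s j<..<rt s j} \<and> bot_int T j = {cl s j<..<cr s j} \<and>
          (\<forall>x\<in>{lf s j<..<rt s j}. gmap T x = br s j x))"

definition toplast :: "'d::finite branches \<Rightarrow> 'd" where
  "toplast s = (THE j. rt s j = len s)"

definition botlast :: "'d::finite branches \<Rightarrow> 'd" where
  "botlast s = (THE j. cr s j = len s)"

text \<open>Both last intervals end at \<open>len s\<close>, so the longer one is the one that
  starts further left.\<close>

definition st_type :: "'d::finite branches \<Rightarrow> side" where
  "st_type s = (if cl s (botlast s) > lf s (toplast s) then Top else Bot)"

definition winner :: "'d::finite branches \<Rightarrow> 'd" where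
  "winner s = (if st_type s = Top then toplast s else botlast s)"

definition loser :: "'d::finite branches \<Rightarrow> 'd" where
  "loser s = (if st_type s = Top then botlast s else toplast s)"

text \<open>The loser's tile is mapped onto the removed piece, which lies inside the winner's tile;
  hence the loser keeps its domain and is followed by the winner's branch.\<close>

definition step_top :: "'d branches \<Rightarrow> 'd \<Rightarrow> 'd \<Rightarrow> 'd branches" where
  "step_top s w l = s\<lparr>len := cl s l, rt := (rt s)(w := cl s l),
     br := (br s)(l := \<lambda>x. br s w (br s l x)),
     ld := (ld s)(l := \<lambda>x. ld s l x + ld s w (br s l x)),
     vr := (vr s)(l := \<lambda>x. vr s l x + vr s w (br s l x))\<rparr>"

definition cut_point :: "'d branches \<Rightarrow> 'd \<Rightarrow> 'd \<Rightarrow> real" where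
  "cut_point s w l = (THE y. lf s w < y \<and> y < rt s w \<and> br s w y = lf s l)"

text \<open>Here the points that leave the shortened interval lie in the winner's tile, to the right
  of the cut point. They are sent onto the loser's old tile, which is being removed, and inherit its
  label.\<close>

definition step_bot :: "'d branches \<Rightarrow> 'd \<Rightarrow> 'd \<Rightarrow> 'd branches" where
  "step_bot s w l = s\<lparr>len := lf s l,
     lf := (lf s)(l := cut_point s w l), rt := (rt s)(l := rt s w, w := cut_point s w l),
     br := (br s)(l := \<lambda>x. br s l (br s w x)),
     ld := (ld s)(l := \<lambda>x. ld s w x + ld s l (br s w x)),
     vr := (vr s)(l := \<lambda>x. vr s w x + vr s l (br s w x))\<rparr>"

definition st_step :: "'d::finite branches \<Rightarrow> 'd branches" where
  "st_step s = (if st_type s = Top then step_top s (winner s) (loser s)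
                else step_bot s (winner s) (loser s))"

lemma well_formedD:
  assumes "well_formed s"
  shows "tiling (len s) (lf s) (rt s)" "tiling (len s) (cl s) (cr s)"
    "strict_mono_on {lf s j..rt s j} (br s j)" "continuous_on {lf s j..rt s j} (br s j)"
  using assms by (auto simp: well_formed_def)

lemma br_image:
  assumes "strict_mono_on {a..b} f" "continuous_on {a..b} f" "a \<le> x" "x < y" "y \<le> (b::real)"
  shows "f ` {x<..<y} = {f x<..<(f y::real)}" "f ` {x..y} = {f x..f y}"
proof -
  have sm: "f u < f v" if "x \<le> u" "u < v" "v \<le> y" for u v
    using that assms by (intro strict_mono_onD[OF assms(1)]) auto
  have ct: "continuous_on {x..y} f" by (rule continuous_on_subset[OF assms(2)]) (use assms in auto)
  have ex: "\<exists>u. x \<le> u \<and> u \<le> y \<and> f u = z" if "f x \<le> z" "z \<le> f y" for z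
    using IVT'[of f x z y] that assms(4) ct by auto
  show "f ` {x<..<y} = {f x<..<f y}"
  proof (intro equalityI subsetI)
    fix z assume z: "z \<in> {f x<..<f y}"
    then obtain u where u: "x \<le> u" "u \<le> y" "f u = z" using ex[of z] by auto
    then have "x \<noteq> u" "u \<noteq> y" using z by auto
    then show "z \<in> f ` {x<..<y}" using u by (intro image_eqI[of _ _ u]) auto
  qed (auto intro!: sm)
  show "f ` {x..y} = {f x..f y}"
  proof (intro equalityI subsetI)
    fix z assume z: "z \<in> {f x..f y}"
    then show "z \<in> f ` {x..y}" using ex[of z] by force
  next
    fix z assume "z \<in> f ` {x..y}"
    then obtain u where "x \<le> u" "u \<le> y" "z = f u" by auto
    then show "z \<in> {f x..f y}" using sm[of x u] sm[of u y] by (cases "x = u"; cases "u = y") auto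
  qed
qed

lemma br_less:
  assumes "well_formed s" "lf s j \<le> x" "x < y" "y \<le> rt s j"
  shows "br s j x < br s j y"
  using assms well_formedD(3)[OF assms(1), of j] by (intro strict_mono_onD[OF well_formedD(3)]) auto

lemma toplast:
  assumes "well_formed s"
  shows "rt s (toplast s) = len s" "rt s j = len s \<Longrightarrow> toplast s = j"
proof -
  obtain w where "rt s w = len s" "\<And>j. rt s j = len s \<Longrightarrow> j = w"
    using tiling_last[OF well_formedD(1)[OF assms]] by metis
  then have "toplast s = w" unfolding toplast_def by blast
  then show "rt s (toplast s) = len s" "rt s j = len s \<Longrightarrow> toplast s = j"
    using \<open>rt s w = len s\<close> by (simp, metis \<open>\<And>j. rt s j = len s \<Longrightarrow> j = w\<close>)
qed

lemma botlast:
  assumes "well_formed s"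
  shows "cr s (botlast s) = len s" "cr s j = len s \<Longrightarrow> botlast s = j"
proof -
  obtain w where "cr s w = len s" "\<And>j. cr s j = len s \<Longrightarrow> j = w"
    using tiling_last[OF well_formedD(2)[OF assms]] by metis
  then have "botlast s = w" unfolding botlast_def by blast
  then show "cr s (botlast s) = len s" "cr s j = len s \<Longrightarrow> botlast s = j"
    using \<open>cr s w = len s\<close> by (simp, metis \<open>\<And>j. cr s j = len s \<Longrightarrow> j = w\<close>)
qed

text \<open>If one label were last on both sides, all the others would form a common initial block,
  nonempty because there are at least two labels.\<close>

lemma toplast_neq_botlast:
  fixes s :: "'d::finite branches"
  assumes wf: "well_formed s" and ind: "indecomposable s" and d: "CARD('d) \<ge> 2"
  shows "toplast s \<noteq> botlast s"
proof
  assume eq: "toplast s = botlast s"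
  let ?A = "- {toplast s}"
  have "?A \<noteq> {}"
  proof
    assume "?A = {}"
    then have "(UNIV :: 'd set) = {toplast s}" by auto
    then have "CARD('d) = 1" by (metis card_1_singleton_iff One_nat_def)
    then show False using d by simp
  qed
  moreover have "\<forall>i\<in>?A. \<forall>j\<in>-?A. lf s i < lf s j \<and> cl s i < cl s j"
    using tiling_lastD(2)[OF well_formedD(1)[OF wf] toplast(1)[OF wf]]
      tiling_lastD(2)[OF well_formedD(2)[OF wf] botlast(1)[OF wf]] eq by auto
  moreover have "?A \<noteq> UNIV" by auto
  ultimately show False using ind unfolding indecomposable_def by blast
qed

definition ready :: "'d::finite branches \<Rightarrow> bool" where
  "ready s \<longleftrightarrow> well_formed s \<and> indecomposable s \<and> toplast s \<noteq> botlast s \<and>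
     lf s (toplast s) \<noteq> cl s (botlast s)"

lemma ready_top:
  assumes "ready s" "st_type s = Top"
  shows "well_formed s" "winner s \<noteq> loser s" "rt s (winner s) = len s" "cr s (loser s) = len s"
    "lf s (winner s) < cl s (loser s)" "st_step s = step_top s (winner s) (loser s)"
  using assms toplast(1)[of s] botlast(1)[of s]
  by (auto simp: ready_def winner_def loser_def st_step_def st_type_def split: if_splits)

lemma ready_bot:
  assumes "ready s" "st_type s \<noteq> Top"
  shows "well_formed s" "winner s \<noteq> loser s" "rt s (loser s) = len s" "cr s (winner s) = len s"
    "cl s (winner s) < lf s (loser s)" "st_step s = step_bot s (winner s) (loser s)"
  using assms toplast(1)[of s] botlast(1)[of s]
  by (auto simp: ready_def winner_def loser_def st_step_def st_type_def split: if_splits)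

lemma cut_point:
  assumes wf: "well_formed s" and "cl s w < lf s l" "lf s l < cr s w"
  shows "lf s w < cut_point s w l" "cut_point s w l < rt s w" "br s w (cut_point s w l) = lf s l"
proof -
  have "lf s l \<in> br s w ` {lf s w<..<rt s w}"
    using br_image(1)[OF well_formedD(3,4)[OF wf], of w "lf s w" "rt s w"]
      tilingD(2)[OF well_formedD(1)[OF wf], of w] assms by auto
  then obtain y where y: "lf s w < y" "y < rt s w" "br s w y = lf s l" by auto
  have "lf s w < cut_point s w l \<and> cut_point s w l < rt s w \<and> br s w (cut_point s w l) = lf s l"
    unfolding cut_point_def
  proof (rule theI[of _ y])
    fix z assume "lf s w < z \<and> z < rt s w \<and> br s w z = lf s l"
    then show "z = y" using br_less[OF wf, of w z y] br_less[OF wf, of w y z] y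
      by (metis less_irrefl less_imp_le linorder_neqE)
  qed (use y in auto)
  then show "lf s w < cut_point s w l" "cut_point s w l < rt s w" "br s w (cut_point s w l) = lf s l" by auto
qed

lemma ready_cut:
  assumes "ready s" "st_type s \<noteq> Top"
  shows "lf s (winner s) < cut_point s (winner s) (loser s)" "cut_point s (winner s) (loser s) < rt s (winner s)"
    "br s (winner s) (cut_point s (winner s) (loser s)) = lf s (loser s)"
proof -
  note r = ready_bot[OF assms]
  have "lf s (loser s) < cr s (winner s)"
    unfolding r(4) using tilingD(2)[OF well_formedD(1)[OF r(1)], of "loser s"] r(3) by simp
  then show "lf s (winner s) < cut_point s (winner s) (loser s)" "cut_point s (winner s) (loser s) < rt s (winner s)"
    "br s (winner s) (cut_point s (winner s) (loser s)) = lf s (loser s)" using cut_point[OF r(1,5)] by auto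
qed

lemma strict_mono_continuous_compose:
  fixes f g :: "real \<Rightarrow> real"
  assumes "strict_mono_on A f" "continuous_on A f" "strict_mono_on B g" "continuous_on B g" "f ` A \<subseteq> B"
  shows "strict_mono_on A (\<lambda>x. g (f x))" "continuous_on A (\<lambda>x. g (f x))"
proof -
  show "strict_mono_on A (\<lambda>x. g (f x))"
    using assms(1,3,5) unfolding strict_mono_on_def by (simp add: image_subset_iff)
  show "continuous_on A (\<lambda>x. g (f x))"
    using assms by (intro continuous_on_compose2[OF assms(4,2)])
qed

text \<open>A top step shrinks the top tiling and splits the bottom one; a bottom step does the
  reverse.\<close>

lemma well_formed_step:
  assumes r: "ready s"
  shows "well_formed (st_step s)"
proof (cases "st_type s = Top")
  case True
  define w l where "w = winner s" and "l = loser s"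
  note r = ready_top[OF r True, folded w_def l_def]
  note t = well_formedD(1,2)[OF r(1)] and m = well_formedD(3,4)[OF r(1)]
  have L: "cl s l < len s" using tilingD(2)[OF t(2), of l] r(4) by simp
  \<comment> \<open>The image of the winner's new right end; the loser's new image fills the rest of
    the winner's old image.\<close>
  define z where "z = br s w (cl s l)"
  have z: "cl s w < z" "z < cr s w"
    using br_less[OF r(1), of w] r(3,5) L unfolding z_def by auto
  have im: "br s l ` {lf s l..rt s l} = {cl s l..len s}"
    using br_image(2)[OF m, of l "lf s l" "rt s l"] tilingD(2)[OF t(1), of l] r(4) by simp
  have "tiling (cl s l) (lf s) ((rt s)(w := cl s l))"
    by (rule tiling_shrink[OF t(1) r(3)]) (use r L in auto)
  moreover have "tiling (cl s l) ((cl s)(l := z)) ((cr s)(l := cr s w, w := z))"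
    by (rule tiling_split[OF t(2) r(4)]) (use r z in auto)
  moreover have "cl (st_step s) = (cl s)(l := z)"
    using r by (auto simp: step_top_def z_def)
  moreover have "cr (st_step s) = (cr s)(l := cr s w, w := z)"
    using r by (auto simp: step_top_def z_def)
  moreover have "strict_mono_on {lf s l..rt s l} (\<lambda>x. br s w (br s l x))"
      "continuous_on {lf s l..rt s l} (\<lambda>x. br s w (br s l x))"
    by (rule strict_mono_continuous_compose[OF m m]; use im r in auto)+
  moreover have "strict_mono_on {lf s w..cl s l} (br s w)" "continuous_on {lf s w..cl s l} (br s w)"
    using m[of w] L r(3) by (auto intro: monotone_on_subset continuous_on_subset)
  ultimately show ?thesis
    unfolding well_formed_def using m r by (auto simp: step_top_def)
next
  case False
  define w l where "w = winner s" and "l = loser s"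
  note y = ready_cut[OF r False, folded w_def l_def]
  note r = ready_bot[OF r False, folded w_def l_def]
  note t = well_formedD(1,2)[OF r(1)] and m = well_formedD(3,4)[OF r(1)]
  have L: "lf s l < len s" using tilingD(2)[OF t(1), of l] r(3) by simp
  have im: "br s w ` {cut_point s w l..rt s w} = {lf s l..len s}"
    using br_image(2)[OF m, of w "cut_point s w l" "rt s w"] y r(4) by simp
  have "tiling (lf s l) (cl s) ((cr s)(w := lf s l))"
    by (rule tiling_shrink[OF t(2) r(4)]) (use r L in auto)
  moreover have "tiling (lf s l) ((lf s)(l := cut_point s w l)) ((rt s)(l := rt s w, w := cut_point s w l))"
    by (rule tiling_split[OF t(1) r(3)]) (use r y in auto)
  moreover have "cl (st_step s) = cl s"
    using r y by (auto simp: step_bot_def)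
  moreover have "cr (st_step s) = (cr s)(w := lf s l)"
    using r y by (auto simp: step_bot_def)
  moreover have "strict_mono_on {cut_point s w l..rt s w} (\<lambda>x. br s l (br s w x))"
      "continuous_on {cut_point s w l..rt s w} (\<lambda>x. br s l (br s w x))"
  proof -
    have *: "strict_mono_on {cut_point s w l..rt s w} (br s w)" "continuous_on {cut_point s w l..rt s w} (br s w)"
      using m[of w] y by (auto intro: monotone_on_subset continuous_on_subset)
    show "strict_mono_on {cut_point s w l..rt s w} (\<lambda>x. br s l (br s w x))"
      "continuous_on {cut_point s w l..rt s w} (\<lambda>x. br s l (br s w x))"
      by (rule strict_mono_continuous_compose[OF * m[of l]]; use im r in auto)+
  qed
  moreover have "strict_mono_on {lf s w..cut_point s w l} (br s w)" "continuous_on {lf s w..cut_point s w l} (br s w)"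
    using m[of w] y by (auto intro: monotone_on_subset continuous_on_subset)
  ultimately show ?thesis
    unfolding well_formed_def using m r by (auto simp: step_bot_def)
qed

lemma step_top_sel [simp]:
  "len (step_top s w l) = cl s l" "lf (step_top s w l) = lf s"
  "rt (step_top s w l) = (rt s)(w := cl s l)"
  "br (step_top s w l) = (br s)(l := \<lambda>x. br s w (br s l x))"
  "ld (step_top s w l) = (ld s)(l := \<lambda>x. ld s l x + ld s w (br s l x))"
  "vr (step_top s w l) = (vr s)(l := \<lambda>x. vr s l x + vr s w (br s l x))"
  by (simp_all add: step_top_def)

lemma step_bot_sel [simp]:
  "len (step_bot s w l) = lf s l" "lf (step_bot s w l) = (lf s)(l := cut_point s w l)"
  "rt (step_bot s w l) = (rt s)(l := rt s w, w := cut_point s w l)"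
  "br (step_bot s w l) = (br s)(l := \<lambda>x. br s l (br s w x))"
  "ld (step_bot s w l) = (ld s)(l := \<lambda>x. ld s w x + ld s l (br s w x))"
  "vr (step_bot s w l) = (vr s)(l := \<lambda>x. vr s w x + vr s l (br s w x))"
  by (simp_all add: step_bot_def)

text \<open>A proper common initial block after the step cannot contain the winner, which is last in
  one of the orders, nor then the loser, which now comes after the winner in the other. Since the
  block avoids the loser, it was already initial when the loser stood last.\<close>

lemma indecomposable_step:
  assumes r: "ready s"
  shows "indecomposable (st_step s)"
proof -
  have ind: "indecomposable s" using r by (simp add: ready_def)
  have key: False
    if A: "A \<noteq> {}" "A \<noteq> UNIV"
      "\<forall>i\<in>A. \<forall>j\<in>-A. p' i < p' j \<and> q' i < q' j"
      and p: "\<And>j. j \<noteq> w \<Longrightarrow> p j < p w" and q: "\<And>j. j \<noteq> l \<Longrightarrow> q j < q l"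
      and p': "p' = p" and q': "\<And>j. j \<noteq> l \<Longrightarrow> q' j = q j" "q w < q' l" and "w \<noteq> l"
      and ind: "\<not> (\<exists>A. A \<noteq> {} \<and> A \<noteq> UNIV \<and> (\<forall>i\<in>A. \<forall>j\<in>-A. p i < p j \<and> q i < q j))"
    for A :: "'a set" and p q p' q' :: "'a \<Rightarrow> real" and w l
  proof -
    have wA: "w \<notin> A" using A p by (metis Compl_iff UNIV_eq_I less_asym p')
    have lA: "l \<notin> A" using wA A(3) q' \<open>w \<noteq> l\<close> by (metis Compl_iff less_asym)
    have "\<forall>i\<in>A. \<forall>j\<in>-A. p i < p j \<and> q i < q j"
    proof (intro ballI)
      fix i j assume ij: "i \<in> A" "j \<in> - A"
      then have "p i < p j \<and> q' i < q' j" using A(3) p' by auto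
      moreover have "i \<noteq> l" using ij lA by auto
      ultimately show "p i < p j \<and> q i < q j" using q q' by (cases "j = l") auto
    qed
    then show False using ind A(1,2) by blast
  qed
  show ?thesis
  proof (cases "st_type s = Top")
    case True
    define w l where "w = winner s" and "l = loser s"
    note r = ready_top[OF r True, folded w_def l_def]
    note t = well_formedD(1,2)[OF r(1)]
    have L: "cl s l < len s" using tilingD(2)[OF t(2), of l] r(4) by simp
    show ?thesis unfolding indecomposable_def
    proof (intro notI, elim exE conjE)
      fix A assume A: "A \<noteq> {}" "A \<noteq> UNIV"
        and *: "\<forall>i\<in>A. \<forall>j\<in>-A. lf (st_step s) i < lf (st_step s) j \<and> cl (st_step s) i < cl (st_step s) j"
      show False
        by (rule key[OF A *, where p = "lf s" and q = "cl s" and w = w and l = l])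
          (use r tiling_lastD(2)[OF t(1) r(3)] tiling_lastD(2)[OF t(2) r(4)] ind L
            br_less[OF r(1), of w "lf s w" "cl s l"] in \<open>auto simp: indecomposable_def\<close>)
    qed
  next
    case False
    define w l where "w = winner s" and "l = loser s"
    note y = ready_cut[OF r False, folded w_def l_def]
    note r = ready_bot[OF r False, folded w_def l_def]
    note t = well_formedD(1,2)[OF r(1)]
    have cl: "cl (st_step s) = cl s" using r y by auto
    show ?thesis unfolding indecomposable_def
    proof (intro notI, elim exE conjE)
      fix A assume A: "A \<noteq> {}" "A \<noteq> UNIV"
        and "\<forall>i\<in>A. \<forall>j\<in>-A. lf (st_step s) i < lf (st_step s) j \<and> cl (st_step s) i < cl (st_step s) j"
      then have *: "\<forall>i\<in>A. \<forall>j\<in>-A. cl (st_step s) i < cl (st_step s) j \<and> lf (st_step s) i < lf (st_step s) j"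
        by blast
      show False
        by (rule key[OF A *, where p = "cl s" and q = "lf s" and w = w and l = l])
          (use r y cl tiling_lastD(2)[OF t(1) r(3)] tiling_lastD(2)[OF t(2) r(4)] ind
            in \<open>auto simp: indecomposable_def\<close>)
    qed
  qed
qed

section \<open>The combinatorial step as a first return map\<close>

lemma total_length_represents:
  assumes "represents s T" "well_formed s"
  shows "total_length T = len s"
  using tiling_Union_Sup[OF well_formedD(1)[OF assms(2)]] assms(1)
  by (simp add: total_length_def represents_def)

lemma represents_last:
  fixes T :: "'d::finite giet"
  assumes "represents s T" "well_formed s"
  shows "fst (datum T) CARD('d) = toplast s" "snd (datum T) CARD('d) = botlast s"
    "last_top T = len s - lf s (toplast s)" "last_bot T = len s - cl s (botlast s)"
    "rv_type T = st_type s"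
    "winner_of (datum T, rv_type T) = winner s" "loser_of (datum T, rv_type T) = loser s"
proof -
  note t = well_formedD(1,2)[OF assms(2)]
  have ti: "top_int T = (\<lambda>j. {lf s j<..<rt s j})" "bot_int T = (\<lambda>j. {cl s j<..<cr s j})"
    using assms(1) by (auto simp: represents_def)
  show 1: "fst (datum T) CARD('d) = toplast s" "snd (datum T) CARD('d) = botlast s"
    unfolding datum_def ti using left_to_right_last[OF t(1) toplast(1)[OF assms(2)]]
      left_to_right_last[OF t(2) botlast(1)[OF assms(2)]] by simp_all
  show 2: "last_top T = len s - lf s (toplast s)" "last_bot T = len s - cl s (botlast s)"
    unfolding last_top_def last_bot_def 1 ti
    using tilingD(2)[OF t(1), of "toplast s"] tilingD(2)[OF t(2), of "botlast s"]
      toplast(1)[OF assms(2)] botlast(1)[OF assms(2)] by simp_all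
  show 3: "rv_type T = st_type s"
    by (auto simp: rv_type_def st_type_def 2)
  show "winner_of (datum T, rv_type T) = winner s" "loser_of (datum T, rv_type T) = loser s"
    unfolding 3 by (cases "st_type s"; simp add: winner_of_def loser_of_def winner_def loser_def 1)+
qed

lemma return_time_1: "f x \<in> J \<Longrightarrow> return_time J f x = 1"
  unfolding return_time_def by (rule Least_equality) auto

lemma return_time_2:
  assumes "f x \<notin> J" "f (f x) \<in> J"
  shows "return_time J f x = 2"
  unfolding return_time_def
proof (rule Least_equality)
  show "0 < (2::nat) \<and> (f ^^ 2) x \<in> J" using assms by (simp add: numeral_2_eq_2)
next
  fix k :: nat assume k: "0 < k \<and> (f ^^ k) x \<in> J"
  have "k \<noteq> 1" using k assms(1) by (metis funpow_simps_right(1) One_nat_def funpow.simps comp_apply id_apply)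
  then show "2 \<le> k" using k by linarith
qed

text \<open>The unordered pair \<open>{i, i'}\<close> treats both types at once: the points
  relabelled by the loser pass through loser and winner for a top step, through winner and loser for
  a bottom step. The order does not affect visit counts.\<close>

lemma first_return_step:
  assumes rep: "represents s T" and rdy: "ready s"
    and x: "lf (st_step s) j < x" "x < rt (st_step s) j"
  defines "J \<equiv> {0..len (st_step s)}"
  shows "j \<noteq> loser s \<Longrightarrow> lf s j < x \<and> x < rt s j \<and> gmap T x \<in> J \<and> gmap T x = br (st_step s) j x"
    "j = loser s \<Longrightarrow> \<exists>i i'. {i, i'} = {winner s, loser s} \<and> lf s i < x \<and> x < rt s i \<and> gmap T x \<notin> J \<and>
       lf s i' < gmap T x \<and> gmap T x < rt s i' \<and> gmap T (gmap T x) \<in> J \<and>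
       gmap T (gmap T x) = br (st_step s) j x"
proof -
  have f: "gmap T x = br s j x" if "lf s j < x" "x < rt s j" for j x
    using rep that by (auto simp: represents_def)
  have wf': "well_formed (st_step s)" by (rule well_formed_step[OF rdy])
  have imJ: "br (st_step s) j x \<in> J"
    using br_less[OF wf', of j "lf (st_step s) j" x] br_less[OF wf', of j x "rt (st_step s) j"] x
      tilingD(1,3)[OF well_formedD(2)[OF wf'], of j] by (auto simp: J_def)
  define w l where "w = winner s" and "l = loser s"
  have "(j \<noteq> l \<longrightarrow> lf s j < x \<and> x < rt s j \<and> gmap T x \<in> J \<and> gmap T x = br (st_step s) j x) \<and>
    (j = l \<longrightarrow> (\<exists>i i'. {i, i'} = {w, l} \<and> lf s i < x \<and> x < rt s i \<and> gmap T x \<notin> J \<and>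
       lf s i' < gmap T x \<and> gmap T x < rt s i' \<and> gmap T (gmap T x) \<in> J \<and>
       gmap T (gmap T x) = br (st_step s) j x))"
  proof (cases "st_type s = Top")
    case True
    note r = ready_top[OF rdy True, folded w_def l_def]
    note t = well_formedD(1,2)[OF r(1)]
    have L: "cl s l < len s" using tilingD(2)[OF t(2), of l] r(4) by simp
    show ?thesis
    proof (cases "j = l")
      case False
      then have "lf s j < x" "x < rt s j" using x r L by (auto split: if_splits)
      moreover have "br (st_step s) j = br s j" using r False by simp
      ultimately show ?thesis using f False imJ by auto
    next
      case True
      then have xx: "lf s l < x" "x < rt s l" using x r by auto
      then have fx: "gmap T x = br s l x" "cl s l < br s l x" "br s l x < len s"
        using f br_less[OF r(1), of l "lf s l" x] br_less[OF r(1), of l x "rt s l"] r(4) by auto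
      then have ffx: "gmap T (gmap T x) = br s w (br s l x)"
        using f[of w "br s l x"] r by auto
      have "gmap T (gmap T x) \<in> J" using imJ r ffx True by simp
      moreover have "gmap T x \<notin> J" using fx r by (auto simp: J_def)
      moreover have "{l, w} = {w, l}" by auto
      ultimately show ?thesis
        using xx fx ffx True r by (intro conjI impI exI[of _ l] exI[of _ w]) auto
    qed
  next
    case False
    note y = ready_cut[OF rdy False, folded w_def l_def]
    note r = ready_bot[OF rdy False, folded w_def l_def]
    note t = well_formedD(1,2)[OF r(1)]
    show ?thesis
    proof (cases "j = l")
      case False
      then have "lf s j < x" "x < rt s j" using x r y by (auto split: if_splits)
      moreover have "br (st_step s) j = br s j" using r False by simp
      ultimately show ?thesis using f False imJ by auto
    next
      case True
      then have xx: "cut_point s w l < x" "x < rt s w" using x r by auto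
      then have fx: "gmap T x = br s w x" "lf s l < br s w x" "br s w x < len s"
        using f y br_less[OF r(1), of w "cut_point s w l" x] br_less[OF r(1), of w x "rt s w"] r(4) by auto
      then have ffx: "gmap T (gmap T x) = br s l (br s w x)"
        using f[of l "br s w x"] r by auto
      have "gmap T (gmap T x) \<in> J" using imJ r ffx True by simp
      moreover have "gmap T x \<notin> J" using fx r by (auto simp: J_def)
      ultimately show ?thesis
        using xx y fx ffx True r by (intro conjI impI exI[of _ w] exI[of _ l]) auto
    qed
  qed
  then show "j \<noteq> loser s \<Longrightarrow> lf s j < x \<and> x < rt s j \<and> gmap T x \<in> J \<and> gmap T x = br (st_step s) j x"
    "j = loser s \<Longrightarrow> \<exists>i i'. {i, i'} = {winner s, loser s} \<and> lf s i < x \<and> x < rt s i \<and> gmap T x \<notin> J \<and>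
       lf s i' < gmap T x \<and> gmap T x < rt s i' \<and> gmap T (gmap T x) \<in> J \<and>
       gmap T (gmap T x) = br (st_step s) j x" by (auto simp: w_def l_def)
qed

lemma return_time_step:
  assumes rep: "represents s T" and rdy: "ready s"
    and x: "lf (st_step s) j < x" "x < rt (st_step s) j"
  defines "J \<equiv> {0..len (st_step s)}"
  shows "return_time J (gmap T) x = (if j = loser s then 2 else 1)"
    "first_return J (gmap T) x = br (st_step s) j x"
proof -
  note f = first_return_step[OF rep rdy x, folded J_def]
  show rt: "return_time J (gmap T) x = (if j = loser s then 2 else 1)"
  proof (cases "j = loser s")
    case True
    then obtain "gmap T x \<notin> J" "gmap T (gmap T x) \<in> J" using f(2) by blast
    then show ?thesis using return_time_2 True by metis
  next
    case False
    then show ?thesis using f(1) return_time_1 by metis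
  qed
  show "first_return J (gmap T) x = br (st_step s) j x"
  proof (cases "j = loser s")
    case True
    then have "gmap T (gmap T x) = br (st_step s) j x" using f(2) by blast
    then show ?thesis using rt True by (simp add: first_return_def numeral_2_eq_2)
  next
    case False
    then show ?thesis using f(1) rt by (simp add: first_return_def)
  qed
qed

text \<open>The only points not covered by the new continuity intervals are the end point of the
  winner's interval and, for a bottom step, the cut point.\<close>

lemma step_points:
  assumes rdy: "ready s" and x: "x \<le> len (st_step s)" "lf s i < x" "x < rt s i"
  shows "(\<exists>j. lf (st_step s) j < x \<and> x < rt (st_step s) j \<and>
           (j \<noteq> loser s \<longrightarrow> i = j)) \<or> (i = winner s \<and> x = rt (st_step s) (winner s))"
proof -
  define w l where "w = winner s" and "l = loser s"
  have "(\<exists>j. lf (st_step s) j < x \<and> x < rt (st_step s) j \<and> (j \<noteq> l \<longrightarrow> i = j)) \<or> (i = w \<and> x = rt (st_step s) w)"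
  proof (cases "st_type s = Top")
    case True
    note r = ready_top[OF rdy True, folded w_def l_def]
    show ?thesis
    proof (cases "i = w \<and> x = rt (st_step s) w")
      case False
      then show ?thesis using x r by (intro disjI1 exI[of _ i]) (auto split: if_splits)
    qed auto
  next
    case False
    note y = ready_cut[OF rdy False, folded w_def l_def]
    note r = ready_bot[OF rdy False, folded w_def l_def]
    have "i \<noteq> l" using x r by auto
    show ?thesis
    proof (cases "i = w \<and> x = rt (st_step s) w")
      case False
      show ?thesis
      proof (cases "i = w \<and> x > cut_point s w l")
        case True
        then show ?thesis using x r y by (intro disjI1 exI[of _ l]) auto
      next
        case F: False
        then show ?thesis using x r y False \<open>i \<noteq> l\<close> by (intro disjI1 exI[of _ i]) (auto split: if_splits)
      qed
    qed auto
  qed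
  then show ?thesis by (simp add: w_def l_def)
qed

text \<open>The set whose interior defines a new continuity interval is squeezed between an open
  interval and its closure, so its interior is known without deciding which end points belong to
  it.\<close>

lemma represents_induce:
  assumes rep: "represents s T" and rdy: "ready s"
  shows "represents (st_step s) (rv_induce T)"
proof -
  have wf: "well_formed s" using rdy by (simp add: ready_def)
  have wf': "well_formed (st_step s)" by (rule well_formed_step[OF rdy])
  note t = well_formedD(1)[OF wf] and t' = well_formedD(1,2)[OF wf']
  note rl = represents_last[OF rep wf]
  define J where "J = {0..len (st_step s)}"
  define R where "R = first_return J (gmap T)"
  define S where "S j = {x \<in> J \<inter> (\<Union>i. top_int T i).
    if return_time J (gmap T) x = 2 then j = loser s else x \<in> top_int T j}" for j
  have top: "top_int T j = {lf s j<..<rt s j}" for j using rep by (auto simp: represents_def)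
  have "len (st_step s) = total_length T - min (last_top T) (last_bot T)"
    unfolding rl total_length_represents[OF rep wf]
    using ready_top[OF rdy] ready_bot[OF rdy]
    by (cases "st_type s = Top") (auto simp: winner_def loser_def)
  then have ind: "rv_induce T = \<lparr>gmap = R, top_int = (\<lambda>j. interior (S j)), bot_int = (\<lambda>j. R ` interior (S j))\<rparr>"
    unfolding rv_induce_def Let_def rl(7) J_def R_def S_def by simp
  note rt = return_time_step[OF rep rdy, folded J_def]
  have I: "interior (S j) = {lf (st_step s) j<..<rt (st_step s) j}" for j
  proof (rule antisym)
    have "{lf (st_step s) j<..<rt (st_step s) j} \<subseteq> S j"
    proof
      fix x assume "x \<in> {lf (st_step s) j<..<rt (st_step s) j}"
      then have x: "lf (st_step s) j < x" "x < rt (st_step s) j" by auto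
      have xJ: "x \<in> J" using x tilingD(1,3)[OF t'(1), of j] by (auto simp: J_def)
      show "x \<in> S j"
      proof (cases "j = loser s")
        case True
        then obtain i where "lf s i < x \<and> x < rt s i"
          using first_return_step(2)[OF rep rdy x] by blast
        then show ?thesis using True xJ rt(1)[OF x] by (auto simp: S_def top)
      next
        case False
        then show ?thesis using first_return_step(1)[OF rep rdy x] xJ rt(1)[OF x] by (auto simp: S_def top)
      qed
    qed
    then show "{lf (st_step s) j<..<rt (st_step s) j} \<subseteq> interior (S j)"
      by (rule interior_maximal) simp
    have "S j \<subseteq> {lf (st_step s) j..rt (st_step s) j}"
    proof
      fix x assume xS: "x \<in> S j"
      then obtain i where i: "lf s i < x" "x < rt s i" by (auto simp: S_def top)
      have xJ: "x \<in> J" using xS by (auto simp: S_def)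
      have uniq: "i = k" if "x \<in> top_int T k" for k
        using tilingD(4)[OF t, of i k] i that by (force simp: top)
      consider (a) j' where "lf (st_step s) j' < x" "x < rt (st_step s) j'" "j' \<noteq> loser s \<longrightarrow> i = j'"
        | (b) "i = winner s" "x = rt (st_step s) (winner s)"
        using step_points[OF rdy _ i] xJ by (auto simp: J_def)
      then show "x \<in> {lf (st_step s) j..rt (st_step s) j}"
      proof cases
        case a
        have "j = j'"
          using xS rt(1)[OF a(1,2)] a(3) uniq[of j] by (auto simp: S_def split: if_splits)
        then show ?thesis using a by auto
      next
        \<comment> \<open>The right end of the winner's shortened tile still returns after one step,
          because its image is an end point of a new bottom tile; it therefore keeps the winner's
          label and is an end point of the correct interval.\<close>
        case b
        have "winner s \<noteq> loser s" using ready_top(2)[OF rdy] ready_bot(2)[OF rdy] by blast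
        then have "br (st_step s) (winner s) = br s (winner s)"
          using ready_top(6)[OF rdy] ready_bot(6)[OF rdy] by (cases "st_type s = Top") auto
        moreover have "gmap T x = br s i x" using rep i by (auto simp: represents_def)
        ultimately have "gmap T x = cr (st_step s) (winner s)" using b by simp
        then have "gmap T x \<in> J"
          using tilingD(1-3)[OF t'(2), of "winner s"] by (auto simp: J_def)
        then have "return_time J (gmap T) x = 1" by (rule return_time_1)
        then have "x \<in> top_int T j" using xS by (auto simp: S_def)
        then have "j = winner s" using uniq[of j] b by simp
        then show ?thesis using b tilingD(2)[OF t'(1), of "winner s"] by auto
      qed
    qed
    then have "interior (S j) \<subseteq> interior {lf (st_step s) j..rt (st_step s) j}" by (rule interior_mono)
    then show "interior (S j) \<subseteq> {lf (st_step s) j<..<rt (st_step s) j}" by simp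
  qed
  have R: "R x = br (st_step s) j x" if "x \<in> {lf (st_step s) j<..<rt (st_step s) j}" for x j
    using that rt(2) by (auto simp: R_def)
  have "R ` {lf (st_step s) j<..<rt (st_step s) j} = {cl (st_step s) j<..<cr (st_step s) j}" for j
  proof -
    have "R ` {lf (st_step s) j<..<rt (st_step s) j} = br (st_step s) j ` {lf (st_step s) j<..<rt (st_step s) j}"
      by (rule image_cong[OF refl R])
    then show ?thesis
      using br_image(1)[OF well_formedD(3,4)[OF wf'], of j "lf (st_step s) j" "rt (st_step s) j"]
        tilingD(2)[OF t'(1), of j] by simp
  qed
  then show ?thesis
    unfolding represents_def ind using R I by auto
qed

text \<open>With a free factor in place of the total length, successive rescalings compose and
  commute with induction, so all of them can be postponed to the end.\<close>

definition scale_giet :: "real \<Rightarrow> 'd::finite giet \<Rightarrow> 'd giet" where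
  "scale_giet c T = \<lparr>gmap = (\<lambda>x. gmap T (c * x) / c), top_int = (\<lambda>j. (\<lambda>x. x / c) ` top_int T j),
     bot_int = (\<lambda>j. (\<lambda>x. x / c) ` bot_int T j)\<rparr>"

lemma rescale_eq_scale: "rescale T = scale_giet (total_length T) T"
  by (simp add: rescale_def scale_giet_def Let_def)

lemma scale_scale: "scale_giet c (scale_giet e T) = scale_giet (e * c) T"
  by (simp add: scale_giet_def image_image mult.assoc[symmetric])

lemma scale_1: "scale_giet 1 T = (T :: 'd::finite giet)"
  by (simp add: scale_giet_def)

lemma divide_image_interval:
  assumes "(c::real) > 0"
  shows "(\<lambda>x. x / c) ` {a<..<b} = {a/c<..<b/c}" "(\<lambda>x. x / c) ` {a..b} = {a/c..b/c}"
proof -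
  show "(\<lambda>x. x / c) ` {a<..<b} = {a/c<..<b/c}"
  proof (intro equalityI subsetI)
    fix y assume "y \<in> {a/c<..<b/c}"
    then show "y \<in> (\<lambda>x. x / c) ` {a<..<b}"
      using assms by (intro image_eqI[of _ _ "y * c"]) (auto simp: field_simps)
  qed (use assms in \<open>auto simp: divide_strict_right_mono\<close>)
  show "(\<lambda>x. x / c) ` {a..b} = {a/c..b/c}"
  proof (intro equalityI subsetI)
    fix y assume "y \<in> {a/c..b/c}"
    then show "y \<in> (\<lambda>x. x / c) ` {a..b}"
      using assms by (intro image_eqI[of _ _ "y * c"]) (auto simp: field_simps)
  qed (use assms in \<open>auto simp: divide_right_mono\<close>)
qed

lemma scale_invariants:
  fixes T :: "'d::finite giet"
  assumes rep: "represents s T" and wf: "well_formed s" and c: "c > 0"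
  shows "total_length (scale_giet c T) = total_length T / c" "datum (scale_giet c T) = datum T"
    "last_top (scale_giet c T) = last_top T / c" "last_bot (scale_giet c T) = last_bot T / c"
    "rv_type (scale_giet c T) = rv_type T" "shape_log_slope (scale_giet c T) = shape_log_slope T"
proof -
  note t = well_formedD(1,2)[OF wf]
  have top: "top_int T = (\<lambda>j. {lf s j<..<rt s j})" "bot_int T = (\<lambda>j. {cl s j<..<cr s j})"
    using rep by (auto simp: represents_def)
  have sc: "top_int (scale_giet c T) = (\<lambda>j. {lf s j / c<..<rt s j / c})"
    "bot_int (scale_giet c T) = (\<lambda>j. {cl s j / c<..<cr s j / c})"
    by (simp_all add: scale_giet_def top divide_image_interval[OF c])
  have tl: "tiling (len s / c) (\<lambda>j. lf s j / c) (\<lambda>j. rt s j / c)"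
    using t(1) c unfolding tiling_def
    by (auto simp: divide_le_cancel divide_strict_right_mono sum_divide_distrib[symmetric] diff_divide_distrib[symmetric])
  show 1: "total_length (scale_giet c T) = total_length T / c"
    unfolding total_length_represents[OF rep wf] unfolding total_length_def sc by (rule tiling_Union_Sup[OF tl])
  have ltr: "left_to_right (\<lambda>j. {a j / c<..<b j / c}) = left_to_right (\<lambda>j. {a j<..<b j})"
    if "\<And>j. a j < b j" for a b :: "'d \<Rightarrow> real"
    using that c by (simp add: left_to_right_def divide_strict_right_mono divide_le_cancel fun_eq_iff)
  show 2: "datum (scale_giet c T) = datum T"
    unfolding datum_def sc top using ltr[of "lf s" "rt s"] ltr[of "cl s" "cr s"]
      tilingD(2)[OF t(1)] tilingD(2)[OF t(2)] by simp
  have m: "measure lborel {a / c<..<b / c} = measure lborel {a<..<b} / c" if "a < b" for a b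
    using that c by (simp add: divide_le_cancel diff_divide_distrib less_imp_le divide_strict_right_mono)
  show 3: "last_top (scale_giet c T) = last_top T / c" "last_bot (scale_giet c T) = last_bot T / c"
    unfolding last_top_def last_bot_def 2 sc top
    using m[OF tilingD(2)[OF t(1)]] m[OF tilingD(2)[OF t(2)]] by metis+
  show "rv_type (scale_giet c T) = rv_type T" unfolding rv_type_def 3 using c by (simp add: divide_less_cancel)
  show "shape_log_slope (scale_giet c T) = shape_log_slope T"
    unfolding shape_log_slope_def sc top m[OF tilingD(2)[OF t(1)]] m[OF tilingD(2)[OF t(2)]] using c by simp
qed

lemma rv_induce_scale:
  fixes T :: "'d::finite giet"
  assumes rep: "represents s T" and wf: "well_formed s" and c: "c > 0"
  shows "rv_induce (scale_giet c T) = scale_giet c (rv_induce T)"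
proof -
  note inv = scale_invariants[OF assms]
  define J where "J = {0..total_length T - min (last_top T) (last_bot T)}"
  define J' where "J' = {0..total_length (scale_giet c T) - min (last_top (scale_giet c T)) (last_bot (scale_giet c T))}"
  define f where "f = gmap T"
  define f' where "f' = gmap (scale_giet c T)"
  have J': "x \<in> J' \<longleftrightarrow> c * x \<in> J" for x
  proof -
    have "min (last_top T / c) (last_bot T / c) = min (last_top T) (last_bot T) / c"
      using c by (simp add: min_def divide_le_cancel)
    then show ?thesis unfolding J'_def J_def inv using c
      by (simp add: diff_divide_distrib[symmetric] pos_le_divide_eq mult.commute zero_le_mult_iff)
  qed
  have it: "(f' ^^ k) x = (f ^^ k) (c * x) / c" for k x
    using c by (induction k) (auto simp: f'_def f_def scale_giet_def)
  have rt: "return_time J' f' x = return_time J f (c * x)" for x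
    unfolding return_time_def J' it using c by simp
  have fr: "first_return J' f' x = first_return J f (c * x) / c" for x
    unfolding first_return_def rt it ..
  define S where "S j = {x \<in> J \<inter> (\<Union>i. top_int T i).
    if return_time J f x = 2 then j = loser_of (datum T, rv_type T) else x \<in> top_int T j}" for j
  have mem: "x \<in> (\<lambda>x. x / c) ` A \<longleftrightarrow> c * x \<in> A" for x A
    using c by (auto simp: image_iff) (metis nonzero_mult_div_cancel_left less_irrefl)
  have S': "{x \<in> J' \<inter> (\<Union>i. top_int (scale_giet c T) i).
      if return_time J' f' x = 2 then j = loser_of (datum T, rv_type T) else x \<in> top_int (scale_giet c T) j}
      = (\<lambda>x. x / c) ` S j" for j
  proof (rule set_eqI)
    fix x
    have "x \<in> top_int (scale_giet c T) i \<longleftrightarrow> c * x \<in> top_int T i" for i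
      unfolding scale_giet_def by (simp only: giet.simps mem)
    then show "x \<in> {x \<in> J' \<inter> (\<Union>i. top_int (scale_giet c T) i).
      if return_time J' f' x = 2 then j = loser_of (datum T, rv_type T) else x \<in> top_int (scale_giet c T) j}
      \<longleftrightarrow> x \<in> (\<lambda>x. x / c) ` S j"
      unfolding mem S_def by (simp add: J' rt)
  qed
  have int: "interior ((\<lambda>x. x / c) ` A) = (\<lambda>x. x / c) ` interior A" for A
  proof (rule interior_injective_linear_image)
    show "linear (\<lambda>x. x / c)" by (rule linearI) (auto simp: add_divide_distrib)
    show "inj (\<lambda>x. x / c)" using c by (auto intro: injI)
  qed
  have "rv_induce (scale_giet c T) = \<lparr>gmap = first_return J' f', top_int = (\<lambda>j. interior ((\<lambda>x. x / c) ` S j)),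
      bot_int = (\<lambda>j. first_return J' f' ` interior ((\<lambda>x. x / c) ` S j))\<rparr>"
    unfolding rv_induce_def Let_def J'_def[symmetric] f'_def[symmetric] inv(2,5) S' ..
  also have "\<dots> = scale_giet c (rv_induce T)"
    unfolding rv_induce_def Let_def J_def[symmetric] f_def[symmetric] S_def[symmetric] scale_giet_def int
    using c by (auto simp: fun_eq_iff fr image_image)
  finally show ?thesis .
qed

section \<open>Orbits and the cocycle\<close>

locale rauzy_orbit =
  fixes T :: "'d::finite giet" and s0 :: "'d branches"
  assumes card_ge_2: "CARD('d) \<ge> 2"
    and rep0: "represents s0 T" and wf0: "well_formed s0" and ind0: "indecomposable s0"
    and len0: "len s0 = 1" and renorm: "inf_renormalizable T"
begin

definition st :: "nat \<Rightarrow> 'd branches" where "st n = (st_step ^^ n) s0"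

definition ind_map :: "nat \<Rightarrow> 'd giet" where "ind_map n = (rv_induce ^^ n) T"

lemma st_Suc: "st (Suc n) = st_step (st n)" and st_0: "st 0 = s0"
  by (simp_all add: st_def)

lemma ind_map_Suc: "ind_map (Suc n) = rv_induce (ind_map n)" and ind_map_0: "ind_map 0 = T"
  by (simp_all add: ind_map_def)

lemma orbit:
  "represents (st n) (ind_map n) \<and> well_formed (st n) \<and> indecomposable (st n) \<and>
     (rv_step ^^ n) T = scale_giet (len (st n)) (ind_map n) \<and> ready (st n)"
proof (induction n)
  \<comment> \<open>Renormalizability speaks of the rescaled iterates; the inequality between the
    last lengths survives the division by the common factor.\<close>
  have rdy: "ready (st n)" if "represents (st n) (ind_map n)" "well_formed (st n)"
      "indecomposable (st n)" "(rv_step ^^ n) T = scale_giet (len (st n)) (ind_map n)" for n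
  proof -
    have c: "len (st n) > 0" using tiling_pos[OF well_formedD(1)[OF that(2)]] .
    have "last_top ((rv_step ^^ n) T) \<noteq> last_bot ((rv_step ^^ n) T)"
      using renorm by (simp add: inf_renormalizable_def)
    then have "last_top (ind_map n) \<noteq> last_bot (ind_map n)"
      unfolding that(4) scale_invariants(3,4)[OF that(1,2) c] by auto
    then show ?thesis
      unfolding represents_last[OF that(1,2)] ready_def
      using that(2,3) toplast_neq_botlast[OF that(2,3) card_ge_2] by auto
  qed
  case 0
  show ?case using rdy[of 0] by (simp add: st_0 ind_map_0 rep0 wf0 ind0 len0 scale_1)
  case (Suc n)
  then have IH: "represents (st n) (ind_map n)" "well_formed (st n)" "indecomposable (st n)"
     "(rv_step ^^ n) T = scale_giet (len (st n)) (ind_map n)" "ready (st n)" by auto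
  have c: "len (st n) > 0" using tiling_pos[OF well_formedD(1)[OF IH(2)]] .
  have 1: "represents (st (Suc n)) (ind_map (Suc n))"
    unfolding st_Suc ind_map_Suc by (rule represents_induce[OF IH(1,5)])
  have 2: "well_formed (st (Suc n))" unfolding st_Suc by (rule well_formed_step[OF IH(5)])
  have 3: "indecomposable (st (Suc n))" unfolding st_Suc by (rule indecomposable_step[OF IH(5)])
  have "(rv_step ^^ Suc n) T = rescale (scale_giet (len (st n)) (ind_map (Suc n)))"
    by (simp add: IH(4) rv_step_def rv_induce_scale[OF IH(1,2) c] ind_map_Suc)
  also have "\<dots> = scale_giet (len (st (Suc n))) (ind_map (Suc n))"
    unfolding rescale_eq_scale scale_scale scale_invariants(1)[OF 1 2 c]
      total_length_represents[OF 1 2] using c by simp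
  finally show ?case using rdy[OF 1 2 3] 1 2 3 by blast
qed

lemma orbitD:
  shows "represents (st n) (ind_map n)" "well_formed (st n)" "ready (st n)"
    "(rv_step ^^ n) T = scale_giet (len (st n)) (ind_map n)" "len (st n) > 0"
  using orbit[of n] tiling_pos well_formedD(1) by auto

lemma rotation_winner:
  "winner_of (rotation_number T n) = winner (st n)" "loser_of (rotation_number T n) = loser (st n)"
  unfolding rotation_number_def orbitD(4) scale_invariants(2,5)[OF orbitD(1,2,5)]
  by (rule represents_last[OF orbitD(1,2)])+

lemma shape_log_slope_orbit:
  "shape_log_slope ((rv_step ^^ n) T) = (\<chi> j. ln ((cr (st n) j - cl (st n) j) / (rt (st n) j - lf (st n) j)))"
proof -
  have "measure lborel {lf (st n) j<..<rt (st n) j} = rt (st n) j - lf (st n) j"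
    "measure lborel {cl (st n) j<..<cr (st n) j} = cr (st n) j - cl (st n) j" for j
    using tilingD(2)[OF well_formedD(1)[OF orbitD(2)], of n j]
      tilingD(2)[OF well_formedD(2)[OF orbitD(2)], of n j] by (simp_all add: less_imp_le)
  then show ?thesis
    using orbitD(1)[of n]
    unfolding orbitD(4) scale_invariants(6)[OF orbitD(1,2,5)] unfolding shape_log_slope_def represents_def
    by simp
qed

end

section \<open>Cocycle matrices as visit counts\<close>

definition elem_matrix :: "'d \<Rightarrow> 'd \<Rightarrow> real ^ 'd ^ 'd::finite" where
  "elem_matrix w l = (\<chi> i j. if i = j \<or> (i = l \<and> j = w) then 1 else 0)"

text \<open>A function of the rotation number alone. This is what allows \<open>S\<close> and
  \<open>T\<close> to share one cocycle.\<close>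

primrec rv_matrix :: "(nat \<Rightarrow> 'd datum \<times> side) \<Rightarrow> nat \<Rightarrow> nat \<Rightarrow> real ^ 'd ^ 'd::finite" where
  "rv_matrix \<gamma> m 0 = mat 1"
| "rv_matrix \<gamma> m (Suc k) =
     elem_matrix (winner_of (\<gamma> (m + k))) (loser_of (\<gamma> (m + k))) ** rv_matrix \<gamma> m k"

text \<open>The loser's row receives the winner's row, just as the loser's new return orbit is made
  of the old orbits of both.\<close>

lemma elem_matrix_mult:
  fixes A :: "real ^ 'd ^ 'd::finite"
  assumes "w \<noteq> l"
  shows "(elem_matrix w l ** A) $ i $ j = A $ i $ j + (if i = l then A $ w $ j else 0)"
proof -
  have "(elem_matrix w l ** A) $ i $ j =
      (\<Sum>k\<in>UNIV. (if k = i then A $ k $ j else 0) + (if k = w then (if i = l then A $ k $ j else 0) else 0))"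
    unfolding matrix_matrix_mult_def elem_matrix_def using assms by (auto intro!: sum.cong)
  then show ?thesis by (simp add: sum.distrib)
qed

lemma elem_matrix_vec:
  fixes v :: "real ^ 'd::finite"
  assumes "w \<noteq> l"
  shows "(elem_matrix w l *v v) $ i = v $ i + (if i = l then v $ w else 0)"
proof -
  have "(elem_matrix w l *v v) $ i =
      (\<Sum>k\<in>UNIV. (if k = i then v $ k else 0) + (if k = w then (if i = l then v $ k else 0) else 0))"
    unfolding matrix_vector_mult_def elem_matrix_def using assms by (auto intro!: sum.cong)
  then show ?thesis by (simp add: sum.distrib)
qed

lemma rv_matrix_add:
  "rv_matrix \<gamma> m (k + k') = rv_matrix \<gamma> (m + k) k' ** rv_matrix \<gamma> m k"
  by (induction k') (simp_all add: matrix_mul_assoc add.assoc)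

context rauzy_orbit
begin

abbreviation "\<gamma> \<equiv> rotation_number T"

lemma winner_neq_loser: "winner (st n) \<noteq> loser (st n)"
  using ready_top(2)[OF orbitD(3)] ready_bot(2)[OF orbitD(3)] by blast

lemma rv_matrix_Suc:
  "rv_matrix \<gamma> m (Suc k) $ i $ j =
     rv_matrix \<gamma> m k $ i $ j + (if i = loser (st (m + k)) then rv_matrix \<gamma> m k $ winner (st (m + k)) $ j else 0)"
  by (simp add: rotation_winner elem_matrix_mult[OF winner_neq_loser])

lemma len_step_le: "len (st (Suc n)) \<le> len (st n)"
proof -
  note wf = orbitD(2)[of n]
  show ?thesis
    using ready_top(6)[OF orbitD(3)] ready_bot(6)[OF orbitD(3)]
      tilingD(2,3)[OF well_formedD(1)[OF wf], of "loser (st n)"]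
      tilingD(2,3)[OF well_formedD(2)[OF wf], of "loser (st n)"]
    by (cases "st_type (st n) = Top") (auto simp: st_Suc)
qed

lemma top_int_ind_map: "x \<in> top_int (ind_map n) j \<longleftrightarrow> lf (st n) j < x \<and> x < rt (st n) j"
  using orbitD(1)[of n] by (auto simp: represents_def)

text \<open>The induction concatenates orbits. An orbit of the loser consists of two segments from
  the previous level, of lengths \<open>q\<close> and \<open>p\<close>, whose junction lies outside
  the smaller interval; so there is no premature return, and the visit counts add like the rows of
  the matrix.\<close>

lemma visits:
  fixes m :: nat
  defines "f \<equiv> gmap (ind_map m)"
  assumes "x \<in> top_int (ind_map (m + k)) i"
  shows "\<exists>q>0. (f ^^ q) x = gmap (ind_map (m + k)) x \<and>
     (\<forall>h. 0 < h \<and> h < q \<longrightarrow> (f ^^ h) x \<notin> {0..len (st (m + k))}) \<and>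
     (\<forall>j. real (card {h. h < q \<and> (f ^^ h) x \<in> top_int (ind_map m) j}) = rv_matrix \<gamma> m k $ i $ j)"
  using assms(2)
proof (induction k arbitrary: x i)
  case 0
  have "{h. h < 1 \<and> (f ^^ h) x \<in> top_int (ind_map m) j} = (if i = j then {0} else {})" for j
    using 0 tilingD(4)[OF well_formedD(1)[OF orbitD(2)], of i j m] by (auto simp: top_int_ind_map)
  then show ?case by (intro exI[of _ 1]) (auto simp: f_def mat_def)
next
  case (Suc k)
  let ?s = "st (m + k)"
  let ?g = "gmap (ind_map (m + k))"
  note R = rv_matrix_Suc[of m k]
  have x: "lf (st_step ?s) i < x" "x < rt (st_step ?s) i"
    using Suc.prems by (auto simp: top_int_ind_map st_Suc)
  have gx: "gmap (ind_map (m + Suc k)) x = br (st_step ?s) i x"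
    using orbitD(1)[of "m + Suc k"] x by (auto simp: represents_def st_Suc)
  note fr = first_return_step[OF orbitD(1,3) x, folded st_Suc]
  have sub: "y \<in> {0..len (st (m + k))}" if "y \<in> {0..len (st (m + Suc k))}" for y
    using that len_step_le[of "m + k"] by auto
  show ?case
  proof (cases "i = loser ?s")
    case False
    then have old: "x \<in> top_int (ind_map (m + k)) i" "?g x = gmap (ind_map (m + Suc k)) x"
      using fr(1) gx by (auto simp: top_int_ind_map st_Suc)
    obtain q where q: "q > 0" "(f ^^ q) x = ?g x"
      "\<And>h. 0 < h \<and> h < q \<Longrightarrow> (f ^^ h) x \<notin> {0..len (st (m + k))}"
      "\<And>j. real (card {h. h < q \<and> (f ^^ h) x \<in> top_int (ind_map m) j}) = rv_matrix \<gamma> m k $ i $ j"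
      using Suc.IH[OF old(1)] by blast
    have "\<forall>h. 0 < h \<and> h < q \<longrightarrow> (f ^^ h) x \<notin> {0..len (st (m + Suc k))}"
      using q(3) sub by blast
    then show ?thesis
      using q(1,2,4) False old(2) unfolding R by (intro exI[of _ q]) simp
  next
    case True
    then obtain a b where ab: "{a, b} = {winner ?s, loser ?s}" "x \<in> top_int (ind_map (m + k)) a"
      "?g x \<notin> {0..len (st (Suc (m + k)))}" "?g x \<in> top_int (ind_map (m + k)) b"
      "?g (?g x) = gmap (ind_map (m + Suc k)) x"
      using fr(2) gx by (auto simp: top_int_ind_map st_Suc)
    obtain q where q: "q > 0" "(f ^^ q) x = ?g x"
      "\<And>h. 0 < h \<and> h < q \<Longrightarrow> (f ^^ h) x \<notin> {0..len (st (m + k))}"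
      "\<And>j. real (card {h. h < q \<and> (f ^^ h) x \<in> top_int (ind_map m) j}) = rv_matrix \<gamma> m k $ a $ j"
      using Suc.IH[OF ab(2)] by blast
    obtain p where p: "p > 0" "(f ^^ p) (?g x) = ?g (?g x)"
      "\<And>h. 0 < h \<and> h < p \<Longrightarrow> (f ^^ h) (?g x) \<notin> {0..len (st (m + k))}"
      "\<And>j. real (card {h. h < p \<and> (f ^^ h) (?g x) \<in> top_int (ind_map m) j}) = rv_matrix \<gamma> m k $ b $ j"
      using Suc.IH[OF ab(4)] by blast
    have it: "(f ^^ (h + q)) x = (f ^^ h) (?g x)" for h
      by (simp add: funpow_add q(2))
    have "(f ^^ h) x \<notin> {0..len (st (m + Suc k))}" if h: "0 < h" "h < p + q" for h
    proof (cases "h < q")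
      case True
      then show ?thesis using q(3) sub h by blast
    next
      case False
      then obtain h' where h': "h = h' + q" by (metis add.commute le_Suc_ex not_less)
      show ?thesis
      proof (cases "h' = 0")
        case True
        then show ?thesis using h' q(2) ab(3) by simp
      next
        case False
        then show ?thesis using h' it p(3)[of h'] sub h by auto
      qed
    qed
    moreover have "real (card {h. h < p + q \<and> (f ^^ h) x \<in> top_int (ind_map m) j}) =
        rv_matrix \<gamma> m (Suc k) $ i $ j" for j
    proof -
      let ?A = "{h. h < q \<and> (f ^^ h) x \<in> top_int (ind_map m) j}"
      let ?B = "{h. h < p \<and> (f ^^ h) (?g x) \<in> top_int (ind_map m) j}"
      have "{h. h < p + q \<and> (f ^^ h) x \<in> top_int (ind_map m) j} = ?A \<union> (\<lambda>h. h + q) ` ?B"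
      proof (intro equalityI subsetI)
        fix h assume h: "h \<in> {h. h < p + q \<and> (f ^^ h) x \<in> top_int (ind_map m) j}"
        show "h \<in> ?A \<union> (\<lambda>h. h + q) ` ?B"
        proof (cases "h < q")
          case False
          then obtain h' where h': "h = h' + q" by (metis add.commute le_Suc_ex not_less)
          then have "h' \<in> ?B" using h it by auto
          then show ?thesis using h' by auto
        qed (use h in auto)
      qed (auto simp: it)
      moreover have "card (?A \<union> (\<lambda>h. h + q) ` ?B) = card ?A + card ((\<lambda>h. h + q) ` ?B)"
        by (rule card_Un_disjoint) auto
      moreover have "card ((\<lambda>h. h + q) ` ?B) = card ?B" by (rule card_image) (auto intro: inj_onI)
      ultimately have "real (card {h. h < p + q \<and> (f ^^ h) x \<in> top_int (ind_map m) j}) =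
          rv_matrix \<gamma> m k $ a $ j + rv_matrix \<gamma> m k $ b $ j" using q(4) p(4) by simp
      also have "\<dots> = rv_matrix \<gamma> m (Suc k) $ i $ j"
        unfolding R using True ab(1) by (auto simp: doubleton_eq_iff)
      finally show ?thesis .
    qed
    ultimately show ?thesis
      using q(1) it p(2) ab(5) by (intro exI[of _ "p + q"]) auto
  qed
qed

definition ztime :: "nat \<Rightarrow> nat" where "ztime n = (\<Sum>i<n. zorich_block ((zorich ^^ i) T))"

lemma zorich_pow: "(zorich ^^ n) T = (rv_step ^^ ztime n) T"
proof (induction n)
  case (Suc n)
  have "(zorich ^^ Suc n) T = (rv_step ^^ zorich_block ((zorich ^^ n) T)) ((zorich ^^ n) T)"
    by (simp add: zorich_def)
  also have "\<dots> = (rv_step ^^ ztime (Suc n)) T"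
    unfolding ztime_def sum.lessThan_Suc add.commute[of "sum _ _"] funpow_add comp_apply
    by (simp only: Suc ztime_def[symmetric])
  finally show ?case .
qed (simp add: ztime_def)

lemma ztime_mono: "m \<le> n \<Longrightarrow> ztime m \<le> ztime n"
  unfolding ztime_def by (intro sum_mono2) auto

lemma zorich_return_eq: "zorich_return T n = ind_map (ztime n)"
  by (simp add: zorich_return_def ind_map_def ztime_def)

lemma zorich_domain_eq: "zorich_domain T n = {0..len (st (ztime n))}"
  by (simp add: zorich_domain_def zorich_return_eq total_length_represents[OF orbitD(1,2)])

lemma Q_eq:
  assumes "m \<le> n"
  shows "Q T m n = rv_matrix \<gamma> (ztime m) (ztime n - ztime m)"
proof -
  define f where "f = gmap (ind_map (ztime m))"
  have n: "ztime n = ztime m + (ztime n - ztime m)" using ztime_mono[OF assms] by simp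
  have "Q T m n $ i $ j = rv_matrix \<gamma> (ztime m) (ztime n - ztime m) $ i $ j" for i j
  proof -
    \<comment> \<open>All points of the interval have the same visit counts, so the arbitrary choice
      in the definition of \<open>Q\<close> does no harm.\<close>
    define x where "x = (SOME x. x \<in> top_int (ind_map (ztime n)) i)"
    have "\<exists>x. x \<in> top_int (ind_map (ztime n)) i"
      using dense[OF tilingD(2)[OF well_formedD(1)[OF orbitD(2)]]] unfolding top_int_ind_map by blast
    then have x: "x \<in> top_int (ind_map (ztime n)) i" unfolding x_def by (rule someI_ex)
    obtain q where q: "q > 0" "(f ^^ q) x = gmap (ind_map (ztime n)) x"
     "\<And>h. 0 < h \<and> h < q \<Longrightarrow> (f ^^ h) x \<notin> {0..len (st (ztime n))}"
     "\<And>j. real (card {h. h < q \<and> (f ^^ h) x \<in> top_int (ind_map (ztime m)) j}) =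
          rv_matrix \<gamma> (ztime m) (ztime n - ztime m) $ i $ j"
      using visits[of x "ztime m" "ztime n - ztime m" i] x unfolding n[symmetric] f_def by blast
    let ?s = "st (ztime n)"
    have "gmap (ind_map (ztime n)) x = br ?s i x"
      using orbitD(1)[of "ztime n"] x unfolding top_int_ind_map by (auto simp: represents_def)
    \<comment> \<open>That the orbit does return after \<open>q\<close> iterates is seen from the
      branch: its image lies in the domain.\<close>
    then have "gmap (ind_map (ztime n)) x \<in> {0..len ?s}"
      using x br_less[OF orbitD(2), of "ztime n" i "lf ?s i" x] br_less[OF orbitD(2), of "ztime n" i x "rt ?s i"]
        tilingD(1,3)[OF well_formedD(2)[OF orbitD(2)], of "ztime n" i] unfolding top_int_ind_map by auto
    then have "return_time {0..len ?s} f x = q"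
      unfolding return_time_def using q by (intro Least_equality) (auto simp: not_less[symmetric])
    then show ?thesis
      unfolding Q_def zorich_return_eq zorich_domain_eq Let_def f_def[symmetric] x_def[symmetric]
      by (simp add: x_def[symmetric] q(4))
  qed
  then show ?thesis by (simp add: vec_eq_iff)
qed

text \<open>Block lengths are determined by the types in the rotation number, so equal rotation
  numbers give equal Zorich times.\<close>

lemma ztime_Suc:
  "ztime (Suc n) = ztime n + (LEAST m. 0 < m \<and> snd (\<gamma> (m + ztime n)) \<noteq> snd (\<gamma> (ztime n)))"
proof -
  have "zorich_block ((zorich ^^ n) T) = (LEAST m. 0 < m \<and> snd (\<gamma> (m + ztime n)) \<noteq> snd (\<gamma> (ztime n)))"
    unfolding zorich_block_def zorich_pow rotation_number_def by (simp add: funpow_add)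
  then show ?thesis by (simp add: ztime_def)
qed

end

lemma Q_eq_if_same_rotation:
  assumes "rauzy_orbit T s" "rauzy_orbit S s'" "rotation_number S = rotation_number T" "m \<le> n"
  shows "Q S m n = Q T m n"
proof -
  interpret T: rauzy_orbit T s by fact
  interpret S: rauzy_orbit S s' by fact
  have "S.ztime k = T.ztime k" for k
  proof (induction k)
    case (Suc k)
    then show ?case unfolding S.ztime_Suc T.ztime_Suc assms(3) by simp
  qed (simp add: S.ztime_def T.ztime_def)
  then show ?thesis unfolding S.Q_eq[OF assms(4)] T.Q_eq[OF assms(4)] assms(3) by simp
qed

section \<open>Distortion\<close>

text \<open>\<open>V\<close> bounds the variation of the logarithmic derivative over all branches
  together. A majorant whose increments add under composition is carried along instead of the
  variation itself.\<close>

definition controlled :: "real \<Rightarrow> 'd::finite branches \<Rightarrow> bool" where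
  "controlled V s \<longleftrightarrow>
     (\<forall>j. \<forall>x\<in>{lf s j..rt s j}.
        (br s j has_real_derivative exp (ld s j x)) (at x within {lf s j..rt s j})) \<and>
     (\<forall>j x y. lf s j \<le> x \<longrightarrow> x \<le> y \<longrightarrow> y \<le> rt s j \<longrightarrow> \<bar>ld s j y - ld s j x\<bar> \<le> vr s j y - vr s j x) \<and>
     (\<Sum>j\<in>UNIV. vr s j (rt s j) - vr s j (lf s j)) \<le> V"

lemma controlledD:
  assumes "controlled V s"
  shows "lf s j \<le> x \<Longrightarrow> x \<le> rt s j \<Longrightarrow>
      (br s j has_real_derivative exp (ld s j x)) (at x within {lf s j..rt s j})"
    "lf s j \<le> x \<Longrightarrow> x \<le> y \<Longrightarrow> y \<le> rt s j \<Longrightarrow> \<bar>ld s j y - ld s j x\<bar> \<le> vr s j y - vr s j x"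
    "(\<Sum>j\<in>UNIV. vr s j (rt s j) - vr s j (lf s j)) \<le> V"
  using assms by (auto simp: controlled_def)

text \<open>The chain rule with unspecified points: for the distortion estimate only the visited
  labels matter, since \<open>ld\<close> is nearly constant on each branch.\<close>

lemma step_ld:
  assumes rdy: "ready s"
    and x: "lf (st_step s) j \<le> x" "x \<le> rt (st_step s) j"
  shows "j \<noteq> loser s \<Longrightarrow> lf s j \<le> x \<and> x \<le> rt s j \<and> ld (st_step s) j x = ld s j x"
    "j = loser s \<Longrightarrow> \<exists>x1 x2. lf s (winner s) \<le> x1 \<and> x1 \<le> rt s (winner s) \<and> lf s j \<le> x2 \<and> x2 \<le> rt s j \<and>
       ld (st_step s) j x = ld s (winner s) x1 + ld s j x2"
proof -
  define w l where "w = winner s" and "l = loser s"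
  have "(j \<noteq> l \<longrightarrow> lf s j \<le> x \<and> x \<le> rt s j \<and> ld (st_step s) j x = ld s j x) \<and>
    (j = l \<longrightarrow> (\<exists>x1 x2. lf s w \<le> x1 \<and> x1 \<le> rt s w \<and> lf s j \<le> x2 \<and> x2 \<le> rt s j \<and>
       ld (st_step s) j x = ld s w x1 + ld s j x2))"
  proof (cases "st_type s = Top")
    case True
    note r = ready_top[OF rdy True, folded w_def l_def]
    note t = well_formedD(1,2)[OF r(1)]
    have L: "cl s l < len s" using tilingD(2)[OF t(2), of l] r(4) by simp
    show ?thesis
    proof (cases "j = l")
      case False
      then show ?thesis using x r L by (auto split: if_splits)
    next
      case True
      then have xx: "lf s l \<le> x" "x \<le> rt s l" using x r by auto
      then have "br s l x \<in> {cl s l..cr s l}"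
        using br_image(2)[OF well_formedD(3,4)[OF r(1)], of l "lf s l" "rt s l"] tilingD(2)[OF t(1), of l] by auto
      then have "lf s w \<le> br s l x \<and> br s l x \<le> rt s w \<and> lf s l \<le> x \<and> x \<le> rt s l \<and>
          ld (st_step s) l x = ld s w (br s l x) + ld s l x" using xx r by auto
      then show ?thesis using True by blast
    qed
  next
    case False
    note y = ready_cut[OF rdy False, folded w_def l_def]
    note r = ready_bot[OF rdy False, folded w_def l_def]
    show ?thesis
    proof (cases "j = l")
      case False
      then show ?thesis using x r y by (auto split: if_splits)
    next
      case True
      then have xx: "cut_point s w l \<le> x" "x \<le> rt s w" using x r by auto
      then have "br s w x \<in> {lf s l..cr s w}"
        using br_image(2)[OF well_formedD(3,4)[OF r(1)], of w "cut_point s w l" "rt s w"] y by auto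
      then have "lf s w \<le> x \<and> x \<le> rt s w \<and> lf s l \<le> br s w x \<and> br s w x \<le> rt s l \<and>
          ld (st_step s) l x = ld s w x + ld s l (br s w x)" using xx r y by auto
      then show ?thesis using True by blast
    qed
  qed
  then show "j \<noteq> loser s \<Longrightarrow> lf s j \<le> x \<and> x \<le> rt s j \<and> ld (st_step s) j x = ld s j x"
    "j = loser s \<Longrightarrow> \<exists>x1 x2. lf s (winner s) \<le> x1 \<and> x1 \<le> rt s (winner s) \<and> lf s j \<le> x2 \<and> x2 \<le> rt s j \<and>
       ld (st_step s) j x = ld s (winner s) x1 + ld s j x2" by (auto simp: w_def l_def)
qed

text \<open>Both the new branch of the loser and the restricted branch of the winner see the
  logarithmic derivative at the cut point, which enters the boundary twice with opposite signs.\<close>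

lemma step_ld_ends:
  assumes rdy: "ready s"
  shows "\<exists>x. \<forall>j. ld (st_step s) j (lf (st_step s) j) = ld s j (lf s j) + (if j = loser s then x else 0) \<and>
    ld (st_step s) j (rt (st_step s) j) =
      (if j = winner s then x else if j = loser s then ld s j (rt s j) + ld s (winner s) (rt s (winner s))
       else ld s j (rt s j))"
proof -
  define w l where "w = winner s" and "l = loser s"
  have "\<exists>x. \<forall>j. ld (st_step s) j (lf (st_step s) j) = ld s j (lf s j) + (if j = l then x else 0) \<and>
    ld (st_step s) j (rt (st_step s) j) =
      (if j = w then x else if j = l then ld s j (rt s j) + ld s w (rt s w) else ld s j (rt s j))"
  proof (cases "st_type s = Top")
    case True
    note r = ready_top[OF rdy True, folded w_def l_def]
    show ?thesis using r by (intro exI[of _ "ld s w (cl s l)"]) auto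
  next
    case False
    note y = ready_cut[OF rdy False, folded w_def l_def]
    note r = ready_bot[OF rdy False, folded w_def l_def]
    show ?thesis using r y by (intro exI[of _ "ld s w (cut_point s w l)"]) auto
  qed
  then show ?thesis unfolding w_def l_def .
qed

lemma sum_two:
  fixes f :: "'d::finite \<Rightarrow> real"
  assumes "w \<noteq> l"
  shows "(\<Sum>j\<in>UNIV. f j) = f w + f l + (\<Sum>j\<in>UNIV - {w, l}. f j)"
proof -
  have "(\<Sum>j\<in>UNIV. f j) = f w + (\<Sum>j\<in>UNIV - {w}. f j)" by (simp add: sum.remove)
  also have "(\<Sum>j\<in>UNIV - {w}. f j) = f l + (\<Sum>j\<in>UNIV - {w} - {l}. f j)"
    using assms by (intro sum.remove) auto
  finally show ?thesis by (simp add: insert_commute Diff_insert2[symmetric] add.assoc)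
qed

lemma exp_deriv_compose:
  assumes "(g has_real_derivative exp b) (at (f x) within B)"
    "(f has_real_derivative exp a) (at x within A)" "f ` A \<subseteq> B"
  shows "((\<lambda>x. g (f x)) has_real_derivative exp (a + b)) (at x within A)"
  using DERIV_image_chain[OF DERIV_subset[OF assms(1,3)] assms(2)]
  by (simp add: exp_add comp_def mult.commute)

text \<open>The loser's new branch crosses exactly the part of the winner's interval that the winner
  loses, so the total variation does not grow.\<close>

lemma controlled_step:
  assumes c: "controlled V s" and rdy: "ready s"
  shows "controlled V (st_step s)"
proof (cases "st_type s = Top")
  case True
  define w l where "w = winner s" and "l = loser s"
  note r = ready_top[OF rdy True, folded w_def l_def]
  note t = well_formedD(1,2)[OF r(1)] and m = well_formedD(3,4)[OF r(1)]
  have L: "cl s l < len s" using tilingD(2)[OF t(2), of l] r(4) by simp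
  have im: "br s l ` {lf s l..rt s l} = {cl s l..len s}"
    using br_image(2)[OF m, of l "lf s l" "rt s l"] tilingD(2)[OF t(1), of l] r(4) by simp
  have "((\<lambda>x. br s w (br s l x)) has_real_derivative exp (ld s l x + ld s w (br s l x)))
      (at x within {lf s l..rt s l})" if "lf s l \<le> x" "x \<le> rt s l" for x
  proof (rule exp_deriv_compose[where f = "br s l" and g = "br s w" and B = "{lf s w..rt s w}"])
    have "br s l x \<in> {cl s l..len s}" using that im by auto
    then show "(br s w has_real_derivative exp (ld s w (br s l x))) (at (br s l x) within {lf s w..rt s w})"
      using r by (intro controlledD(1)[OF c]) auto
  qed (use that im r controlledD(1)[OF c] in auto)
  moreover have "(br s w has_real_derivative exp (ld s w x)) (at x within {lf s w..cl s l})"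
    if "lf s w \<le> x" "x \<le> cl s l" for x
    using that r L by (intro DERIV_subset[OF controlledD(1)[OF c]]) auto
  moreover have "\<bar>(ld s l y + ld s w (br s l y)) - (ld s l x + ld s w (br s l x))\<bar> \<le>
      (vr s l y + vr s w (br s l y)) - (vr s l x + vr s w (br s l x))"
    if "lf s l \<le> x" "x \<le> y" "y \<le> rt s l" for x y
  proof -
    have "br s l x \<in> {cl s l..len s}" "br s l y \<in> {cl s l..len s}" using that im by auto
    moreover have "br s l x \<le> br s l y"
      using that br_less[OF r(1), of l x y] by (cases "x = y") auto
    ultimately have "\<bar>ld s w (br s l y) - ld s w (br s l x)\<bar> \<le> vr s w (br s l y) - vr s w (br s l x)"
      using r by (intro controlledD(2)[OF c]) auto
    then show ?thesis using controlledD(2)[OF c that] by linarith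
  qed
  moreover have "(\<Sum>j\<in>UNIV. vr (st_step s) j (rt (st_step s) j) - vr (st_step s) j (lf (st_step s) j)) =
      (\<Sum>j\<in>UNIV. vr s j (rt s j) - vr s j (lf s j))"
    unfolding sum_two[OF r(2)] using r by auto
  ultimately show ?thesis
    using controlledD[OF c] r L unfolding controlled_def by auto
next
  case False
  define w l where "w = winner s" and "l = loser s"
  note y = ready_cut[OF rdy False, folded w_def l_def]
  note r = ready_bot[OF rdy False, folded w_def l_def]
  note t = well_formedD(1,2)[OF r(1)] and m = well_formedD(3,4)[OF r(1)]
  have im: "br s w ` {cut_point s w l..rt s w} = {lf s l..len s}"
    using br_image(2)[OF m, of w "cut_point s w l" "rt s w"] y r(4) by simp
  have "((\<lambda>x. br s l (br s w x)) has_real_derivative exp (ld s w x + ld s l (br s w x)))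
      (at x within {cut_point s w l..rt s w})" if "cut_point s w l \<le> x" "x \<le> rt s w" for x
  proof (rule exp_deriv_compose[where f = "br s w" and g = "br s l" and B = "{lf s l..rt s l}"])
    have "br s w x \<in> {lf s l..len s}" using that im by auto
    then show "(br s l has_real_derivative exp (ld s l (br s w x))) (at (br s w x) within {lf s l..rt s l})"
      using r by (intro controlledD(1)[OF c]) auto
    show "(br s w has_real_derivative exp (ld s w x)) (at x within {cut_point s w l..rt s w})"
      using that y by (intro DERIV_subset[OF controlledD(1)[OF c]]) auto
  qed (use im r in auto)
  moreover have "(br s w has_real_derivative exp (ld s w x)) (at x within {lf s w..cut_point s w l})"
    if "lf s w \<le> x" "x \<le> cut_point s w l" for x
    using that y by (intro DERIV_subset[OF controlledD(1)[OF c]]) auto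
  moreover have "\<bar>(ld s w z + ld s l (br s w z)) - (ld s w x + ld s l (br s w x))\<bar> \<le>
      (vr s w z + vr s l (br s w z)) - (vr s w x + vr s l (br s w x))"
    if "cut_point s w l \<le> x" "x \<le> z" "z \<le> rt s w" for x z
  proof -
    have "br s w x \<in> {lf s l..len s}" "br s w z \<in> {lf s l..len s}" using that im by auto
    moreover have "br s w x \<le> br s w z"
      using that y br_less[OF r(1), of w x z] by (cases "x = z") auto
    ultimately have "\<bar>ld s l (br s w z) - ld s l (br s w x)\<bar> \<le> vr s l (br s w z) - vr s l (br s w x)"
      using r by (intro controlledD(2)[OF c]) auto
    moreover have "\<bar>ld s w z - ld s w x\<bar> \<le> vr s w z - vr s w x"
      using that y by (intro controlledD(2)[OF c]) auto
    ultimately show ?thesis by linarith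
  qed
  moreover have "(\<Sum>j\<in>UNIV. vr (st_step s) j (rt (st_step s) j) - vr (st_step s) j (lf (st_step s) j)) =
      (\<Sum>j\<in>UNIV. vr s j (rt s j) - vr s j (lf s j))"
    unfolding sum_two[OF r(2)] using r y by auto
  ultimately show ?thesis
    using controlledD[OF c] r y unfolding controlled_def by auto
qed

text \<open>By the mean value theorem the mean slope is the exponential of \<open>ld\<close> at some
  interior point, and \<open>ld\<close> oscillates by at most \<open>V\<close> on a branch.\<close>

lemma controlled_log_slope:
  assumes c: "controlled V s" and wf: "well_formed s" and x: "lf s j \<le> x" "x \<le> rt s j"
  shows "\<bar>ln ((cr s j - cl s j) / (rt s j - lf s j)) - ld s j x\<bar> \<le> V" "0 \<le> V"
proof -
  have lr: "lf s j < rt s j" using tilingD(2)[OF well_formedD(1)[OF wf]] .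
  have nn: "0 \<le> vr s i y - vr s i x" if "lf s i \<le> x" "x \<le> y" "y \<le> rt s i" for i x y
    using controlledD(2)[OF c that] by linarith
  have "vr s j (rt s j) - vr s j (lf s j) \<le> (\<Sum>i\<in>UNIV. vr s i (rt s i) - vr s i (lf s i))"
    using nn tilingD(2)[OF well_formedD(1)[OF wf]] by (intro member_le_sum) (auto simp: less_imp_le)
  then have V: "vr s j (rt s j) - vr s j (lf s j) \<le> V" using controlledD(3)[OF c] by simp
  then show "0 \<le> V" using nn[of j "lf s j" "rt s j"] lr by simp
  have osc: "\<bar>ld s j u - ld s j v\<bar> \<le> V" if uv: "lf s j \<le> v" "v \<le> u" "u \<le> rt s j" for u v
    using controlledD(2)[OF c uv] nn[of j "lf s j" v] nn[of j u "rt s j"] uv V by linarith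
  have "\<exists>z>lf s j. z < rt s j \<and> br s j (rt s j) - br s j (lf s j) = (rt s j - lf s j) * exp (ld s j z)"
  proof -
    have "\<exists>z. lf s j < z \<and> z < rt s j \<and> (\<exists>D. (br s j has_real_derivative D) (at z) \<and>
        br s j (rt s j) - br s j (lf s j) = (rt s j - lf s j) * D)"
    proof -
      have "br s j differentiable (at z)" if "lf s j < z" "z < rt s j" for z
        using controlledD(1)[OF c, of j z] that at_within_Icc_at[of "lf s j" z "rt s j"]
        by (auto simp: real_differentiable_def)
      from MVT[OF lr well_formedD(4)[OF wf] this] show ?thesis by blast
    qed
    then obtain z D where z: "lf s j < z" "z < rt s j" "(br s j has_real_derivative D) (at z)"
        "br s j (rt s j) - br s j (lf s j) = (rt s j - lf s j) * D" by blast
    moreover have "(br s j has_real_derivative exp (ld s j z)) (at z)"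
      using controlledD(1)[OF c, of j z] z at_within_Icc_at[of "lf s j" z "rt s j"] by simp
    ultimately have "D = exp (ld s j z)" using DERIV_unique by blast
    then show ?thesis using z by blast
  qed
  then obtain z where z: "lf s j < z" "z < rt s j" "cr s j - cl s j = (rt s j - lf s j) * exp (ld s j z)" by blast
  then have "ln ((cr s j - cl s j) / (rt s j - lf s j)) = ld s j z" using lr by simp
  then show "\<bar>ln ((cr s j - cl s j) / (rt s j - lf s j)) - ld s j x\<bar> \<le> V"
    using osc[of x z] osc[of z x] x z by (cases "x \<le> z") (auto simp: abs_minus_commute)
qed

section \<open>The boundary of a generalized interval exchange\<close>

definition psum :: "('d::finite \<Rightarrow> real) \<Rightarrow> real ^ 'd \<Rightarrow> 'd \<Rightarrow> real" where
  "psum p v j = (\<Sum>i\<in>{i. p i < p j}. v $ i)"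

text \<open>
  If \<open>v\<close> is the coboundary of a function on the vertices of the glued polygon that vanishes at the
  leftmost vertex, then \<open>psum p v j\<close> is the value of that function at the left end of the side \<open>j\<close>, on
  the top side for \<open>p = lf s\<close> and on the bottom side for \<open>p = cl s\<close>. The equation below says that the
  function respects the gluing.
\<close>

definition coboundaries :: "'d::finite branches \<Rightarrow> (real ^ 'd) set" where
  "coboundaries s = {v. \<forall>j. psum (lf s) v j = psum (cl s) v j}"

text \<open>For \<open>w \<noteq> l\<close> this is the inverse transpose of
  \<open>elem_matrix w l\<close>, so that pairings are preserved.\<close>

definition dual_step :: "'d \<Rightarrow> 'd \<Rightarrow> real ^ 'd \<Rightarrow> real ^ 'd::finite" where
  "dual_step w l v = (\<chi> j. v $ j - (if j = w then v $ l else 0))"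

lemma dual_step_inner:
  fixes v :: "real ^ 'd::finite"
  assumes "w \<noteq> l"
  shows "dual_step w l u \<bullet> (elem_matrix w l *v v) = u \<bullet> v"
proof -
  have "dual_step w l u \<bullet> (elem_matrix w l *v v) =
      (\<Sum>j\<in>UNIV. (u $ j - (if j = w then u $ l else 0)) * (v $ j + (if j = l then v $ w else 0)))"
    by (simp add: inner_vec_def dual_step_def elem_matrix_vec[OF assms])
  also have "\<dots> = (\<Sum>j\<in>UNIV. u $ j * v $ j)"
    unfolding sum_two[OF assms] using assms by (simp add: algebra_simps)
  finally show ?thesis by (simp add: inner_vec_def)
qed

lemma psum_last:
  fixes v :: "real ^ 'd::finite"
  assumes "\<forall>j. j \<noteq> w \<longrightarrow> p j < p w"
  shows "psum p v w + v $ w = (\<Sum>j\<in>UNIV. v $ j)"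
proof -
  have "{i. p i < p w} = UNIV - {w}" using assms by auto
  then show ?thesis unfolding psum_def by (simp add: sum.remove[of UNIV w])
qed

text \<open>A step moves the loser \<open>l\<close>, last in the order \<open>q\<close>, to the place right after the winner \<open>w\<close>,
  which is last in the other order \<open>p\<close>.\<close>

lemma psum_dual_step:
  fixes v :: "real ^ 'd::finite"
  assumes p0: "\<forall>j. j \<noteq> w \<longrightarrow> p j < p w" and q0: "\<forall>j. j \<noteq> l \<longrightarrow> q j < q l" and wl: "w \<noteq> l"
    and injq: "inj q"
    and p0': "\<forall>i j. p' i < p' j \<longleftrightarrow> p i < p j"
    and q0': "\<forall>j. j \<noteq> l \<longrightarrow> q' j = q j \<and> (q w < q j \<longrightarrow> q' l < q j)" "q w < q' l"
    and eq0: "\<forall>j. psum p v j = psum q v j"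
  shows "psum p' (dual_step w l v) j = psum p v j" "psum q' (dual_step w l v) j = psum p v j"
    "psum p v l = psum p v w + dual_step w l v $ w"
proof -
  let ?v = "dual_step w l v"
  have p: "\<And>j. j \<noteq> w \<Longrightarrow> p j < p w" and q: "\<And>j. j \<noteq> l \<Longrightarrow> q j < q l"
    and p': "\<And>i j. p' i < p' j \<longleftrightarrow> p i < p j" and eq: "\<And>j. psum p v j = psum q v j"
    and q': "\<And>j. j \<noteq> l \<Longrightarrow> q' j = q j" "q w < q' l" "\<And>j. j \<noteq> l \<Longrightarrow> q w < q j \<Longrightarrow> q' l < q j"
    using p0 q0 p0' q0' eq0 by blast+
  have tot: "psum p v w + v $ w = psum p v l + v $ l"
    using psum_last[OF p0, of v] psum_last[OF q0, of v] eq by simp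
  show 3: "psum p v l = psum p v w + ?v $ w" using tot by (simp add: dual_step_def)
  have w: "w \<notin> {i. p i < p j}" for j using p by (metis less_asym less_irrefl mem_Collect_eq)
  show "psum p' ?v j = psum p v j"
    unfolding psum_def p' using w by (intro sum.cong) (auto simp: dual_step_def)
  show "psum q' ?v j = psum p v j"
  proof (cases "j = l")
    case True
    have "{i. q' i < q' l} = insert w {i. q i < q w}"
    proof (intro set_eqI iffI)
      fix i assume i: "i \<in> {i. q' i < q' l}"
      then have "i \<noteq> l" by auto
      then have "\<not> q w < q i" using i q' by force
      then show "i \<in> insert w {i. q i < q w}" using injq by (auto simp: inj_eq not_less le_less)
    next
      fix i assume i: "i \<in> insert w {i. q i < q w}"
      then have "i \<noteq> l" using q wl by fastforce
      then show "i \<in> {i. q' i < q' l}" using i q' wl by auto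
    qed
    then have "psum q' ?v l = ?v $ w + (\<Sum>i\<in>{i. q i < q w}. ?v $ i)"
      unfolding psum_def by simp
    also have "(\<Sum>i\<in>{i. q i < q w}. ?v $ i) = psum q v w"
      unfolding psum_def by (intro sum.cong) (auto simp: dual_step_def)
    finally show ?thesis using True 3 eq[of w] by simp
  next
    case False
    show ?thesis
    proof (cases "q w < q j")
      case True
      have "w \<in> {i. q i < q j}" "l \<notin> {i. q i < q j}" using True q False by (auto simp: not_less less_imp_le)
      moreover have "{i. q' i < q' j} = insert l {i. q i < q j}"
      proof (intro set_eqI)
        fix i show "i \<in> {i. q' i < q' j} \<longleftrightarrow> i \<in> insert l {i. q i < q j}"
          using q' True False by (cases "i = l") auto
      qed
      ultimately have "psum q' ?v j = ?v $ l + (?v $ w + (\<Sum>i\<in>{i. q i < q j} - {w}. ?v $ i))"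
        unfolding psum_def using wl by (simp add: sum.remove[of _ w] insert_Diff_if)
      also have "(\<Sum>i\<in>{i. q i < q j} - {w}. ?v $ i) = (\<Sum>i\<in>{i. q i < q j} - {w}. v $ i)"
        by (intro sum.cong) (auto simp: dual_step_def)
      also have "\<dots> = psum q v j - v $ w"
        unfolding psum_def using \<open>w \<in> {i. q i < q j}\<close> by (simp add: sum.remove[of _ w])
      finally show ?thesis using wl eq by (simp add: dual_step_def)
    next
      case False2: False
      have "{i. q' i < q' j} = {i. q i < q j}"
      proof (intro set_eqI)
        fix i show "i \<in> {i. q' i < q' j} \<longleftrightarrow> i \<in> {i. q i < q j}"
          using q' False2 False q[of j] by (cases "i = l") auto
      qed
      then have "psum q' ?v j = (\<Sum>i\<in>{i. q i < q j}. ?v $ i)" by (simp add: psum_def)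
      also have "\<dots> = (\<Sum>i\<in>{i. q i < q j}. v $ i)"
        using False2 by (intro sum.cong) (auto simp: dual_step_def)
      also have "\<dots> = psum q v j" by (simp add: psum_def)
      finally show ?thesis using eq by simp
    qed
  qed
qed

text \<open>A step reglues the polygon along existing vertices, so the potential at the left end of
  each side stays the same. The last two equations express two coincidences of vertices: the
  winner's new right end is the loser's old left end, and the two old last sides share their right
  end.\<close>

lemma coboundaries_step:
  assumes rdy: "ready s" and v: "v \<in> coboundaries s"
  defines "v' \<equiv> dual_step (winner s) (loser s) v"
  shows "v' \<in> coboundaries (st_step s)"
    "psum (lf (st_step s)) v' j = psum (lf s) v j"
    "psum (lf s) v (loser s) = psum (lf s) v (winner s) + v' $ winner s"
    "psum (lf s) v (winner s) + v $ winner s = psum (lf s) v (loser s) + v $ loser s"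
proof -
  define w l where "w = winner s" and "l = loser s"
  have eq: "psum (lf s) v j = psum (cl s) v j" for j using v by (simp add: coboundaries_def)
  have wf: "well_formed s" using rdy by (simp add: ready_def)
  note t = well_formedD(1,2)[OF wf]
  have "(\<forall>j. psum (lf (st_step s)) v' j = psum (lf s) v j) \<and> (\<forall>j. psum (cl (st_step s)) v' j = psum (lf s) v j) \<and>
    psum (lf s) v l = psum (lf s) v w + v' $ w \<and> psum (lf s) v w + v $ w = psum (lf s) v l + v $ l"
  proof (cases "st_type s = Top")
    case True
    note r = ready_top[OF rdy True, folded w_def l_def]
    have L: "cl s l < len s" using tilingD(2)[OF t(2), of l] r(4) by simp
    define z where "z = br s w (cl s l)"
    have z: "cl s w < z" "z < cr s w"
      using br_less[OF r(1), of w] r(3,5) L unfolding z_def by auto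
    have c': "cl (st_step s) = (cl s)(l := z)" "lf (st_step s) = lf s" using r by (auto simp: z_def)
    have z2: "z < cl s j" if "cl s w < cl s j" for j
      using tiling_less_iff[OF t(2), of w j] that z by (cases "w = j") auto
    have p: "\<forall>j. j \<noteq> w \<longrightarrow> lf s j < lf s w" and q: "\<forall>j. j \<noteq> l \<longrightarrow> cl s j < cl s l"
      using tiling_lastD(2)[OF t(1) r(3)] tiling_lastD(2)[OF t(2) r(4)] by auto
    have "cl (st_step s) j = ((cl s)(l := z)) j" for j using c'(1) by metis
    then have q': "\<forall>j. j \<noteq> l \<longrightarrow> cl (st_step s) j = cl s j \<and> (cl s w < cl s j \<longrightarrow> cl (st_step s) l < cl s j)"
      "cl s w < cl (st_step s) l" using z z2 by auto
    have p': "\<forall>i j. lf (st_step s) i < lf (st_step s) j \<longleftrightarrow> lf s i < lf s j" using c' by simp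
    have eq': "\<forall>j. psum (lf s) v j = psum (cl s) v j" using eq by simp
    have 1: "psum (lf (st_step s)) v' j = psum (lf s) v j" "psum (cl (st_step s)) v' j = psum (lf s) v j"
      "psum (lf s) v l = psum (lf s) v w + v' $ w" for j
      unfolding v'_def w_def[symmetric] l_def[symmetric]
      by (rule psum_dual_step[where p = "lf s" and q = "cl s" and p' = "lf (st_step s)" and q' = "cl (st_step s)",
            OF p q r(2) tiling_inj[OF t(2)] p' q' eq'])+
    have "psum (lf s) v w + v $ w = psum (lf s) v l + v $ l"
      using psum_last[OF p, of v] psum_last[OF q, of v] eq by simp
    then show ?thesis using 1 by blast
  next
    case False
    note y = ready_cut[OF rdy False, folded w_def l_def]
    note r = ready_bot[OF rdy False, folded w_def l_def]
    have c': "cl (st_step s) = cl s" "lf (st_step s) = (lf s)(l := cut_point s w l)" using r y by auto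
    have z2: "cut_point s w l < lf s j" if "lf s w < lf s j" for j
      using tiling_less_iff[OF t(1), of w j] that y by (cases "w = j") auto
    have p: "\<forall>j. j \<noteq> w \<longrightarrow> cl s j < cl s w" and q: "\<forall>j. j \<noteq> l \<longrightarrow> lf s j < lf s l"
      using tiling_lastD(2)[OF t(1) r(3)] tiling_lastD(2)[OF t(2) r(4)] by auto
    have "cl (st_step s) j = cl s j" for j using c'(1) by metis
    then have p': "\<forall>i j. cl (st_step s) i < cl (st_step s) j \<longleftrightarrow> cl s i < cl s j" by simp
    have q': "\<forall>j. j \<noteq> l \<longrightarrow> lf (st_step s) j = lf s j \<and> (lf s w < lf s j \<longrightarrow> lf (st_step s) l < lf s j)"
      "lf s w < lf (st_step s) l" using y z2 c' by auto
    have eq': "\<forall>j. psum (cl s) v j = psum (lf s) v j" using eq by simp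
    have 1: "psum (cl (st_step s)) v' j = psum (cl s) v j" "psum (lf (st_step s)) v' j = psum (cl s) v j"
      "psum (cl s) v l = psum (cl s) v w + v' $ w" for j
      unfolding v'_def w_def[symmetric] l_def[symmetric]
      by (rule psum_dual_step[where p = "cl s" and q = "lf s" and p' = "cl (st_step s)" and q' = "lf (st_step s)",
            OF p q r(2) tiling_inj[OF t(1)] p' q' eq'])+
    have "psum (lf s) v w + v $ w = psum (lf s) v l + v $ l"
      using psum_last[OF p, of v] psum_last[OF q, of v] eq by simp
    then show ?thesis using 1 eq by simp
  qed
  then show "v' \<in> coboundaries (st_step s)"
    "psum (lf (st_step s)) v' j = psum (lf s) v j"
    "psum (lf s) v (loser s) = psum (lf s) v (winner s) + v' $ winner s"
    "psum (lf s) v (winner s) + v $ winner s = psum (lf s) v (loser s) + v $ loser s"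
    by (simp_all add: coboundaries_def w_def l_def)
qed

text \<open>If \<open>ld\<close> were constant on each branch, with values given by a vector
  \<open>u\<close>, this sum would be \<open>v \<bullet> u\<close>. This is why it tests log-slope
  vectors up to distortion.\<close>

definition boundary :: "'d::finite branches \<Rightarrow> real ^ 'd \<Rightarrow> real" where
  "boundary s v = (\<Sum>j\<in>UNIV. (psum (lf s) v j + v $ j) * ld s j (rt s j) - psum (lf s) v j * ld s j (lf s j))"

text \<open>The derivative at the cut point enters with the potentials of the winner's new right end
  and of the loser's left end, which agree, so it cancels. The derivative at the winner's old right
  end passes to the loser with an unchanged weight, because the old last sides end at the same
  vertex.\<close>

lemma boundary_step:
  assumes rdy: "ready s" and v: "v \<in> coboundaries s"
  shows "boundary (st_step s) (dual_step (winner s) (loser s) v) = boundary s v"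
proof -
  define w l v' where "w = winner s" and "l = loser s" and "v' = dual_step w l v"
  have wl: "w \<noteq> l" using ready_top(2)[OF rdy] ready_bot(2)[OF rdy] unfolding w_def l_def by blast
  note c = coboundaries_step(2-4)[OF rdy v, folded w_def l_def, folded v'_def]
  have v': "v' $ j = v $ j" if "j \<noteq> w" for j using that by (simp add: v'_def dual_step_def)
  obtain x where x: "\<And>j. ld (st_step s) j (lf (st_step s) j) = ld s j (lf s j) + (if j = l then x else 0)"
    "\<And>j. ld (st_step s) j (rt (st_step s) j) =
      (if j = w then x else if j = l then ld s j (rt s j) + ld s w (rt s w) else ld s j (rt s j))"
    using step_ld_ends[OF rdy] unfolding w_def l_def by blast
  have "boundary (st_step s) v' - boundary s v = psum (lf s) v l * x - psum (lf s) v w * ld s w (lf s w)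
     + (psum (lf s) v l + v $ l) * (ld s l (rt s l) + ld s w (rt s w)) - psum (lf s) v l * (ld s l (lf s l) + x)
     - ((psum (lf s) v w + v $ w) * ld s w (rt s w) - psum (lf s) v w * ld s w (lf s w))
     - ((psum (lf s) v l + v $ l) * ld s l (rt s l) - psum (lf s) v l * ld s l (lf s l))"
    unfolding boundary_def sum_two[OF wl] x c(1) using wl by (simp add: v' c(2))
  also have "\<dots> = 0" unfolding c(3) by (simp add: algebra_simps)
  finally show ?thesis by (simp add: v'_def w_def l_def)
qed

text \<open>The values of the potential at all ends of sides. The vector \<open>v\<close> changes
  under a dual step, but this set does not, and its size is comparable to the norm of
  \<open>v\<close>; this is the source of the bounded dual action.\<close>

definition potential_values :: "'d::finite branches \<Rightarrow> real ^ 'd \<Rightarrow> real set" where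
  "potential_values s v = range (psum (lf s) v) \<union> range (\<lambda>j. psum (lf s) v j + v $ j)"

lemma potential_values_step:
  assumes rdy: "ready s" and v: "v \<in> coboundaries s"
  shows "potential_values (st_step s) (dual_step (winner s) (loser s) v) = potential_values s v"
proof -
  define w l v' where "w = winner s" and "l = loser s" and "v' = dual_step w l v"
  have wl: "w \<noteq> l" using ready_top(2)[OF rdy] ready_bot(2)[OF rdy] unfolding w_def l_def by blast
  note c = coboundaries_step(2-4)[OF rdy v, folded w_def l_def, folded v'_def]
  have v': "v' $ j = v $ j" if "j \<noteq> w" for j using that by (simp add: v'_def dual_step_def)
  let ?p = "psum (lf s) v"
  have 1: "?p j + v' $ j \<in> potential_values s v" for j
    using c(2)[symmetric] v'[of j] by (cases "j = w") (auto simp: potential_values_def)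
  have 2: "?p j + v $ j \<in> range (\<lambda>j. ?p j + v' $ j)" for j
  proof (cases "j = w")
    case True
    then have "?p j + v $ j = ?p l + v' $ l" using c(3) v'[of l] wl by simp
    then show ?thesis by blast
  next
    case False
    then show ?thesis using v'[of j] by (intro image_eqI[of _ _ j]) auto
  qed
  have "potential_values (st_step s) v' = range ?p \<union> range (\<lambda>j. ?p j + v' $ j)"
    by (simp add: potential_values_def c(1))
  also have "\<dots> = potential_values s v" using 1 2 by (auto simp: potential_values_def)
  finally show ?thesis by (simp add: v'_def w_def l_def)
qed

text \<open>Each value is a partial sum of coordinates of \<open>v\<close>, and each coordinate is
  the difference of two values.\<close>

lemma potential_norm:
  fixes v :: "real ^ 'd::finite" and B :: real
  shows "u \<in> potential_values s v \<Longrightarrow> \<bar>u\<bar> \<le> CARD('d) * norm v"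
    "(\<And>u. u \<in> potential_values s v \<Longrightarrow> \<bar>u\<bar> \<le> B) \<Longrightarrow> norm v \<le> CARD('d) * (2 * B)"
proof -
  have S: "\<bar>\<Sum>i\<in>A. v $ i\<bar> \<le> CARD('d) * norm v" for A
  proof -
    have "\<bar>\<Sum>i\<in>A. v $ i\<bar> \<le> (\<Sum>i\<in>A. norm v)"
      by (rule order_trans[OF sum_abs sum_mono]) (simp add: component_le_norm_cart)
    also have "\<dots> \<le> CARD('d) * norm v" by (simp add: mult_right_mono card_mono)
    finally show ?thesis .
  qed
  assume "u \<in> potential_values s v"
  then consider j where "u = (\<Sum>i\<in>{i. lf s i < lf s j}. v $ i)"
    | j where "u = (\<Sum>i\<in>{i. lf s i < lf s j}. v $ i) + v $ j"
    by (auto simp: potential_values_def psum_def)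
  then show "\<bar>u\<bar> \<le> CARD('d) * norm v"
  proof cases
    case 2
    then have "u = (\<Sum>i\<in>insert j {i. lf s i < lf s j}. v $ i)" by simp
    then show ?thesis using S by metis
  qed (use S in auto)
next
  assume B: "\<And>u. u \<in> potential_values s v \<Longrightarrow> \<bar>u\<bar> \<le> B"
  have "\<bar>v $ j\<bar> \<le> 2 * B" for j
  proof -
    have "\<bar>psum (lf s) v j\<bar> \<le> B" "\<bar>psum (lf s) v j + v $ j\<bar> \<le> B"
      using B by (auto simp: potential_values_def)
    then show ?thesis by linarith
  qed
  then have "(\<Sum>j\<in>UNIV. \<bar>v $ j\<bar>) \<le> (\<Sum>j\<in>(UNIV::'d set). 2 * B)" by (intro sum_mono)
  then show "norm v \<le> CARD('d) * (2 * B)" using norm_le_l1_cart[of v] by simp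
qed

section \<open>Log-slope vectors and boundary along an orbit\<close>

locale controlled_orbit = rauzy_orbit T s0 for T :: "'d::finite giet" and s0 +
  fixes V :: real
  assumes controlled0: "controlled V s0"
begin

definition \<omega> :: "nat \<Rightarrow> real ^ 'd" where "\<omega> n = shape_log_slope ((rv_step ^^ n) T)"

lemma controlled_st: "controlled V (st n)"
  by (induction n) (simp_all add: st_0 st_Suc controlled0 controlled_step orbitD(3))

lemma \<omega>_ld:
  assumes "lf (st n) j \<le> x" "x \<le> rt (st n) j"
  shows "\<bar>\<omega> n $ j - ld (st n) j x\<bar> \<le> V"
  using controlled_log_slope(1)[OF controlled_st orbitD(2) assms] by (simp add: \<omega>_def shape_log_slope_orbit)

lemma lf_le_rt: "lf (st n) j \<le> rt (st n) j"
  using tilingD(2)[OF well_formedD(1)[OF orbitD(2)], of n j] by simp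

lemma V_nonneg: "0 \<le> V"
  by (rule controlled_log_slope(2)[OF controlled_st orbitD(2) order_refl lf_le_rt])

lemma rv_matrix_nonneg: "0 \<le> rv_matrix \<gamma> m k $ i $ j"
  by (induction k arbitrary: i) (simp_all add: rv_matrix_Suc mat_def del: rv_matrix.simps(2))

lemma rv_matrix_diag: "1 \<le> rv_matrix \<gamma> m k $ i $ i"
  by (induction k) (auto simp: rv_matrix_Suc mat_def rv_matrix_nonneg add_increasing2 simp del: rv_matrix.simps(2))

text \<open>The logarithmic derivative of a return branch is a sum of \<open>ld\<close> over the
  visited points. Replacing a term by a log-slope costs at most \<open>V\<close>, and the row sum
  counts the visits.\<close>

lemma ld_cocycle:
  assumes "lf (st (m + k)) i \<le> x" "x \<le> rt (st (m + k)) i"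
  shows "\<bar>ld (st (m + k)) i x - (rv_matrix \<gamma> m k *v \<omega> m) $ i\<bar> \<le> V * (\<Sum>j\<in>UNIV. rv_matrix \<gamma> m k $ i $ j)"
  using assms
proof (induction k arbitrary: i x)
  case 0
  have "(\<Sum>j\<in>UNIV. rv_matrix \<gamma> m 0 $ i $ j) = 1" by (simp add: mat_def)
  then show ?case using \<omega>_ld[of m i x] 0 by (simp add: abs_minus_commute)
next
  case (Suc k)
  let ?w = "winner (st (m + k))" and ?l = "loser (st (m + k))"
  let ?R = "rv_matrix \<gamma> m k"
  have v: "(rv_matrix \<gamma> m (Suc k) *v \<omega> m) $ i = (?R *v \<omega> m) $ i + (if i = ?l then (?R *v \<omega> m) $ ?w else 0)"
    unfolding matrix_vector_mult_def by (simp add: rv_matrix_Suc sum.distrib algebra_simps del: rv_matrix.simps(2))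
  have s: "(\<Sum>j\<in>UNIV. rv_matrix \<gamma> m (Suc k) $ i $ j) =
      (\<Sum>j\<in>UNIV. ?R $ i $ j) + (if i = ?l then (\<Sum>j\<in>UNIV. ?R $ ?w $ j) else 0)"
    by (simp add: rv_matrix_Suc sum.distrib del: rv_matrix.simps(2))
  have x: "lf (st_step (st (m + k))) i \<le> x" "x \<le> rt (st_step (st (m + k))) i"
    using Suc.prems by (simp_all add: st_Suc)
  note ld = step_ld[OF orbitD(3) x, folded st_Suc]
  show ?case
  proof (cases "i = ?l")
    case True
    then obtain x1 x2 where xx: "lf (st (m + k)) ?w \<le> x1" "x1 \<le> rt (st (m + k)) ?w"
      "lf (st (m + k)) i \<le> x2" "x2 \<le> rt (st (m + k)) i"
      "ld (st (Suc (m + k))) i x = ld (st (m + k)) ?w x1 + ld (st (m + k)) i x2"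
      using ld(2) by blast
    show ?thesis unfolding v s using Suc.IH[OF xx(1,2)] Suc.IH[OF xx(3,4)] xx(5) True
      by (simp add: distrib_left)
  next
    case False
    then show ?thesis unfolding v s using ld(1) Suc.IH[of i x] by simp
  qed
qed

text \<open>One more \<open>V\<close> is spent on passing from \<open>ld\<close> to the log-slope at
  the later time; as row sums are at least 1, this at most doubles the constant.\<close>

lemma \<omega>_cocycle:
  "\<bar>\<omega> (m + k) $ i - (rv_matrix \<gamma> m k *v \<omega> m) $ i\<bar> \<le> 2 * V * (\<Sum>j\<in>UNIV. rv_matrix \<gamma> m k $ i $ j)"
proof -
  have "1 \<le> (\<Sum>j\<in>UNIV. rv_matrix \<gamma> m k $ i $ j)"
    using rv_matrix_diag[of m k i] member_le_sum[of i UNIV "\<lambda>j. rv_matrix \<gamma> m k $ i $ j"] rv_matrix_nonneg by force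
  then have "V \<le> V * (\<Sum>j\<in>UNIV. rv_matrix \<gamma> m k $ i $ j)"
    using mult_left_mono[OF _ V_nonneg] by fastforce
  then show ?thesis
    using ld_cocycle[of m k i "lf (st (m + k)) i"] \<omega>_ld[of "m + k" i "lf (st (m + k)) i"] lf_le_rt[of "m + k" i]
    by linarith
qed

primrec dual_orbit :: "real ^ 'd \<Rightarrow> nat \<Rightarrow> real ^ 'd" where
  "dual_orbit v 0 = v"
| "dual_orbit v (Suc n) = dual_step (winner (st n)) (loser (st n)) (dual_orbit v n)"

lemma dual_orbit:
  assumes "v \<in> coboundaries s0"
  shows "dual_orbit v n \<in> coboundaries (st n)" "boundary (st n) (dual_orbit v n) = boundary s0 v"
    "potential_values (st n) (dual_orbit v n) = potential_values s0 v"
proof -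
  have "dual_orbit v n \<in> coboundaries (st n) \<and> boundary (st n) (dual_orbit v n) = boundary s0 v \<and>
    potential_values (st n) (dual_orbit v n) = potential_values s0 v"
  proof (induction n)
    case (Suc n)
    then show ?case
      using coboundaries_step(1)[OF orbitD(3), of "dual_orbit v n" n] boundary_step[OF orbitD(3), of "dual_orbit v n" n]
        potential_values_step[OF orbitD(3), of "dual_orbit v n" n] by (simp add: st_Suc)
  qed (use assms in \<open>simp add: st_0\<close>)
  then show "dual_orbit v n \<in> coboundaries (st n)" "boundary (st n) (dual_orbit v n) = boundary s0 v"
    "potential_values (st n) (dual_orbit v n) = potential_values s0 v" by auto
qed

lemma dual_orbit_inner: "dual_orbit v n \<bullet> (rv_matrix \<gamma> 0 n *v u) = v \<bullet> u"
  by (induction n)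
    (simp_all add: rotation_winner matrix_vector_mul_assoc[symmetric] dual_step_inner winner_neq_loser)

text \<open>Both norms are comparable to one and the same set of potential values, so the constant
  depends neither on the times nor on their order.\<close>

lemma dual_orbit_norm:
  assumes "v \<in> coboundaries s0"
  shows "norm (dual_orbit v m) \<le> 2 * real CARD('d) ^ 2 * norm (dual_orbit v n)"
proof -
  have "norm (dual_orbit v m) \<le> CARD('d) * (2 * (CARD('d) * norm (dual_orbit v n)))"
    using potential_norm(1)[of _ "st n" "dual_orbit v n"]
    by (intro potential_norm(2)[of "st m"]) (simp add: dual_orbit(3)[OF assms])
  then show ?thesis by (simp add: power2_eq_square)
qed

lemma boundary_bound:
  fixes v u :: "real ^ 'd"
  assumes "\<And>j. \<bar>u $ j - ld (st n) j (lf (st n) j)\<bar> \<le> B" "\<And>j. \<bar>u $ j - ld (st n) j (rt (st n) j)\<bar> \<le> B"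
  shows "\<bar>boundary (st n) v - v \<bullet> u\<bar> \<le> CARD('d) * (2 * (CARD('d) * norm v * B))"
proof -
  let ?L = "\<lambda>j. psum (lf (st n)) v j" and ?R = "\<lambda>j. psum (lf (st n)) v j + v $ j"
  have B: "0 \<le> B" using assms(1) by (meson abs_ge_zero order_trans)
  have LR: "\<bar>?L j\<bar> \<le> CARD('d) * norm v" "\<bar>?R j\<bar> \<le> CARD('d) * norm v" for j
    by (rule potential_norm(1)[of _ "st n"]; simp add: potential_values_def)+
  have "\<bar>?R j * (ld (st n) j (rt (st n) j) - u $ j) - ?L j * (ld (st n) j (lf (st n) j) - u $ j)\<bar> \<le>
      2 * (CARD('d) * norm v * B)" for j
  proof -
    have "\<bar>?R j * (ld (st n) j (rt (st n) j) - u $ j)\<bar> \<le> CARD('d) * norm v * B"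
      "\<bar>?L j * (ld (st n) j (lf (st n) j) - u $ j)\<bar> \<le> CARD('d) * norm v * B"
      unfolding abs_mult using LR assms B by (auto intro!: mult_mono simp: abs_minus_commute)
    then show ?thesis by linarith
  qed
  note le = this
  have "boundary (st n) v - v \<bullet> u =
      (\<Sum>j\<in>UNIV. ?R j * (ld (st n) j (rt (st n) j) - u $ j) - ?L j * (ld (st n) j (lf (st n) j) - u $ j))"
    unfolding boundary_def inner_vec_def sum_subtractf[symmetric] by (intro sum.cong) (auto simp: algebra_simps)
  also have "\<bar>\<dots>\<bar> \<le> (\<Sum>j\<in>(UNIV::'d set). 2 * (CARD('d) * norm v * B))"
    by (rule order_trans[OF sum_abs sum_mono[OF le]])
  finally show ?thesis by simp
qed

text \<open>The boundary is constant in time and differs from the pairing with the log-slopes by a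
  multiple of the norm. Its value, computed at time 0, is bounded by the norm there, hence by the
  norm at time \<open>n\<close>.\<close>

lemma dual_orbit_\<omega>:
  "\<exists>C\<ge>0. \<forall>v\<in>coboundaries s0. \<forall>n. \<bar>dual_orbit v n \<bullet> \<omega> n\<bar> \<le> C * norm (dual_orbit v n)"
proof -
  define d where "d = real CARD('d)"
  have d: "d \<ge> 0" by (simp add: d_def)
  have b: "\<bar>boundary (st n) v - v \<bullet> \<omega> n\<bar> \<le> 2 * d\<^sup>2 * V * norm v" for n and v :: "real ^ 'd"
    using boundary_bound[of "\<omega> n" n V v] \<omega>_ld[of n] lf_le_rt[of n]
    by (simp add: d_def power2_eq_square algebra_simps)
  show ?thesis
  \<comment> \<open>The first summand is the distortion at time \<open>n\<close>; the second is the
    bound at time 0 multiplied by the constant of \<open>dual_orbit_norm\<close>.\<close>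
  proof (intro exI[of _ "2 * d\<^sup>2 * V + (2 * d\<^sup>2 * V + norm (\<omega> 0)) * (2 * d\<^sup>2)"] conjI ballI allI)
    fix v n assume v: "v \<in> coboundaries s0"
    have "\<bar>boundary s0 v\<bar> \<le> 2 * d\<^sup>2 * V * norm v + norm v * norm (\<omega> 0)"
      using b[of 0 v] Cauchy_Schwarz_ineq2[of v "\<omega> 0"] unfolding st_0 by linarith
    also have "\<dots> = (2 * d\<^sup>2 * V + norm (\<omega> 0)) * norm v" by (simp add: algebra_simps)
    also have "\<dots> \<le> (2 * d\<^sup>2 * V + norm (\<omega> 0)) * (2 * d\<^sup>2 * norm (dual_orbit v n))"
      using dual_orbit_norm[OF v, of 0 n] V_nonneg by (intro mult_left_mono) (auto simp: d_def)
    finally have "\<bar>boundary (st n) (dual_orbit v n)\<bar> \<le>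
        (2 * d\<^sup>2 * V + norm (\<omega> 0)) * (2 * d\<^sup>2) * norm (dual_orbit v n)"
      by (simp add: dual_orbit(2)[OF v] mult.assoc)
    then show "\<bar>dual_orbit v n \<bullet> \<omega> n\<bar> \<le>
        (2 * d\<^sup>2 * V + (2 * d\<^sup>2 * V + norm (\<omega> 0)) * (2 * d\<^sup>2)) * norm (dual_orbit v n)"
      using b[of n "dual_orbit v n"] unfolding distrib_right[of "2 * d\<^sup>2 * V"] by linarith
  qed (use V_nonneg in auto)
qed

end

section \<open>Genus and the dimension of the space of coboundaries\<close>

text \<open>Symplectic induction: a hyperbolic plane \<open>span {x, y}\<close> is split off, and
  the form stays nondegenerate on its complement \<open>W\<close> with respect to the form.\<close>

lemma skew_nondegenerate_even_dim:
  fixes f :: "'a::euclidean_space \<Rightarrow> 'a"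
  assumes lin: "linear f" and skew: "\<And>x y. x \<bullet> f y = - (y \<bullet> f x)"
    and "subspace V" "\<And>x. x \<in> V \<Longrightarrow> (\<And>y. y \<in> V \<Longrightarrow> x \<bullet> f y = 0) \<Longrightarrow> x = 0"
  shows "even (dim V)"
  using assms(3,4)
proof (induction "dim V" arbitrary: V rule: less_induct)
  case less
  have self: "x \<bullet> f x = 0" for x using skew[of x x] by simp
  show ?case
  proof (cases "V \<subseteq> {0}")
    case True
    then show ?thesis by (simp add: dim_eq_0[THEN iffD2])
  next
    case False
    then obtain x where x: "x \<in> V" "x \<noteq> 0" by auto
    then obtain y where y: "y \<in> V" "x \<bullet> f y \<noteq> 0" using less.prems(2) by blast
    define c where "c = x \<bullet> f y"
    have c: "c \<noteq> 0" "y \<bullet> f x = - c" using y skew[of y x] by (simp_all add: c_def)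
    define W where "W = {w \<in> V. w \<bullet> f x = 0 \<and> w \<bullet> f y = 0}"
    have W: "subspace W"
      using less.prems(1) unfolding W_def subspace_def by (auto simp: inner_left_distrib)
    have indep: "s *\<^sub>R x + t *\<^sub>R y \<in> W \<Longrightarrow> s = 0 \<and> t = 0" for s t
      using c self by (auto simp: W_def inner_left_distrib c_def[symmetric])
    have "dim (span {x, y}) = 2"
    proof -
      have "x \<noteq> y" using y(2) self by auto
      moreover have "y \<notin> span {x}"
      proof
        assume "y \<in> span {x}"
        then obtain s where "y = s *\<^sub>R x" by (auto simp: span_singleton)
        then show False using y(2) self linear_scale[OF lin] by simp
      qed
      ultimately show ?thesis using x(2)
        unfolding dim_span insert_commute[of x y] by (simp add: dim_insert[of y "{x}"] dim_insert[of x "{}"])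
    qed
    moreover have "span {x, y} \<inter> W = {0}"
    proof (intro equalityI subsetI)
      fix w assume w: "w \<in> span {x, y} \<inter> W"
      then obtain s t where "w = s *\<^sub>R x + t *\<^sub>R y"
        by (auto simp: span_insert span_singleton) (metis add.commute diff_add_cancel)
      then show "w \<in> {0}" using indep[of s t] w by auto
    qed (use W subspace_0 span_0 in auto)
    moreover have "{u + w |u w. u \<in> span {x, y} \<and> w \<in> W} = V"
    proof (intro equalityI subsetI)
      fix v assume "v \<in> {u + w |u w. u \<in> span {x, y} \<and> w \<in> W}"
      moreover have "span {x, y} \<subseteq> V" using x y less.prems(1) by (intro span_minimal) auto
      ultimately show "v \<in> V" using less.prems(1) by (auto simp: W_def intro: subspace_add)
    next
      fix v assume v: "v \<in> V"
      \<comment> \<open>The coefficients for which \<open>v - ?u\<close> pairs to zero with both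
        \<open>f x\<close> and \<open>f y\<close>.\<close>
      define s t where "s = (v \<bullet> f y) / c" and "t = - ((v \<bullet> f x) / c)"
      let ?u = "s *\<^sub>R x + t *\<^sub>R y"
      have "?u \<in> span {x, y}" by (intro span_add span_scale span_base) auto
      moreover have "v - ?u \<in> W"
        using v x y less.prems(1) c self
        by (auto simp: W_def inner_diff_left inner_left_distrib s_def t_def c_def[symmetric]
            intro!: subspace_diff subspace_add subspace_scale)
      moreover have "v = ?u + (v - ?u)" by simp
      ultimately show "v \<in> {u + w |u w. u \<in> span {x, y} \<and> w \<in> W}" by blast
    qed
    ultimately have dim: "dim V = 2 + dim W"
      using dim_sums_Int[OF subspace_span[of "{x, y}"] W] by simp
    moreover have "even (dim W)"
    proof (rule less.hyps)
      fix w assume w: "w \<in> W" "\<And>z. z \<in> W \<Longrightarrow> w \<bullet> f z = 0"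
      have "w \<bullet> f v = 0" if v: "v \<in> V" for v
      proof -
        define s t where "s = (v \<bullet> f y) / c" and "t = - ((v \<bullet> f x) / c)"
        have "v - (s *\<^sub>R x + t *\<^sub>R y) \<in> W"
          using v x y less.prems(1) c self
          by (auto simp: W_def inner_diff_left inner_left_distrib s_def t_def c_def[symmetric]
              intro!: subspace_diff subspace_add subspace_scale)
        then have "w \<bullet> f (v - (s *\<^sub>R x + t *\<^sub>R y)) = 0" by (rule w(2))
        moreover have "w \<bullet> f x = 0" "w \<bullet> f y = 0" using w(1) by (auto simp: W_def)
        ultimately show ?thesis
          by (simp add: linear_diff[OF lin] linear_add[OF lin] linear_scale[OF lin] inner_diff_right inner_right_distrib)
      qed
      then show "w = 0" using less.prems(2) w(1) by (auto simp: W_def)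
    qed (use W dim in auto)
    ultimately show ?thesis by simp
  qed
qed

text \<open>The kernel of a skew map is the orthogonal complement of its range, so the form is
  nondegenerate on the range, whose dimension is therefore even.\<close>

lemma skew_kernel_dim:
  fixes f :: "'a::euclidean_space \<Rightarrow> 'a"
  assumes lin: "linear f" and skew: "\<And>x y. x \<bullet> f y = - (y \<bullet> f x)"
  shows "\<exists>r. even r \<and> dim {v. f v = 0} + r = DIM('a)"
proof (intro exI conjI)
  have "(f v = 0) \<longleftrightarrow> (\<forall>x\<in>range f. orthogonal x v)" for v
  proof
    assume "\<forall>x\<in>range f. orthogonal x v"
    then have "f (f v) \<bullet> v = 0" by (simp add: orthogonal_def)
    then have "f v \<bullet> f v = 0" using skew[of v "f v"] by (simp add: inner_commute)
    then show "f v = 0" by simp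
  next
    assume "f v = 0"
    then show "\<forall>x\<in>range f. orthogonal x v" using skew[of v] by (auto simp: orthogonal_def inner_commute)
  qed
  then have K: "{v. f v = 0} = {v \<in> UNIV. \<forall>x\<in>range f. orthogonal x v}" by auto
  show "dim {v. f v = 0} + dim (range f) = DIM('a)"
    unfolding K by (subst dim_subspace_orthogonal_to_vectors)
      (auto simp: linear_subspace_image[OF lin])
  show "even (dim (range f))"
  proof (rule skew_nondegenerate_even_dim[OF lin skew])
    fix x assume x: "x \<in> range f" "\<And>y. y \<in> range f \<Longrightarrow> x \<bullet> f y = 0"
    obtain z where z: "x = f z" using x(1) by auto
    have "f x \<bullet> f x = 0" using x(2)[of "f x"] skew[of x "f x"] by (simp add: inner_commute)
    then have "f x = 0" by simp
    then have "x \<bullet> x = 0" using skew[of x z] z by simp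
    then show "x = 0" by simp
  qed (simp_all add: linear_subspace_image[OF lin])
qed

text \<open>Applied to lengths, this is the translation vector of the exchange with orders
  \<open>p\<close> and \<open>q\<close>. Its matrix is the classical skew matrix with entries 0, 1
  and -1 that records the pairs of labels in opposite order.\<close>

definition intersection :: "('d::finite \<Rightarrow> real) \<Rightarrow> ('d \<Rightarrow> real) \<Rightarrow> real ^ 'd \<Rightarrow> real ^ 'd" where
  "intersection p q v = (\<chi> j. psum q v j - psum p v j)"

lemma linear_intersection: "linear (intersection p q)"
  by (rule linearI)
    (simp_all add: intersection_def psum_def vec_eq_iff sum.distrib sum_distrib_left algebra_simps)

lemma skew_intersection:
  fixes u v :: "real ^ 'd::finite"
  assumes "inj p" "inj q"
  shows "u \<bullet> intersection p q v = - (v \<bullet> intersection p q u)"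
proof -
  define \<Omega> :: "'d \<Rightarrow> 'd \<Rightarrow> real" where "\<Omega> j i = of_bool (q i < q j) - of_bool (p i < p j)" for i j
  have \<Omega>: "\<Omega> j i = - \<Omega> i j" for i j
    using assms by (cases "i = j") (auto simp: \<Omega>_def inj_eq not_less le_less)
  have "psum p v j = (\<Sum>i\<in>UNIV. of_bool (p i < p j) * v $ i)" for p v and j :: 'd
    unfolding psum_def by (subst sum.mono_neutral_cong_left[of UNIV]) auto
  then have "intersection p q v $ j = (\<Sum>i\<in>UNIV. \<Omega> j i * v $ i)" for v j
    by (simp only: intersection_def \<Omega>_def left_diff_distrib sum_subtractf vec_lambda_beta)
  then have int: "u \<bullet> intersection p q v = (\<Sum>j\<in>UNIV. \<Sum>i\<in>UNIV. \<Omega> j i * (u $ j * v $ i))" for u v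
    by (simp add: inner_vec_def sum_distrib_left mult_ac)
  have "u \<bullet> intersection p q v = (\<Sum>i\<in>UNIV. \<Sum>j\<in>UNIV. \<Omega> j i * (u $ j * v $ i))"
    unfolding int by (rule sum.swap)
  also have "\<dots> = (\<Sum>i\<in>UNIV. \<Sum>j\<in>UNIV. - (\<Omega> i j * (v $ i * u $ j)))"
    using \<Omega> by (intro sum.cong refl) (metis minus_mult_left mult.commute)
  also have "\<dots> = - (v \<bullet> intersection p q u)" unfolding int by (simp add: sum_negf)
  finally show ?thesis .
qed

section \<open>Vertex classes and coboundaries\<close>

lemma independent_family_dim:
  fixes f :: "'i \<Rightarrow> 'a::euclidean_space"
  assumes "finite I" "\<And>x. (\<Sum>i\<in>I. x i *\<^sub>R f i) = 0 \<Longrightarrow> \<forall>i\<in>I. x i = 0" "f ` I \<subseteq> S"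
  shows "card I \<le> dim S"
proof -
  have inj: "inj_on f I"
  proof (rule inj_onI, rule ccontr)
    fix i j assume ij: "i \<in> I" "j \<in> I" "f i = f j" "i \<noteq> j"
    define x :: "'i \<Rightarrow> real" where "x k = (if k = i then 1 else 0) - (if k = j then 1 else 0)" for k
    have "(\<Sum>k\<in>I. x k *\<^sub>R f k) = (\<Sum>k\<in>I. (if k = i then f k else 0)) - (\<Sum>k\<in>I. (if k = j then f k else 0))"
      unfolding sum_subtractf[symmetric] by (intro sum.cong) (auto simp: x_def)
    also have "\<dots> = 0" using ij assms(1) by simp
    finally show False using assms(2)[of x] ij by (auto simp: x_def)
  qed
  have "independent (f ` I)"
  proof (rule independent_if_scalars_zero)
    fix u w assume u: "(\<Sum>w\<in>f ` I. u w *\<^sub>R w) = 0" "w \<in> f ` I"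
    then have "(\<Sum>i\<in>I. u (f i) *\<^sub>R f i) = 0" by (simp add: sum.reindex[OF inj])
    then show "u w = 0" using assms(2)[of "\<lambda>i. u (f i)"] u(2) by auto
  qed (use assms(1) in simp)
  then have "card (f ` I) \<le> dim S" using assms(3) by (rule independent_card_le_dim[rotated])
  then show ?thesis by (simp add: card_image[OF inj])
qed

definition label_rank :: "('d::finite \<Rightarrow> real) \<Rightarrow> 'd \<Rightarrow> nat" where
  "label_rank p j = card {i. p i \<le> p j}"

lemma rank_less: "p i < p j \<Longrightarrow> label_rank p i < label_rank p j"
  unfolding label_rank_def by (intro psubset_card_mono psubsetI) (auto simp: set_eq_iff not_le intro!: exI[of _ j])

lemma rank_less_iff: "label_rank p i < label_rank p j \<longleftrightarrow> p i < p j"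
proof
  assume "label_rank p i < label_rank p j"
  then show "p i < p j"
    using rank_less[of p j i] by (cases "p i" "p j" rule: linorder_cases) (auto simp: label_rank_def)
qed (rule rank_less)

lemma bij_rank:
  fixes p :: "'d::finite \<Rightarrow> real"
  assumes "inj p"
  shows "bij_betw (label_rank p) UNIV {1..CARD('d)}"
proof -
  have inj: "inj (label_rank p)"
    using assms by (auto intro!: injI dest: injD simp: rank_less_iff)
      (metis injD linorder_neqE_linordered_idom nat_neq_iff rank_less_iff)
  have "label_rank p j \<in> {1..CARD('d)}" for j
  proof -
    have "card {i. p i \<le> p j} \<le> CARD('d)" by (rule card_mono) auto
    moreover have "card {i. p i \<le> p j} > 0" by (subst card_gt_0_iff) auto
    ultimately show ?thesis unfolding label_rank_def by simp
  qed
  then have "range (label_rank p) = {1..CARD('d)}"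
    using inj by (intro card_subset_eq) (auto simp: card_image)
  then show ?thesis using inj by (simp add: bij_betw_def)
qed

lemma left_to_right_rank:
  fixes a b :: "'d::finite \<Rightarrow> real"
  assumes "tiling L a b"
  shows "left_to_right (\<lambda>j. {a j<..<b j}) (label_rank a j) = j"
proof -
  have [simp]: "Inf {a j<..<b j} = a j" for j
    using tilingD(2)[OF assms] by (simp add: cInf_greaterThanLessThan)
  have "inj (label_rank a)" using bij_rank[OF tiling_inj[OF assms]] by (simp add: bij_betw_def)
  then show ?thesis unfolding left_to_right_def label_rank_def[symmetric]
    by (intro the_equality) (auto simp: label_rank_def[symmetric] dest: injD)
qed

text \<open>Telescoping along the order: partial sums of a coboundary recover the potential up to
  its value at the leftmost vertex.\<close>

lemma psum_rank:
  fixes p :: "'d::finite \<Rightarrow> real" and \<phi> :: "nat \<Rightarrow> real"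
  assumes "inj p" "\<And>i. v $ i = \<phi> (label_rank p i) - \<phi> (label_rank p i - 1)"
  shows "psum p v j = \<phi> (label_rank p j - 1) - \<phi> 0"
proof -
  have bij: "bij_betw (label_rank p) {i. p i < p j} {1..<label_rank p j}"
  proof (rule bij_betw_subset[OF bij_rank[OF assms(1)] subset_UNIV])
    have r: "label_rank p j \<in> {1..CARD('d)}" for j using bij_rank[OF assms(1)] by (auto simp: bij_betw_def)
    show "label_rank p ` {i. p i < p j} = {1..<label_rank p j}"
    proof (intro equalityI subsetI)
      fix k assume k: "k \<in> {1..<label_rank p j}"
      then have "k \<in> range (label_rank p)" using bij_rank[OF assms(1)] r[of j] by (auto simp: bij_betw_def)
      then show "k \<in> label_rank p ` {i. p i < p j}" using k by (auto simp: rank_less_iff)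
    qed (use r rank_less_iff[of p] in auto)
  qed
  have "psum p v j = (\<Sum>i\<in>{i. p i < p j}. \<phi> (label_rank p i) - \<phi> (label_rank p i - 1))"
    unfolding psum_def by (intro sum.cong) (simp_all add: assms(2))
  also have "\<dots> = (\<Sum>k\<in>{1..<label_rank p j}. \<phi> k - \<phi> (k - 1))"
    by (rule sum.reindex_bij_betw[OF bij])
  also have "\<dots> = \<phi> (label_rank p j - 1) - \<phi> 0"
  proof -
    have "(\<Sum>k\<in>{1..<n}. \<phi> k - \<phi> (k - 1)) = \<phi> (n - 1) - \<phi> 0" for n
    proof (induction n)
      case (Suc n) then show ?case by (cases n) auto
    qed simp
    then show ?thesis .
  qed
  finally show ?thesis .
qed

lemma coboundaries_eq_kernel: "coboundaries s = {v. intersection (lf s) (cl s) v = 0}"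
  by (auto simp: coboundaries_def intersection_def vec_eq_iff)

lemma subspace_coboundaries: "subspace (coboundaries s)"
  unfolding coboundaries_eq_kernel by (rule linear_subspace_kernel[OF linear_intersection])

text \<open>Every vertex class other than that of the leftmost vertex contributes the coboundary of
  its indicator. A linear relation among these gives a potential that is constant along the top side
  and vanishes at its left end; as every class meets the top side, all coefficients vanish.\<close>

lemma dim_coboundaries_ge_classes:
  fixes s :: "'d::finite branches"
  assumes rep: "represents s T" and wf: "well_formed s"
  defines "E \<equiv> (vertex_gluing (datum T) \<union> (vertex_gluing (datum T))\<inverse>)\<^sup>*"
  shows "card ((UNIV \<times> {0..CARD('d)}) // E) \<le> Suc (dim (coboundaries s))"
proof -
  note t = well_formedD(1,2)[OF wf]
  let ?d = "CARD('d)"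
  let ?Vert = "UNIV \<times> {0..?d} :: (side \<times> nat) set"
  let ?rt = "label_rank (lf s)" and ?rb = "label_rank (cl s)"
  define C0 where "C0 = E `` {(Top, 0)}"
  define I where "I = ?Vert // E - {C0}"
  define ind :: "(side \<times> nat) set \<Rightarrow> side \<times> nat \<Rightarrow> real" where "ind C x = (if x \<in> C then 1 else 0)" for C x
  define f :: "(side \<times> nat) set \<Rightarrow> real ^ 'd" where
    "f C = (\<chi> i. ind C (Top, ?rt i) - ind C (Top, ?rt i - 1))" for C
  have bt: "bij_betw ?rt UNIV {1..?d}" and bb: "bij_betw ?rb UNIV {1..?d}"
    by (rule bij_rank[OF tiling_inj[OF t(1)]], rule bij_rank[OF tiling_inj[OF t(2)]])
  have dt: "fst (datum T) (?rt j) = j" "snd (datum T) (?rb j) = j" for j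
  proof -
    have "top_int T = (\<lambda>j. {lf s j<..<rt s j})" "bot_int T = (\<lambda>j. {cl s j<..<cr s j})"
      using rep by (auto simp: represents_def)
    then show "fst (datum T) (?rt j) = j" "snd (datum T) (?rb j) = j"
      using left_to_right_rank[OF t(1)] left_to_right_rank[OF t(2)] by (simp_all add: datum_def)
  qed
  have eqv: "equiv UNIV E"
    unfolding E_def by (intro equivI) (auto intro!: refl_rtrancl sym_rtrancl trans_rtrancl sym_Un_converse)
  \<comment> \<open>Vertex number \<open>k\<close> is the right end of side number \<open>k\<close>,
    so \<open>e = 0\<close> glues right ends and \<open>e = 1\<close> left ends.\<close>
  have glue: "((Top, ?rt j - e), (Bot, ?rb j - e)) \<in> E" if "e \<in> {0, 1}" for j e
  proof -
    have "?rt j \<in> {1..?d}" "?rb j \<in> {1..?d}" using bt bb by (auto simp: bij_betw_def)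
    then have "((Top, ?rt j - e), (Bot, ?rb j - e)) \<in> vertex_gluing (datum T)"
      unfolding vertex_gluing_def using that dt[of j]
      by (intro UnI2 CollectI exI[of _ "?rt j"] exI[of _ "?rb j"] exI[of _ e]) simp
    then show ?thesis by (auto simp: E_def)
  qed
  have glue0: "((Top, 0), (Bot, 0)) \<in> E"
    unfolding E_def vertex_gluing_def by (intro r_into_rtrancl) auto
  have ind: "ind C x = ind C y" if "C \<in> ?Vert // E" "(x, y) \<in> E" for C x y
    using that eqv unfolding ind_def quotient_def equiv_def
    by (auto dest: transD symD)
  have "finite (UNIV :: side set)"
    by (rule finite_subset[of _ "{Top, Bot}"]) (auto intro: side.exhaust)
  then have fin: "finite (?Vert // E)" by (simp add: quotient_def)
  have "f ` I \<subseteq> coboundaries s"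
  proof (rule image_subsetI)
    fix C assume "C \<in> I"
    then have C: "C \<in> ?Vert // E" by (simp add: I_def)
    have "psum (lf s) (f C) j = ind C (Top, ?rt j - 1) - ind C (Top, 0)" for j
      by (rule psum_rank[OF tiling_inj[OF t(1)], of _ "\<lambda>k. ind C (Top, k)"]) (simp add: f_def)
    \<comment> \<open>\<open>f C\<close> is written in terms of the top side; gluing both ends of a
      side shows that it has the same increment on the bottom side.\<close>
    moreover have "psum (cl s) (f C) j = ind C (Bot, ?rb j - 1) - ind C (Bot, 0)" for j
      using ind[OF C glue[of 0]] ind[OF C glue[of 1]]
      by (intro psum_rank[OF tiling_inj[OF t(2)], of _ "\<lambda>k. ind C (Bot, k)"]) (simp add: f_def)
    ultimately show "f C \<in> coboundaries s"
      using ind[OF C glue[of 1]] ind[OF C glue0] by (simp add: coboundaries_def)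
  qed
  moreover have "\<forall>C\<in>I. x C = 0" if x: "(\<Sum>C\<in>I. x C *\<^sub>R f C) = 0" for x
  proof
    define \<Phi> where "\<Phi> k = (\<Sum>C\<in>I. x C * ind C (Top, k))" for k
    have "\<Phi> (?rt i) = \<Phi> (?rt i - 1)" for i
    proof -
      have "(\<Sum>C\<in>I. x C *\<^sub>R f C) $ i = \<Phi> (?rt i) - \<Phi> (?rt i - 1)"
        by (simp add: \<Phi>_def f_def sum_subtractf[symmetric] right_diff_distrib)
      then show ?thesis using x by simp
    qed
    moreover have "k \<in> {1..?d} \<Longrightarrow> \<exists>i. k = ?rt i" for k using bt by (auto simp: bij_betw_def)
    ultimately have step: "\<Phi> k = \<Phi> (k - 1)" if "k \<in> {1..?d}" for k using that by metis
    have const: "\<Phi> k = \<Phi> 0" if "k \<le> ?d" for k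
      using that
    proof (induction k)
      case (Suc k) then show ?case using step[of "Suc k"] by simp
    qed simp
    have "\<Phi> 0 = 0" unfolding \<Phi>_def
    proof (rule sum.neutral, rule ballI)
      fix C assume "C \<in> I"
      then have C: "C \<in> ?Vert // E" "C \<noteq> C0" by (auto simp: I_def)
      have "(Top, 0) \<notin> C"
        using C eqv unfolding C0_def quotient_def by (auto simp: equiv_class_eq_iff[OF eqv])
      then show "x C * ind C (Top, 0) = 0" by (simp add: ind_def)
    qed
    fix C assume CI: "C \<in> I"
    then have C: "C \<in> ?Vert // E" by (auto simp: I_def)
    \<comment> \<open>A bottom vertex is either the leftmost vertex or the right end of a bottom
      side, and either of these is glued to a top vertex.\<close>
    obtain k where k: "k \<le> ?d" "(Top, k) \<in> C"
    proof -
      obtain S q where q: "q \<le> ?d" "C = E `` {(S, q)}" using C by (auto simp: quotient_def)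
      show ?thesis
      proof (cases S)
        case Top
        then show ?thesis using that[of q] q eqv by (auto simp: equiv_def refl_on_def)
      next
        case Bot
        show ?thesis
        proof (cases "q = 0")
          case True
          then show ?thesis using that[of 0] q Bot glue0 eqv by (auto simp: equiv_def dest: symD)
        next
          case False
          then obtain j where j: "q = ?rb j" using bb q(1) by (force simp: bij_betw_def)
          have "?rt j \<le> ?d" using bt by (auto simp: bij_betw_def)
          then show ?thesis using that[of "?rt j"] q Bot glue[of 0 j] j eqv by (auto simp: equiv_def dest: symD)
        qed
      qed
    qed
    have "ind C' (Top, k) = (if C' = C then 1 else 0)" if "C' \<in> I" for C'
    proof -
      have "C' \<in> UNIV // E" "C \<in> UNIV // E" using that C by (auto simp: I_def quotient_def)
      then have "C' = C \<or> C' \<inter> C = {}" by (rule quotient_disj[OF eqv])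
      then show ?thesis using k(2) by (auto simp: ind_def)
    qed
    then have "\<Phi> k = (\<Sum>C'\<in>I. if C' = C then x C' else 0)"
      unfolding \<Phi>_def by (intro sum.cong) auto
    then have "\<Phi> k = x C" using CI fin by (simp add: I_def)
    then show "x C = 0" using const[OF k(1)] \<open>\<Phi> 0 = 0\<close> by simp
  qed
  ultimately have "card I \<le> dim (coboundaries s)"
    using fin by (intro independent_family_dim[of I f]) (auto simp: I_def)
  then show ?thesis using fin by (simp add: I_def card_Diff_singleton_if split: if_splits)
qed

text \<open>The genus is half of a number of vertices and sides, rounded down, and the vertex count
  gives only an inequality. That the codimension of the coboundaries is even ensures that nothing is
  lost in the rounding.\<close>

lemma dim_coboundaries_ge:
  fixes s :: "'d::finite branches"
  assumes rep: "represents s T" and wf: "well_formed s"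
  shows "CARD('d) \<le> dim (coboundaries s) + 2 * genus (datum T)"
proof -
  note t = well_formedD(1,2)[OF wf]
  obtain r where r: "even r" "dim (coboundaries s) + r = CARD('d)"
    using skew_kernel_dim[OF linear_intersection skew_intersection[OF tiling_inj[OF t(1)] tiling_inj[OF t(2)]]]
    by (auto simp: coboundaries_eq_kernel)
  then obtain h where h: "r = 2 * h" by auto
  then have "h \<le> genus (datum T)"
    using dim_coboundaries_ge_classes[OF rep wf] r(2) unfolding genus_def by linarith
  then show ?thesis using r(2) h by linarith
qed

section \<open>Branches of a generalized interval exchange\<close>

text \<open>The finitely many missing points have measure zero, which turns covering into the length
  identity of \<open>tiling\<close>; this identity is easier to maintain when tiles are cut and
  relabelled.\<close>

lemma interval_partition_tiling:
  fixes I :: "'d::finite \<Rightarrow> real set"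
  assumes "interval_partition I"
  obtains a b where "tiling 1 a b" "\<And>j. I j = {a j<..<b j}"
proof -
  have "\<forall>j. \<exists>a b. a < b \<and> I j = {a<..<b}" using assms by (simp add: interval_partition_def)
  then obtain a b where ab: "\<And>j. a j < b j" "\<And>j. I j = {a j<..<b j}" by metis
  have disj: "I i \<inter> I j = {}" if "i \<noteq> j" for i j
    using assms that by (auto simp: interval_partition_def)
  have sub: "(\<Union>j. I j) \<subseteq> {0..1}" and fin: "finite ({0..1} - (\<Union>j. I j))"
    using assms by (auto simp: interval_partition_def)
  have bd: "0 \<le> a j \<and> b j \<le> 1" for j
  proof -
    have "{a j<..<b j} \<subseteq> {0..1}" using sub ab(2) by blast
    then have "closure {a j<..<b j} \<subseteq> {0..1}" by (intro closure_minimal) auto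
    then show ?thesis using ab(1)[of j] by auto
  qed
  have dis: "b i \<le> a j \<or> b j \<le> a i" if "i \<noteq> j" for i j
  proof (rule ccontr)
    assume "\<not> (b i \<le> a j \<or> b j \<le> a i)"
    then have "max (a i) (a j) < min (b i) (b j)" using ab(1) by auto
    then obtain x where "max (a i) (a j) < x" "x < min (b i) (b j)" using dense by blast
    then have "x \<in> I i \<inter> I j" using ab(2) by auto
    then show False using disj[OF that] by auto
  qed
  have "(\<Sum>j\<in>UNIV. b j - a j) = (\<Sum>j\<in>UNIV. measure lborel (I j))"
    using ab by (intro sum.cong) (auto simp: less_imp_le)
  also have "\<dots> = measure lborel (\<Union>j. I j)"
    by (rule measure_finite_Union[symmetric]) (use disj ab in \<open>auto simp: disjoint_family_on_def less_imp_le\<close>)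
  also have "\<dots> = measure lborel {0..1::real}"
  proof -
    have "{0..1} = (\<Union>j. I j) \<union> ({0..1} - (\<Union>j. I j))" using sub by auto
    moreover have "{0..1} - (\<Union>j. I j) \<in> null_sets lborel"
      using fin by (rule finite_imp_null_set_lborel)
    ultimately show ?thesis
      using measure_Un_null_set[of "\<Union>j. I j" lborel "{0..1} - (\<Union>j. I j)"] ab(2) by auto
  qed
  finally have "(\<Sum>j\<in>UNIV. b j - a j) = 1" by simp
  then have "tiling 1 a b" using ab(1) bd dis by (auto simp: tiling_def)
  then show ?thesis using that ab(2) by blast
qed

lemma Cr_on_continuous: "Cr_on r f S \<Longrightarrow> continuous_on S f"
proof -
  assume "Cr_on r f S"
  then obtain D where D: "\<And>x. x \<in> S \<Longrightarrow> D 0 x = f x"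
    "\<And>k x. k < r \<Longrightarrow> x \<in> S \<Longrightarrow> (D k has_real_derivative D (Suc k) x) (at x within S)"
    "continuous_on S (D r)"
    unfolding Cr_on_def by blast
  have "continuous_on S (D 0)"
  proof (cases "r = 0")
    case False
    then show ?thesis unfolding continuous_on_eq_continuous_within
      by (intro ballI DERIV_continuous[OF D(2)]) auto
  qed (use D(3) in simp)
  then show ?thesis using D(1) continuous_on_cong by metis
qed

lemma strict_mono_bij_ends:
  fixes f :: "real \<Rightarrow> real"
  assumes "strict_mono_on {a..b} f" "f ` {a..b} = {c..d}" "a < b" "c < d"
  shows "f a = c" "f b = d"
proof -
  have le: "f x \<le> f y" if "a \<le> x" "x \<le> y" "y \<le> b" for x y
    using strict_mono_onD[OF assms(1), of x y] that by (cases "x = y") (auto simp: less_imp_le)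
  have "c \<in> f ` {a..b}" "d \<in> f ` {a..b}" using assms by auto
  then obtain x y where xy: "a \<le> x" "x \<le> b" "f x = c" "a \<le> y" "y \<le> b" "f y = d" by auto
  have "f a \<in> {c..d}" "f b \<in> {c..d}" using assms by auto
  then show "f a = c" "f b = d" using le[of a x] le[of y b] xy by auto
qed

lemma giet_branches:
  fixes T :: "'d::finite giet"
  assumes "giet r T"
  obtains s where "represents s T" "well_formed s" "len s = 1"
    "\<And>j. Cr_diffeo r (br s j) {lf s j..rt s j} {cl s j..cr s j}"
proof -
  obtain a b where ab: "tiling 1 a b" "\<And>j. top_int T j = {a j<..<b j}"
    using interval_partition_tiling assms unfolding giet_def by metis
  obtain c d where cd: "tiling 1 c d" "\<And>j. bot_int T j = {c j<..<d j}"
    using interval_partition_tiling assms unfolding giet_def by metis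
  note l = tilingD(2)[OF ab(1)] tilingD(2)[OF cd(1)]
  have "\<forall>j. \<exists>F. (\<forall>x\<in>{a j<..<b j}. F x = gmap T x) \<and> strict_mono_on {a j..b j} F \<and>
      Cr_diffeo r F {a j..b j} {c j..d j}"
    using assms l unfolding giet_def ab(2) cd(2) by (simp add: closure_greaterThanLessThan)
  then obtain F where F: "\<And>j x. a j < x \<Longrightarrow> x < b j \<Longrightarrow> F j x = gmap T x"
    "\<And>j. strict_mono_on {a j..b j} (F j)" "\<And>j. Cr_diffeo r (F j) {a j..b j} {c j..d j}"
    by (metis greaterThanLessThan_iff)
  have ends: "F j (a j) = c j" "F j (b j) = d j" for j
    using strict_mono_bij_ends[OF F(2) _ l] F(3) by (auto simp: Cr_diffeo_def bij_betw_def)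
  \<comment> \<open>\<open>ld\<close> and \<open>vr\<close> are placeholders here;
    \<open>giet_controlled_orbit\<close> replaces them by actual logarithmic derivatives.\<close>
  define s where "s = \<lparr>len = 1, lf = a, rt = b, br = F, ld = (\<lambda>_ _. 0), vr = (\<lambda>_ _. 0)\<rparr>"
  have "continuous_on {a j..b j} (F j)" for j
    using F(3) Cr_on_continuous by (auto simp: Cr_diffeo_def)
  then have "well_formed s" using ab(1) cd(1) F(2) by (simp add: well_formed_def s_def ends)
  moreover have "represents s T" using ab(2) cd(2) F(1) by (simp add: represents_def s_def ends)
  moreover have "len s = 1" by (simp add: s_def)
  moreover have "Cr_diffeo r (br s j) {lf s j..rt s j} {cl s j..cr s j}" for j
    using F(3) by (simp add: s_def ends)
  ultimately show ?thesis using that by blast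
qed

lemma down_closed_image:
  fixes a b :: "'d::finite \<Rightarrow> real"
  assumes t: "tiling L a b" and A: "\<And>i j. i \<in> A \<Longrightarrow> j \<notin> A \<Longrightarrow> a i < a j"
  shows "left_to_right (\<lambda>j. {a j<..<b j}) ` {1..card A} = A"
proof -
  note bij = bij_rank[OF tiling_inj[OF t]]
  have "label_rank a ` A = {1..card A}"
  proof (rule card_subset_eq)
    show "label_rank a ` A \<subseteq> {1..card A}"
    proof (rule image_subsetI)
      fix j assume "j \<in> A"
      then have "{i. a i \<le> a j} \<subseteq> A" using A by (auto simp: not_less[symmetric])
      then have "label_rank a j \<le> card A" unfolding label_rank_def by (intro card_mono) auto
      moreover have "1 \<le> label_rank a j" using bij by (auto simp: bij_betw_def)
      ultimately show "label_rank a j \<in> {1..card A}" by simp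
    qed
    show "card (label_rank a ` A) = card {1..card A}"
      using bij by (simp add: bij_betw_def card_image inj_on_subset[OF _ subset_UNIV])
  qed simp
  then have "left_to_right (\<lambda>j. {a j<..<b j}) ` {1..card A} = (\<lambda>j. left_to_right (\<lambda>j. {a j<..<b j}) (label_rank a j)) ` A"
    by (metis image_image)
  then show ?thesis by (simp add: left_to_right_rank[OF t])
qed

text \<open>A set of labels that is initial in both orders is the image of the same
  \<open>{1..card A}\<close> under both enumerations.\<close>

lemma irreducible_indecomposable:
  fixes T :: "'d::finite giet"
  assumes rep: "represents s T" and wf: "well_formed s" and irr: "irreducible_datum (datum T)"
  shows "indecomposable s"
  unfolding indecomposable_def
proof (intro notI, elim exE conjE)
  fix A assume A: "A \<noteq> {}" "A \<noteq> UNIV" "\<forall>i\<in>A. \<forall>j\<in>-A. lf s i < lf s j \<and> cl s i < cl s j"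
  have "top_int T = (\<lambda>j. {lf s j<..<rt s j})" "bot_int T = (\<lambda>j. {cl s j<..<cr s j})"
    using rep by (auto simp: represents_def)
  then have "fst (datum T) ` {1..card A} = A" "snd (datum T) ` {1..card A} = A"
    using down_closed_image[OF well_formedD(1)[OF wf], of A] down_closed_image[OF well_formedD(2)[OF wf], of A] A(3)
    by (auto simp: datum_def)
  moreover have "card A < CARD('d)" using A(2) by (intro psubset_card_mono) auto
  moreover have "1 \<le> card A" using A(1) by (simp add: Suc_le_eq card_gt_0_iff)
  ultimately show False using irr unfolding irreducible_datum_def by metis
qed

lemma giet_rauzy_orbit:
  fixes T :: "'d::finite giet"
  assumes "T \<in> giet_space r" "inf_renormalizable T" "CARD('d) \<ge> 2"
  obtains s where "rauzy_orbit T s"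
proof -
  have T: "giet r T" "irreducible_datum (datum T)" using assms(1) by (auto simp: giet_space_def)
  obtain s where s: "represents s T" "well_formed s" "len s = 1" using giet_branches[OF T(1)] by metis
  then have "rauzy_orbit T s"
    using assms irreducible_indecomposable[OF s(1,2) T(2)] by (simp add: rauzy_orbit_def)
  then show ?thesis by (rule that)
qed

lemma at_within_Icc_neq_bot: "a < b \<Longrightarrow> x \<in> {a..b} \<Longrightarrow> at x within {a..b::real} \<noteq> bot"
  by (simp add: trivial_limit_within islimpt_Icc)

text \<open>The inverse being differentiable too, the derivative of a branch does not vanish.\<close>

lemma diffeo_log_derivative:
  fixes f :: "real \<Rightarrow> real"
  assumes "Cr_diffeo r f {a..b} {c..d}" "strict_mono_on {a..b} f" "a < b" "r \<ge> 2"
  obtains g M where "\<And>x. x \<in> {a..b} \<Longrightarrow> (f has_real_derivative exp (g x)) (at x within {a..b})"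
    "\<And>x y. x \<in> {a..b} \<Longrightarrow> y \<in> {a..b} \<Longrightarrow> \<bar>g x - g y\<bar> \<le> M * \<bar>x - y\<bar>"
proof -
  let ?S = "{a..b}" and ?h = "inv_into {a..b} f"
  have bij: "bij_betw f ?S {c..d}" and "Cr_on r f ?S" "Cr_on r ?h {c..d}"
    using assms(1) by (auto simp: Cr_diffeo_def)
  then obtain D E where D: "\<And>x. x \<in> ?S \<Longrightarrow> D 0 x = f x"
    "\<And>k x. k < r \<Longrightarrow> x \<in> ?S \<Longrightarrow> (D k has_real_derivative D (Suc k) x) (at x within ?S)"
    "continuous_on ?S (D r)"
    and E: "\<And>x. x \<in> {c..d} \<Longrightarrow> E 0 x = ?h x"
    "\<And>k x. k < r \<Longrightarrow> x \<in> {c..d} \<Longrightarrow> (E k has_real_derivative E (Suc k) x) (at x within {c..d})"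
    unfolding Cr_on_def by metis
  have fS: "f x \<in> {c..d}" if "x \<in> ?S" for x using bij that by (auto simp: bij_betw_def)
  have f': "(f has_real_derivative D 1 x) (at x within ?S)" if x: "x \<in> ?S" for x
  proof -
    have "(D 0 has_real_derivative D 1 x) (at x within ?S)" using D(2)[of 0 x] x assms(4) by simp
    then show ?thesis by (rule has_field_derivative_transform_within[OF _ zero_less_one x]) (simp add: D(1))
  qed
  have pos: "D 1 x > 0" if x: "x \<in> ?S" for x
  proof -
    have nb: "at x within ?S \<noteq> bot" by (rule at_within_Icc_neq_bot[OF assms(3) x])
    have "(E 0 has_real_derivative E 1 (f x)) (at (f x) within f ` ?S)"
      using E(2)[of 0 "f x"] fS[OF x] assms(4) bij by (simp add: bij_betw_def)
    from DERIV_image_chain[OF this f'[OF x]]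
    have "(E 0 \<circ> f has_real_derivative E 1 (f x) * D 1 x) (at x within ?S)" .
    then have "((\<lambda>x. x) has_real_derivative E 1 (f x) * D 1 x) (at x within ?S)"
    proof (rule has_field_derivative_transform_within[OF _ zero_less_one x])
      fix y assume y: "y \<in> ?S"
      then show "(E 0 \<circ> f) y = y"
        using E(1)[OF fS[OF y]] bij by (simp add: bij_betw_def inv_into_f_f)
    qed
    moreover have "((\<lambda>x. x) has_real_derivative 1) (at x within ?S)" by (rule DERIV_ident)
    ultimately have "E 1 (f x) * D 1 x = 1"
      unfolding has_field_derivative_iff using tendsto_unique[OF nb] by blast
    then have "D 1 x \<noteq> 0" by auto
    moreover have "0 \<le> D 1 x"
    proof (rule tendsto_lowerbound[OF _ _ nb])
      show "((\<lambda>y. (f y - f x) / (y - x)) \<longlongrightarrow> D 1 x) (at x within ?S)"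
        using f'[OF x] by (simp add: has_field_derivative_iff)
      show "\<forall>\<^sub>F y in at x within ?S. 0 \<le> (f y - f x) / (y - x)"
      proof (rule eventually_at[THEN iffD2], intro exI[of _ 1] conjI ballI impI)
        fix y assume y: "y \<in> ?S" "y \<noteq> x \<and> dist y x < 1"
        show "0 \<le> (f y - f x) / (y - x)"
          using strict_mono_onD[OF assms(2), of x y] strict_mono_onD[OF assms(2), of y x] x y
          by (cases "x < y") (auto simp: divide_nonpos_nonpos less_imp_le)
      qed simp
    qed
    ultimately show ?thesis by simp
  qed
  have g': "((\<lambda>x. ln (D 1 x)) has_real_derivative D 2 x / D 1 x) (at x within ?S)" if x: "x \<in> ?S" for x
  proof -
    have "(D 1 has_real_derivative D 2 x) (at x within ?S)"
      using D(2)[of 1 x] x assms(4) by (simp add: numeral_2_eq_2)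
    then show ?thesis using pos[OF x] by (auto intro!: derivative_eq_intros simp: field_simps)
  qed
  have "continuous_on ?S (D 2)"
  proof (cases "r = 2")
    case False
    then show ?thesis unfolding continuous_on_eq_continuous_within
      using assms(4) by (intro ballI DERIV_continuous[OF D(2)]) auto
  qed (use D(3) in simp)
  moreover have "continuous_on ?S (D 1)"
    unfolding continuous_on_eq_continuous_within
    using assms(4) by (intro ballI DERIV_continuous[OF D(2)]) auto
  ultimately have "continuous_on ?S (\<lambda>x. D 2 x / D 1 x)"
    using pos by (intro continuous_on_divide ballI) (assumption | force)+
  then have "bounded ((\<lambda>x. D 2 x / D 1 x) ` ?S)"
    by (intro compact_imp_bounded compact_continuous_image) auto
  then obtain M where M: "\<And>x. x \<in> ?S \<Longrightarrow> norm (D 2 x / D 1 x) \<le> M"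
    unfolding bounded_iff by blast
  show ?thesis
  proof (rule that[of "\<lambda>x. ln (D 1 x)" M])
    show "(f has_real_derivative exp (ln (D 1 x))) (at x within ?S)" if "x \<in> ?S" for x
      using f'[OF that] pos[OF that] by simp
    show "\<bar>ln (D 1 x) - ln (D 1 y)\<bar> \<le> M * \<bar>x - y\<bar>" if "x \<in> ?S" "y \<in> ?S" for x y
      unfolding real_norm_def[symmetric]
      by (rule field_differentiable_bound[OF _ g' M]) (use that in auto)
  qed
qed

lemma giet_controlled_orbit:
  fixes T :: "'d::finite giet"
  assumes "T \<in> giet_space r" "inf_renormalizable T" "CARD('d) \<ge> 2" "r \<ge> 2"
  obtains s V where "controlled_orbit T s V"
proof -
  have "giet r T" "irreducible_datum (datum T)" using assms(1) by (auto simp: giet_space_def)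
  then obtain s where s: "represents s T" "well_formed s" "len s = 1"
    "\<And>j. Cr_diffeo r (br s j) {lf s j..rt s j} {cl s j..cr s j}" using giet_branches by metis
  have "\<exists>g M. (\<forall>x\<in>{lf s j..rt s j}. (br s j has_real_derivative exp (g x)) (at x within {lf s j..rt s j})) \<and>
    (\<forall>x\<in>{lf s j..rt s j}. \<forall>y\<in>{lf s j..rt s j}. \<bar>g x - g y\<bar> \<le> M * \<bar>x - y\<bar>)" for j
    by (rule diffeo_log_derivative[OF s(4) well_formedD(3)[OF s(2)] tilingD(2)[OF well_formedD(1)[OF s(2)]] assms(4)]) blast
  then obtain g M where g: "\<And>j x. x \<in> {lf s j..rt s j} \<Longrightarrow>
      (br s j has_real_derivative exp (g j x)) (at x within {lf s j..rt s j})"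
    "\<And>j x y. x \<in> {lf s j..rt s j} \<Longrightarrow> y \<in> {lf s j..rt s j} \<Longrightarrow> \<bar>g j x - g j y\<bar> \<le> M j * \<bar>x - y\<bar>"
    by metis
  \<comment> \<open>The logarithmic derivatives are Lipschitz, so linear functions serve as
    majorants; their total increment is the bound on the variation.\<close>
  define s' where "s' = s\<lparr>ld := g, vr := (\<lambda>j x. M j * x)\<rparr>"
  have s': "represents s' T" "well_formed s'" "len s' = 1"
    using s by (simp_all add: s'_def represents_def well_formed_def)
  have "controlled (\<Sum>j\<in>UNIV. M j * rt s j - M j * lf s j) s'"
    unfolding controlled_def
  proof (intro conjI allI ballI impI)
    fix j x y assume xy: "lf s' j \<le> x" "x \<le> y" "y \<le> rt s' j"
    then show "\<bar>ld s' j y - ld s' j x\<bar> \<le> vr s' j y - vr s' j x"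
      using g(2)[of y j x] by (simp add: s'_def right_diff_distrib)
  qed (use g(1) in \<open>auto simp: s'_def\<close>)
  moreover have "rauzy_orbit T s'"
    using s' assms irreducible_indecomposable[OF s'(1,2)] by (simp add: rauzy_orbit_def giet_space_def)
  ultimately show ?thesis
    using that unfolding controlled_orbit_def controlled_orbit_axioms_def by blast
qed

section \<open>Splittings, norms and angles\<close>

lemma split_proj:
  assumes "splitting E"
  shows "split_proj E x v \<in> E x"
    "v = split_proj E Stab v + split_proj E Cent v + split_proj E Unst v"
proof -
  have "\<exists>!f. (\<forall>x. f x \<in> E x) \<and> v = f Stab + f Cent + f Unst" using assms by (simp add: splitting_def)
  from theI'[OF this] show "split_proj E x v \<in> E x"
    "v = split_proj E Stab v + split_proj E Cent v + split_proj E Unst v"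
    unfolding split_proj_def by blast+
qed

lemma split_proj_unique:
  fixes E :: "osel \<Rightarrow> (real ^ 'd::finite) set"
  assumes "splitting E" "a \<in> E Stab" "b \<in> E Cent" "c \<in> E Unst" "v = a + b + c"
  shows "split_proj E Stab v = a" "split_proj E Cent v = b" "split_proj E Unst v = c"
proof -
  define f where "f = case_osel a b c"
  have f: "(\<forall>x. f x \<in> E x) \<and> v = f Stab + f Cent + f Unst"
    using assms by (auto simp: f_def split: osel.split)
  have "\<exists>!f. (\<forall>x. f x \<in> E x) \<and> v = f Stab + f Cent + f Unst" using assms(1) by (simp add: splitting_def)
  then have "(THE f. (\<forall>x. f x \<in> E x) \<and> v = f Stab + f Cent + f Unst) = f"
    by (rule the1_equality) (rule f)
  then have "split_proj E x v = f x" for x by (simp add: split_proj_def)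
  then show "split_proj E Stab v = a" "split_proj E Cent v = b" "split_proj E Unst v = c"
    by (simp_all add: f_def)
qed

lemma split_proj_eqI:
  assumes "splitting E" "\<And>x. f x \<in> E x" "v = f Stab + f Cent + f Unst"
  shows "split_proj E x v = f x"
  using split_proj_unique[OF assms(1) assms(2) assms(2) assms(2) assms(3)] by (cases x) auto

lemma splitting_subspace: "splitting E \<Longrightarrow> subspace (E x)"
  by (simp add: splitting_def)

lemma linear_split_proj:
  assumes "splitting E"
  shows "linear (split_proj E x)"
proof (rule linearI)
  have add3: "u = a + b + c \<Longrightarrow> v = a' + b' + c' \<Longrightarrow> u + v = (a + a') + (b + b') + (c + c')"
    for u v a b c a' b' c' :: "real ^ 'a" by simp
  note sub = splitting_subspace[OF assms]
  fix u v
  have "split_proj E x (u + v) = (\<lambda>x. split_proj E x u + split_proj E x v) x"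
  proof (rule split_proj_eqI[OF assms])
    show "u + v = (split_proj E Stab u + split_proj E Stab v) + (split_proj E Cent u + split_proj E Cent v) +
        (split_proj E Unst u + split_proj E Unst v)"
      by (rule add3[OF split_proj(2)[OF assms, of u] split_proj(2)[OF assms, of v]])
  qed (intro subspace_add sub split_proj assms)
  then show "split_proj E x (u + v) = split_proj E x u + split_proj E x v" by simp
next
  note sub = splitting_subspace[OF assms]
  fix r v
  have "split_proj E x (r *\<^sub>R v) = (\<lambda>x. r *\<^sub>R split_proj E x v) x"
  proof (rule split_proj_eqI[OF assms])
    show "r *\<^sub>R v = r *\<^sub>R split_proj E Stab v + r *\<^sub>R split_proj E Cent v + r *\<^sub>R split_proj E Unst v"
      by (metis split_proj(2)[OF assms, of v] scaleR_right_distrib)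
  qed (intro subspace_scale sub split_proj assms)
  then show "split_proj E x (r *\<^sub>R v) = r *\<^sub>R split_proj E x v" by simp
qed

lemma split_proj_same:
  assumes "splitting E" "v \<in> E x"
  shows "split_proj E y v = (if y = x then v else 0)"
proof (rule split_proj_eqI[OF assms(1)])
  fix y show "(if y = x then v else 0) \<in> E y"
    using assms subspace_0[OF splitting_subspace[OF assms(1)]] by auto
qed (cases x; simp)

lemma split_proj_map:
  assumes E: "splitting E" and F: "splitting F" and g: "linear g" and im: "\<And>x. g ` E x \<subseteq> F x"
  shows "split_proj F x (g v) = g (split_proj E x v)"
proof (rule split_proj_eqI[OF F])
  show "g v = g (split_proj E Stab v) + g (split_proj E Cent v) + g (split_proj E Unst v)"
    by (metis split_proj(2)[OF E, of v] linear_add[OF g])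
qed (use im split_proj(1)[OF E] in blast)

lemma norm_split_proj_le:
  assumes "splitting (E :: osel \<Rightarrow> (real ^ 'd::finite) set)"
  shows "norm (split_proj E x v) \<le> onorm (split_proj E x) * norm v"
  using onorm[of "split_proj E x" v] linear_split_proj[OF assms] by (simp add: linear_conv_bounded_linear)

lemma bounded_linear_mv: "bounded_linear ((*v) (A :: real ^ 'n ^ 'm::finite))"
  by (simp add: linear_conv_bounded_linear[symmetric] matrix_vector_mul_linear)

lemma norm_mv_le: "norm (A *v v) \<le> mnorm A * norm (v :: real ^ 'd::finite)"
  unfolding mnorm_def by (rule onorm[OF bounded_linear_mv])

lemma mv_sum: "A *v (\<Sum>i\<in>S. f i) = (\<Sum>i\<in>S. (A :: real ^ 'd ^ 'd::finite) *v f i)"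
  by (rule linear_sum[OF matrix_vector_mul_linear])

lemma mnorm_nonneg: "0 \<le> mnorm A"
  unfolding mnorm_def by (rule onorm_pos_le[OF bounded_linear_mv])

text \<open>The quotient at \<open>v = 0\<close> is 0 by the convention for division, so the
  supremum behaves well on the trivial subspace too.\<close>

lemma mnorm_on_bdd: "bdd_above ((\<lambda>v. norm (A *v v :: real ^ 'd) / norm (v :: real ^ 'd::finite)) ` S)"
proof (rule bdd_aboveI2)
  fix v show "norm (A *v v) / norm v \<le> mnorm A"
    using norm_mv_le[of A v] mnorm_nonneg[of A] by (cases "v = 0") (auto simp: divide_le_eq)
qed

lemma norm_mv_le_on: "v \<in> S \<Longrightarrow> norm (A *v v) \<le> mnorm_on A S * norm v"
proof -
  assume "v \<in> S"
  then have "norm (A *v v) / norm v \<le> mnorm_on A S"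
    unfolding mnorm_on_def by (rule cSUP_upper[OF _ mnorm_on_bdd])
  then show ?thesis by (cases "v = 0") (auto simp: divide_le_eq)
qed

lemma mnorm_on_id: "v \<in> S \<Longrightarrow> v \<noteq> 0 \<Longrightarrow> 1 \<le> mnorm_on (mat 1) S"
  using norm_mv_le_on[of v S "mat 1"] by simp

lemma mnorm_on_nonneg: "S \<noteq> {} \<Longrightarrow> 0 \<le> mnorm_on A S"
proof -
  assume "S \<noteq> {}"
  then obtain v where "v \<in> S" by blast
  then show ?thesis unfolding mnorm_on_def by (intro cSUP_upper2[OF mnorm_on_bdd]) auto
qed

lemma component_le_mnorm: "\<bar>A $ i $ j\<bar> \<le> mnorm (A :: real ^ 'd ^ 'd::finite)"
proof -
  have "\<bar>A $ i $ j\<bar> = \<bar>(A *v axis j 1) $ i\<bar>" by (simp add: matrix_vector_mult_basis column_def)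
  also have "\<dots> \<le> norm (A *v axis j 1)" by (rule component_le_norm_cart)
  also have "\<dots> \<le> mnorm A" using norm_mv_le[of A "axis j 1"] by simp
  finally show ?thesis .
qed

lemma norm_le_sum_bound:
  fixes v :: "real ^ 'd::finite" and B :: real
  assumes "\<And>i. \<bar>v $ i\<bar> \<le> B"
  shows "norm v \<le> CARD('d) * B"
proof -
  have "(\<Sum>i\<in>UNIV. \<bar>v $ i\<bar>) \<le> (\<Sum>i\<in>(UNIV::'d set). B)" by (intro sum_mono assms)
  then show ?thesis using norm_le_l1_cart[of v] by simp
qed

lemma mnorm_le_entries:
  fixes A :: "real ^ 'd ^ 'd::finite" and B :: real
  assumes "\<And>i j. \<bar>A $ i $ j\<bar> \<le> B" "0 \<le> B"
  shows "mnorm A \<le> CARD('d) ^ 2 * B"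
  unfolding mnorm_def
proof (rule onorm_le)
  fix v
  have "\<bar>(A *v v) $ i\<bar> \<le> CARD('d) * (B * norm v)" for i
  proof -
    have "\<bar>(A *v v) $ i\<bar> \<le> (\<Sum>j\<in>UNIV. \<bar>A $ i $ j * v $ j\<bar>)"
      unfolding matrix_vector_mult_def by (simp add: sum_abs)
    also have "\<dots> \<le> (\<Sum>j\<in>(UNIV::'d set). B * norm v)"
      unfolding abs_mult by (intro sum_mono mult_mono assms component_le_norm_cart) auto
    finally show ?thesis by simp
  qed
  then have "norm (A *v v) \<le> CARD('d) * (CARD('d) * (B * norm v))" by (rule norm_le_sum_bound)
  then show "norm (A *v v) \<le> CARD('d) ^ 2 * B * norm v" by (simp add: power2_eq_square mult.assoc)
qed

text \<open>Both angles with \<open>w\<close> and with \<open>- w\<close> are large, so the cosine is bounded away from \<open>\<plusminus>1\<close>.\<close>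

lemma angle_norm_bound:
  fixes E F :: "(real ^ 'd::finite) set"
  assumes ang: "subspace_angle E F > \<delta>" and \<delta>: "\<delta> > 0" and F: "subspace F"
    and v: "v \<in> E" "v \<noteq> 0" and w: "w \<in> F" "w \<noteq> 0"
  shows "norm v \<le> 1 / sqrt (1 - cos (min \<delta> pi)) * norm (v + w)"
proof -
  \<comment> \<open>Truncation at \<open>pi\<close> keeps \<open>e\<close> in the range where the
    cosine decreases.\<close>
  define e where "e = min \<delta> pi"
  have e: "0 < e" "e \<le> pi" using \<delta> by (auto simp: e_def)
  have c1: "cos e < 1" using cos_monotone_0_pi[of 0 e] e by simp
  have cs: "v' \<bullet> w' / (norm v' * norm w') \<le> cos e"
    if "v' \<in> E - {0}" "w' \<in> F - {0}" for v' w'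
  proof -
    let ?t = "v' \<bullet> w' / (norm v' * norm w')"
    have nz: "norm v' * norm w' > 0" using that by auto
    have t: "\<bar>?t\<bar> \<le> 1"
      using Cauchy_Schwarz_ineq2[of v' w'] nz by (simp add: abs_divide divide_le_eq)
    then have t1: "-1 \<le> ?t" "?t \<le> 1" by linarith+
    have bdd: "bdd_below ((\<lambda>(v, w). arccos (v \<bullet> w / (norm v * norm w))) ` ((E - {0}) \<times> (F - {0})))"
    proof (rule bdd_belowI2[where m = 0])
      fix p :: "(real ^ 'd) \<times> (real ^ 'd)"
      obtain a b where p: "p = (a, b)" by (cases p)
      have "\<bar>a \<bullet> b / (norm a * norm b)\<bar> \<le> 1"
        using Cauchy_Schwarz_ineq2[of a b] by (auto simp: abs_divide divide_le_eq)
      then have "-1 \<le> a \<bullet> b / (norm a * norm b)" "a \<bullet> b / (norm a * norm b) \<le> 1" by linarith+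
      then show "0 \<le> (case p of (v, w) \<Rightarrow> arccos (v \<bullet> w / (norm v * norm w)))"
        using arccos_lbound[of "a \<bullet> b / (norm a * norm b)"] p by auto
    qed
    have "subspace_angle E F \<le> arccos ?t"
      unfolding subspace_angle_def using cINF_lower[OF bdd, of "(v', w')"] that by auto
    then have "e \<le> arccos ?t" using ang by (auto simp: e_def)
    moreover have "arccos ?t \<le> pi" using t1 by (rule arccos_ubound)
    ultimately have "cos (arccos ?t) \<le> cos e" using e cos_monotone_0_pi_le[of e "arccos ?t"] by simp
    then show ?thesis using cos_arccos_abs[OF t] by simp
  qed
  have nvw: "0 < norm v * norm w" using v w by simp
  have c0: "- (v \<bullet> w) \<le> cos e * (norm v * norm w)"
    using cs[of v "- w"] v w subspace_neg[OF F, of w] pos_divide_le_eq[OF nvw, of "- (v \<bullet> w)" "cos e"] by simp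
  have "v \<bullet> w \<le> cos e * (norm v * norm w)"
    using cs[of v w] v w by (simp add: divide_le_eq)
  \<comment> \<open>The sum of the estimates for \<open>w\<close> and \<open>- w\<close>. The sign
    of the cosine is needed to multiply the inequality between means by it.\<close>
  then have "0 \<le> cos e * (norm v * norm w)" using c0 by linarith
  then have cpos: "0 \<le> cos e" using nvw by (simp add: zero_le_mult_iff)
  have "2 * (norm v * norm w) \<le> norm v ^ 2 + norm w ^ 2"
    using sum_squares_bound[of "norm v" "norm w"] by simp
  then have "cos e * (2 * (norm v * norm w)) \<le> cos e * (norm v ^ 2 + norm w ^ 2)"
    using cpos by (rule mult_left_mono)
  moreover have "norm (v + w) ^ 2 = norm v ^ 2 + norm w ^ 2 + 2 * (v \<bullet> w)"
    by (simp add: power2_norm_eq_inner inner_add_left inner_add_right inner_commute)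
  ultimately have "norm v ^ 2 + norm w ^ 2 - cos e * (norm v ^ 2 + norm w ^ 2) \<le> norm (v + w) ^ 2"
    using c0 by linarith
  moreover have "(1 - cos e) * norm v ^ 2 \<le> (1 - cos e) * (norm v ^ 2 + norm w ^ 2)"
    using c1 by (intro mult_left_mono) auto
  ultimately have "(1 - cos e) * norm v ^ 2 \<le> norm (v + w) ^ 2" by (simp add: algebra_simps)
  then have "sqrt ((1 - cos e) * norm v ^ 2) \<le> norm (v + w)"
    by (metis real_sqrt_le_mono real_sqrt_abs abs_norm_cancel)
  then have "sqrt (1 - cos e) * norm v \<le> norm (v + w)" by (simp add: real_sqrt_mult)
  moreover have "sqrt (1 - cos e) > 0" using c1 by simp
  ultimately show ?thesis by (simp add: e_def[symmetric] pos_le_divide_eq mult.commute)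
qed

section \<open>Cocycles with a regular splitting\<close>

lemma splitting_dim:
  fixes E :: "osel \<Rightarrow> (real ^ 'd::finite) set"
  assumes "splitting E"
  shows "dim (E Stab) + dim (E Cent) + dim (E Unst) \<le> CARD('d)"
proof -
  note sub = splitting_subspace[OF assms]
  let ?S = "{x + y |x y. x \<in> E Stab \<and> y \<in> E Cent}"
  have S: "subspace ?S" by (rule subspace_sums[OF sub sub])
  have "E Stab \<inter> E Cent = {0}"
  proof (intro equalityI subsetI)
    fix v assume "v \<in> E Stab \<inter> E Cent"
    then show "v \<in> {0}"
      using split_proj_same[OF assms, of v Stab Stab] split_proj_same[OF assms, of v Cent Stab] by simp
  qed (use subspace_0[OF sub] in auto)
  then have 1: "dim ?S = dim (E Stab) + dim (E Cent)"
    using dim_sums_Int[OF sub[of Stab] sub[of Cent]] by simp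
  have "?S \<inter> E Unst = {0}"
  proof (intro equalityI subsetI)
    fix v assume v: "v \<in> ?S \<inter> E Unst"
    then obtain a b where ab: "a \<in> E Stab" "b \<in> E Cent" "v = a + b" by auto
    have "split_proj E Unst v = 0"
      using split_proj_unique(3)[OF assms ab(1,2) subspace_0[OF sub], of v] ab(3) by simp
    then show "v \<in> {0}" using split_proj_same[OF assms, of v Unst Unst] v by simp
  next
    have "0 + 0 \<in> ?S" using subspace_0[OF sub] by blast
    then show "v \<in> ?S \<inter> E Unst" if "v \<in> {0}" for v using that subspace_0[OF sub] by auto
  qed
  then have 2: "dim {x + y |x y. x \<in> ?S \<and> y \<in> E Unst} = dim ?S + dim (E Unst)"
    using dim_sums_Int[OF S sub[of Unst]] by simp
  have "dim {x + y |x y. x \<in> ?S \<and> y \<in> E Unst} \<le> CARD('d)"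
    by (rule dim_subset_UNIV_cart)
  then show ?thesis using 1 2 by simp
qed

lemma exp_decay: "0 < \<theta> \<Longrightarrow> (\<lambda>n. exp (- \<theta> * real n)) \<longlonglongrightarrow> 0"
  using LIMSEQ_power_zero[of "exp (- \<theta>)"] by (simp add: exp_of_nat_mult[symmetric] mult.commute)

lemma eq_0_if_le_decay:
  fixes X a :: real
  assumes "f \<longlonglongrightarrow> 0" "eventually (\<lambda>n. \<bar>a\<bar> \<le> X * f n) sequentially"
  shows "a = 0"
proof -
  have "(\<lambda>n. X * f n) \<longlonglongrightarrow> 0" using tendsto_mult_right_zero[OF assms(1)] .
  then have "\<bar>a\<bar> \<le> 0" by (rule tendsto_lowerbound) (use assms(2) in auto)
  then show ?thesis by simp
qed

text \<open>The index \<open>Suc (k - 1)\<close> reproduces the summand of the Diophantine condition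
  literally; it equals \<open>k\<close> for \<open>k \<ge> 1\<close>.\<close>

definition backward_term ::
  "(nat \<Rightarrow> nat \<Rightarrow> real ^ 'd ^ 'd::finite) \<Rightarrow> (osel \<Rightarrow> nat \<Rightarrow> (real ^ 'd) set) \<Rightarrow> (nat \<Rightarrow> nat) \<Rightarrow> nat \<Rightarrow> nat \<Rightarrow> real"
where
  "backward_term M \<Gamma> ns n k = mnorm_on (M (ns k) (ns n)) (\<Gamma> Stab (ns k)) *
     onorm (split_proj (\<lambda>y. \<Gamma> y (ns k)) Stab) * mnorm (M (ns (k - 1)) (ns (Suc (k - 1))))"

definition forward_term ::
  "(nat \<Rightarrow> nat \<Rightarrow> real ^ 'd ^ 'd::finite) \<Rightarrow> (osel \<Rightarrow> nat \<Rightarrow> (real ^ 'd) set) \<Rightarrow> (nat \<Rightarrow> nat) \<Rightarrow> nat \<Rightarrow> nat \<Rightarrow> real"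
where
  "forward_term M \<Gamma> ns n k = mnorm_on (matrix_inv (M (ns n) (ns k))) (\<Gamma> Unst (ns k)) *
     onorm (split_proj (\<lambda>y. \<Gamma> y (ns k)) Unst) * mnorm (M (ns (k - 1)) (ns (Suc (k - 1))))"

text \<open>The linear core of the argument, detached from interval maps. \<open>K\<close> stands
  for the coboundaries at time 0 and \<open>dual\<close> for their orbits under the dual cocycle;
  the genus survives only in the dimension inequality \<open>dim_K\<close>. One constant
  \<open>A\<close> serves for several independent bounds.\<close>

locale regular_cocycle =
  fixes Q :: "nat \<Rightarrow> nat \<Rightarrow> real ^ 'd ^ 'd::finite"
    and \<Gamma> :: "osel \<Rightarrow> nat \<Rightarrow> (real ^ 'd) set"
    and ns ks :: "nat \<Rightarrow> nat" and \<omega> :: "nat \<Rightarrow> real ^ 'd"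
    and K :: "(real ^ 'd) set" and dual :: "real ^ 'd \<Rightarrow> nat \<Rightarrow> real ^ 'd"
    and A B \<theta> \<delta> :: real
  assumes Q_refl: "Q n n = mat 1"
    and Q_comp: "l \<le> m \<Longrightarrow> m \<le> n \<Longrightarrow> Q l n = Q m n ** Q l m"
    and Q_invertible: "m \<le> n \<Longrightarrow> invertible (Q m n)"
    and Q_nonneg: "m \<le> n \<Longrightarrow> 0 \<le> Q m n $ i $ j" and Q_diag: "m \<le> n \<Longrightarrow> 1 \<le> Q m n $ i $ i"
    and split: "splitting (\<lambda>x. \<Gamma> x n)"
    and invariant: "m \<le> n \<Longrightarrow> (*v) (Q m n) ` \<Gamma> x m = \<Gamma> x n"
    and \<theta>: "0 < \<theta>" and \<delta>: "0 < \<delta>" and A: "0 \<le> A"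
    and stab: "v \<in> \<Gamma> Stab 0 \<Longrightarrow> norm (Q 0 n *v v) \<le> A * exp (- \<theta> * real n) * norm v"
    and unst: "v \<in> \<Gamma> Unst n \<Longrightarrow> norm (matrix_inv (Q 0 n) *v v) \<le> A * exp (- \<theta> * real n) * norm v"
    and ns_0: "ns 0 = 0" and ns_Suc: "ns k \<le> ns (Suc k)" and ns_ge: "k \<le> Suc (ns k)"
    and ks: "strict_mono ks"
    and backward: "(\<Sum>k = 1..ks m. backward_term Q \<Gamma> ns (ks m) k) \<le> B"
    and forward_summable: "summable (\<lambda>i. forward_term Q \<Gamma> ns (ks m) (ks m + 1 + i))"
    and forward: "(\<Sum>i. forward_term Q \<Gamma> ns (ks m) (ks m + 1 + i)) \<le> B"
    and angle: "x \<noteq> y \<Longrightarrow> \<Gamma> x (ns (ks m)) \<noteq> {0} \<Longrightarrow> \<Gamma> y (ns (ks m)) \<noteq> {0} \<Longrightarrow>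
        subspace_angle (\<Gamma> x (ns (ks m))) (\<Gamma> y (ns (ks m))) > \<delta>"
    and subexp: "(\<lambda>m. 1 / real m * ln (mnorm (Q (ns (ks m)) (ns (ks (Suc m)))))) \<longlonglongrightarrow> 0"
    and \<omega>_err: "m \<le> n \<Longrightarrow> \<bar>\<omega> n $ i - (Q m n *v \<omega> m) $ i\<bar> \<le> A * (\<Sum>j\<in>UNIV. Q m n $ i $ j)"
    and K: "subspace K"
    and dual_inner: "h \<in> K \<Longrightarrow> dual h n \<bullet> (Q 0 n *v u) = h \<bullet> u"
    and dual_norm: "h \<in> K \<Longrightarrow> norm (dual h m) \<le> A * norm (dual h n)"
    and dual_0: "dual h 0 = h"
    and dual_\<omega>: "h \<in> K \<Longrightarrow> \<bar>dual h n \<bullet> \<omega> n\<bar> \<le> A * norm (dual h n)"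
    and dim_K: "CARD('d) \<le> dim K + dim (\<Gamma> Stab 0) + dim (\<Gamma> Unst 0)"
begin

abbreviation "P n x \<equiv> split_proj (\<lambda>y. \<Gamma> y n) x"
abbreviation "N m \<equiv> ns (ks m)"
abbreviation "Qi m n \<equiv> matrix_inv (Q m n)"

lemma P_sum: "v = P n Stab v + P n Cent v + P n Unst v"
  by (rule split_proj(2)[OF split])

lemma P_in: "P n x v \<in> \<Gamma> x n"
  by (rule split_proj(1)[OF split])

lemma P_linear: "linear (P n x)"
  by (rule linear_split_proj[OF split])

lemma \<Gamma>_subspace: "subspace (\<Gamma> x n)"
  by (rule splitting_subspace[OF split])

lemma P_Q: "m \<le> n \<Longrightarrow> P n x (Q m n *v v) = Q m n *v P m x v"
  by (rule split_proj_map[OF split split]) (use invariant in auto)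

lemma Qi_Q:
  assumes mn: "m \<le> n"
  shows "Qi m n *v (Q m n *v v) = v" "Q m n *v (Qi m n *v v) = v"
proof -
  have "Q m n ** Qi m n = mat 1 \<and> Qi m n ** Q m n = mat 1"
    using Q_invertible[OF mn] unfolding invertible_def matrix_inv_def by (rule someI_ex)
  then show "Qi m n *v (Q m n *v v) = v" "Q m n *v (Qi m n *v v) = v"
    by (simp_all add: matrix_vector_mul_assoc)
qed

lemma Q_Q: "l \<le> m \<Longrightarrow> m \<le> n \<Longrightarrow> Q m n *v (Q l m *v v) = Q l n *v v"
  by (simp add: Q_comp[of l m n] matrix_vector_mul_assoc)

lemma Q_\<Gamma>: "m \<le> n \<Longrightarrow> v \<in> \<Gamma> x m \<Longrightarrow> Q m n *v v \<in> \<Gamma> x n"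
  using invariant by blast

lemma Qi_\<Gamma>:
  assumes "m \<le> n" "v \<in> \<Gamma> x n"
  shows "Qi m n *v v \<in> \<Gamma> x m"
proof -
  obtain u where "u \<in> \<Gamma> x m" "v = Q m n *v u" using assms invariant[of m n x] by blast
  then show ?thesis by (simp add: Qi_Q(1)[OF assms(1)])
qed

lemma ns_mono: "k \<le> k' \<Longrightarrow> ns k \<le> ns k'"
  by (rule lift_Suc_mono_le) (rule ns_Suc)

lemma ks_ge: "m \<le> ks m"
  by (rule strict_mono_imp_increasing[OF ks])

lemma N_mono: "m \<le> m' \<Longrightarrow> N m \<le> N m'"
  using ns_mono strict_mono_less_eq[OF ks] by blast

lemma N_ge: "m \<le> Suc (N m)"
  using ks_ge[of m] ns_ge[of "ks m"] by simp

lemma N_at_top: "filterlim N at_top sequentially"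
  unfolding filterlim_at_top
proof
  fix Z show "eventually (\<lambda>m. Z \<le> N m) sequentially"
    using eventually_ge_at_top[of "Suc Z"]
    by eventually_elim (use N_ge in \<open>meson Suc_le_mono order_trans\<close>)
qed

lemma N_decay: "(\<lambda>m. exp (- \<theta> * real (N m))) \<longlonglongrightarrow> 0"
  using filterlim_compose[OF exp_decay[OF \<theta>] N_at_top] .

lemma mnorm_Q_ge_1: "m \<le> n \<Longrightarrow> 1 \<le> mnorm (Q m n)"
  using Q_diag[of m n undefined] component_le_mnorm[of "Q m n" undefined undefined] by linarith

text \<open>Entries do not decrease along the cocycle, as the later factor is nonnegative with
  diagonal entries at least 1. Thus an estimate between two consecutive times \<open>N m\<close>
  also covers the times in between.\<close>

lemma mnorm_Q_mono:
  assumes "l \<le> m" "m \<le> n"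
  shows "mnorm (Q l m) \<le> CARD('d) ^ 2 * mnorm (Q l n)"
proof (rule mnorm_le_entries)
  fix i j
  have "Q l m $ i $ j \<le> Q m n $ i $ i * Q l m $ i $ j"
    using mult_right_mono[OF Q_diag[OF assms(2), of i] Q_nonneg[OF assms(1), of i j]] by simp
  also have "\<dots> \<le> (\<Sum>k\<in>UNIV. Q m n $ i $ k * Q l m $ k $ j)"
    using Q_nonneg assms by (intro member_le_sum) auto
  also have "\<dots> = Q l n $ i $ j" by (simp add: Q_comp[OF assms] matrix_matrix_mult_def)
  also have "\<dots> \<le> mnorm (Q l n)" using component_le_mnorm[of "Q l n" i j] by linarith
  finally show "\<bar>Q l m $ i $ j\<bar> \<le> mnorm (Q l n)" using Q_nonneg[OF assms(1)] by simp
qed (rule mnorm_nonneg)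

text \<open>One factor bounds a row sum by the norm of the matrix, the other a norm by the
  coordinates.\<close>

definition "A1 = CARD('d) * (CARD('d) * A)"

lemma A1: "0 \<le> A1"
  using A by (simp add: A1_def)

lemma \<omega>_err_norm:
  assumes "m \<le> n"
  shows "norm (\<omega> n - Q m n *v \<omega> m) \<le> A1 * mnorm (Q m n)"
proof -
  have "\<bar>(\<omega> n - Q m n *v \<omega> m) $ i\<bar> \<le> A * (CARD('d) * mnorm (Q m n))" for i
  proof -
    have "(\<Sum>j\<in>UNIV. Q m n $ i $ j) \<le> (\<Sum>j\<in>(UNIV::'d set). mnorm (Q m n))"
      by (intro sum_mono order_trans[OF abs_ge_self component_le_mnorm])
    then have "A * (\<Sum>j\<in>UNIV. Q m n $ i $ j) \<le> A * (CARD('d) * mnorm (Q m n))"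
      using A by (intro mult_left_mono) auto
    then show ?thesis using \<omega>_err[OF assms, of i] by simp
  qed
  then have "norm (\<omega> n - Q m n *v \<omega> m) \<le> CARD('d) * (A * (CARD('d) * mnorm (Q m n)))"
    by (rule norm_le_sum_bound)
  then show ?thesis by (simp add: A1_def algebra_simps)
qed

lemma onorm_P_nonneg: "0 \<le> onorm (P n x)"
  using P_linear by (intro onorm_pos_le) (simp add: linear_conv_bounded_linear)

lemma \<Gamma>_nonempty: "\<Gamma> x n \<noteq> {}"
  using subspace_0[OF \<Gamma>_subspace] by blast

lemma backward_term_nonneg: "0 \<le> backward_term Q \<Gamma> ns n k"
  unfolding backward_term_def
  by (intro mult_nonneg_nonneg mnorm_on_nonneg \<Gamma>_nonempty onorm_P_nonneg mnorm_nonneg)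

lemma B: "0 \<le> B"
  using sum_nonneg[of "{1..ks 0}", OF backward_term_nonneg] backward[of 0] by (rule order_trans)

text \<open>The last summand of the backward condition bounds the stable projection.\<close>

lemma P_stab_bound:
  assumes "1 \<le> m"
  shows "norm (P (N m) Stab v) \<le> B * norm v"
proof (cases "\<Gamma> Stab (N m) = {0}")
  case True
  then have "P (N m) Stab v = 0" using P_in[of "N m" Stab v] by simp
  then show ?thesis using B by simp
next
  case False
  then obtain u where u: "u \<in> \<Gamma> Stab (N m)" "u \<noteq> 0" using \<Gamma>_nonempty by blast
  have k: "1 \<le> ks m" using ks_ge[of m] assms by simp
  have "backward_term Q \<Gamma> ns (ks m) (ks m) \<le> B"
    by (rule order_trans[OF member_le_sum backward[of m]])
      (use k in \<open>simp_all only: backward_term_nonneg atLeastAtMost_iff order_refl finite_atLeastAtMost simp_thms\<close>)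
  moreover have "1 \<le> mnorm_on (Q (N m) (N m)) (\<Gamma> Stab (N m))"
    unfolding Q_refl by (rule mnorm_on_id[OF u])
  moreover have "1 \<le> mnorm (Q (ns (ks m - 1)) (ns (Suc (ks m - 1))))"
    by (rule mnorm_Q_ge_1[OF ns_Suc])
  moreover have "p \<le> a * p * b" if "1 \<le> a" "1 \<le> b" "0 \<le> p" for a b p :: real
    using mult_mono[OF that(1,2)] that mult_left_mono[of 1 "a * b" p] by (simp add: mult_ac)
  ultimately have "onorm (P (N m) Stab) \<le> B"
    using onorm_P_nonneg[of "N m" Stab] order_trans unfolding backward_term_def by blast
  then show ?thesis
    using norm_split_proj_le[OF split[of "N m"], of Stab v] mult_right_mono[of "onorm (P (N m) Stab)" B "norm v"] by simp
qed

text \<open>Pairwise angles alone do not control the projections of a splitting into three spaces.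
  The stable projection is already bounded, and once its part is removed, the angle between the
  central and the unstable space controls the rest.\<close>

lemma P_bound: "\<exists>C\<ge>0. \<forall>m\<ge>1. \<forall>x v. norm (P (N m) x v) \<le> C * norm v"
proof -
  \<comment> \<open>The value 1 covers the case in which the central or the unstable component
    vanishes and no angle is available.\<close>
  define D where "D = max 1 (1 / sqrt (1 - cos (min \<delta> pi)))"
  have D: "1 \<le> D" by (simp add: D_def)
  have u: "norm (P (N m) Unst v) \<le> D * ((1 + B) * norm v)" if m: "1 \<le> m" for m v
  proof -
    let ?u = "P (N m) Unst v" and ?c = "P (N m) Cent v"
    have sum: "?u + ?c = v - P (N m) Stab v" using P_sum[of v "N m"] by (simp add: algebra_simps)
    have le: "norm (?u + ?c) \<le> (1 + B) * norm v"
      unfolding sum using norm_triangle_ineq4[of v "P (N m) Stab v"] P_stab_bound[OF m, of v] by (simp add: algebra_simps)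
    have "norm ?u \<le> D * norm (?u + ?c)"
    proof (cases "?u = 0 \<or> ?c = 0")
      case True
      then show ?thesis using D mult_right_mono[OF D, of "norm ?u"] by auto
    next
      case False
      then have "norm ?u \<le> 1 / sqrt (1 - cos (min \<delta> pi)) * norm (?u + ?c)"
      proof (intro angle_norm_bound[OF angle \<delta> \<Gamma>_subspace])
        show "\<Gamma> Unst (N m) \<noteq> {0}" "\<Gamma> Cent (N m) \<noteq> {0}"
          using P_in[of "N m" Unst v] P_in[of "N m" Cent v] False by blast+
      qed (use P_in False in auto)
      also have "\<dots> \<le> D * norm (?u + ?c)" by (intro mult_right_mono) (simp_all add: D_def)
      finally show ?thesis .
    qed
    then show ?thesis using mult_left_mono[OF le, of D] D by linarith
  qed
  let ?C = "B + D * (1 + B) + 1"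
  have C: "norm (P (N m) x v) \<le> ?C * norm v" if m: "1 \<le> m" for m x v
  proof (cases x)
    case Stab
    have "B * norm v \<le> ?C * norm v" using D B by (intro mult_right_mono) auto
    then show ?thesis using P_stab_bound[OF m, of v] Stab by simp
  next
    case Unst
    have "D * (1 + B) * norm v \<le> ?C * norm v" using D B by (intro mult_right_mono) auto
    then show ?thesis using u[OF m, of v] Unst by (simp add: mult.assoc)
  next
    case Cent
    have "P (N m) Cent v = v - P (N m) Stab v - P (N m) Unst v" using P_sum[of v "N m"] by (simp add: algebra_simps)
    then have "norm (P (N m) Cent v) \<le> norm v + norm (P (N m) Stab v) + norm (P (N m) Unst v)"
      using norm_triangle_ineq4[of "v - P (N m) Stab v" "P (N m) Unst v"] norm_triangle_ineq4[of v "P (N m) Stab v"] by simp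
    then show ?thesis using Cent u[OF m, of v] P_stab_bound[OF m, of v] by (simp add: algebra_simps)
  qed
  show ?thesis using C D B by (intro exI[of _ ?C]) auto
qed

section \<open>Stable and unstable components of the log-slopes\<close>

definition err :: "nat \<Rightarrow> real ^ 'd" where
  "err k = \<omega> (ns k) - Q (ns (k - 1)) (ns (Suc (k - 1))) *v \<omega> (ns (k - 1))"

lemma norm_err: "1 \<le> k \<Longrightarrow> norm (err k) \<le> A1 * mnorm (Q (ns (k - 1)) (ns (Suc (k - 1))))"
  using \<omega>_err_norm[OF ns_Suc, of "k - 1"] by (simp add: err_def)

text \<open>Discrete variation of constants: the error made at each return is transported to the
  final time.\<close>

lemma \<omega>_expansion:
  "\<omega> (ns k) = Q 0 (ns k) *v \<omega> 0 + (\<Sum>j = 1..k. Q (ns j) (ns k) *v err j)"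
proof (induction k)
  case 0
  then show ?case by (simp add: ns_0 Q_refl)
next
  case (Suc k)
  let ?Z = "Q (ns k) (ns (Suc k))"
  have "\<omega> (ns (Suc k)) = ?Z *v \<omega> (ns k) + err (Suc k)" by (simp add: err_def)
  also have "?Z *v \<omega> (ns k) = Q 0 (ns (Suc k)) *v \<omega> 0 + (\<Sum>j = 1..k. Q (ns j) (ns (Suc k)) *v err j)"
  proof -
    have "(\<Sum>j = 1..k. ?Z *v (Q (ns j) (ns k) *v err j)) = (\<Sum>j = 1..k. Q (ns j) (ns (Suc k)) *v err j)"
      by (intro sum.cong refl Q_Q ns_mono) auto
    then show ?thesis by (subst Suc) (simp add: matrix_vector_right_distrib mv_sum Q_Q ns_Suc)
  qed
  finally show ?case by (simp add: Q_refl)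
qed

lemma P_expansion:
  "P (ns k) x (\<omega> (ns k)) = Q 0 (ns k) *v P 0 x (\<omega> 0) + (\<Sum>j = 1..k. Q (ns j) (ns k) *v P (ns j) x (err j))"
proof -
  have "P (ns k) x (\<omega> (ns k)) = P (ns k) x (Q 0 (ns k) *v \<omega> 0) + (\<Sum>j = 1..k. P (ns k) x (Q (ns j) (ns k) *v err j))"
    by (subst \<omega>_expansion) (simp add: linear_add[OF P_linear] linear_sum[OF P_linear])
  also have "(\<Sum>j = 1..k. P (ns k) x (Q (ns j) (ns k) *v err j)) = (\<Sum>j = 1..k. Q (ns j) (ns k) *v P (ns j) x (err j))"
    by (intro sum.cong refl P_Q ns_mono) simp
  finally show ?thesis by (simp add: P_Q)
qed

lemma stable_bound: "\<exists>C. \<forall>m. norm (P (N m) Stab (\<omega> (N m))) \<le> C"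
proof (intro exI allI)
  fix m
  have "norm (Q 0 (N m) *v P 0 Stab (\<omega> 0)) \<le> A * exp (- \<theta> * real (N m)) * norm (P 0 Stab (\<omega> 0))"
    by (rule stab[OF P_in])
  also have "\<dots> \<le> A * 1 * norm (P 0 Stab (\<omega> 0))"
    using A \<theta> by (intro mult_right_mono mult_left_mono) auto
  finally have 1: "norm (Q 0 (N m) *v P 0 Stab (\<omega> 0)) \<le> A * norm (P 0 Stab (\<omega> 0))" by simp
  have "norm (\<Sum>j = 1..ks m. Q (ns j) (N m) *v P (ns j) Stab (err j)) \<le>
      (\<Sum>k = 1..ks m. A1 * backward_term Q \<Gamma> ns (ks m) k)"
  proof (rule order_trans[OF norm_sum sum_mono])
    fix k assume k: "k \<in> {1..ks m}"
    let ?a = "mnorm_on (Q (ns k) (N m)) (\<Gamma> Stab (ns k))" and ?b = "onorm (P (ns k) Stab)"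
    let ?z = "mnorm (Q (ns (k - 1)) (ns (Suc (k - 1))))"
    have a: "0 \<le> ?a" by (rule mnorm_on_nonneg[OF \<Gamma>_nonempty])
    have "norm (Q (ns k) (N m) *v P (ns k) Stab (err k)) \<le> ?a * norm (P (ns k) Stab (err k))"
      by (rule norm_mv_le_on[OF P_in])
    also have "\<dots> \<le> ?a * (?b * (A1 * ?z))"
      using norm_split_proj_le[OF split[of "ns k"], of Stab "err k"] mult_left_mono[OF norm_err[of k] onorm_P_nonneg[of "ns k" Stab]] k a
      by (intro mult_left_mono) auto
    finally show "norm (Q (ns k) (N m) *v P (ns k) Stab (err k)) \<le> A1 * backward_term Q \<Gamma> ns (ks m) k"
      by (simp add: backward_term_def mult_ac)
  qed
  also have "\<dots> \<le> A1 * B"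
    unfolding sum_distrib_left[symmetric] by (intro mult_left_mono backward A1)
  finally show "norm (P (N m) Stab (\<omega> (N m))) \<le> A * norm (P 0 Stab (\<omega> 0)) + A1 * B"
    unfolding P_expansion by (intro order_trans[OF norm_triangle_ineq] add_mono 1)
qed

definition pulled_err :: "nat \<Rightarrow> real ^ 'd" where
  "pulled_err k = Qi 0 (ns k) *v P (ns k) Unst (err k)"

lemma pulled_err_in: "pulled_err k \<in> \<Gamma> Unst 0"
  unfolding pulled_err_def by (rule Qi_\<Gamma>[OF _ P_in]) simp

lemma Q_pulled_err:
  assumes "j \<le> k"
  shows "Q 0 (ns j) *v pulled_err k = Qi (ns j) (ns k) *v P (ns k) Unst (err k)"
proof -
  have "Q (ns j) (ns k) *v (Q 0 (ns j) *v pulled_err k) = P (ns k) Unst (err k)"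
    using ns_mono[OF assms] by (simp add: Q_Q pulled_err_def Qi_Q)
  then show ?thesis using Qi_Q(1)[OF ns_mono[OF assms]] by metis
qed

abbreviation "fterm m i \<equiv> forward_term Q \<Gamma> ns (ks m) (ks m + 1 + i)"

lemma norm_Q_pulled_err: "norm (Q 0 (N m) *v pulled_err (ks m + 1 + i)) \<le> A1 * fterm m i"
proof -
  let ?k = "ks m + 1 + i"
  let ?a = "mnorm_on (Qi (N m) (ns ?k)) (\<Gamma> Unst (ns ?k))" and ?b = "onorm (P (ns ?k) Unst)"
  let ?z = "mnorm (Q (ns (?k - 1)) (ns (Suc (?k - 1))))"
  have a: "0 \<le> ?a" by (rule mnorm_on_nonneg[OF \<Gamma>_nonempty])
  have "norm (Qi (N m) (ns ?k) *v P (ns ?k) Unst (err ?k)) \<le> ?a * norm (P (ns ?k) Unst (err ?k))"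
    by (rule norm_mv_le_on[OF P_in])
  also have "\<dots> \<le> ?a * (?b * (A1 * ?z))"
    using norm_split_proj_le[OF split[of "ns ?k"], of Unst "err ?k"] mult_left_mono[OF norm_err[of ?k] onorm_P_nonneg[of "ns ?k" Unst]] a
    by (intro mult_left_mono) auto
  finally show ?thesis using Q_pulled_err[of "ks m" ?k] by (simp add: forward_term_def mult_ac)
qed

text \<open>The forward condition with \<open>m = 0\<close> gives summability of the errors as seen
  from time \<open>N 0\<close>; one fixed matrix brings them back to time 0.\<close>

lemma summable_pulled_err: "summable (\<lambda>i. pulled_err (Suc i))"
proof -
  have "norm (pulled_err (ks 0 + 1 + i)) \<le> mnorm (Qi 0 (N 0)) * A1 * fterm 0 i" for i
  proof -
    have "norm (pulled_err (ks 0 + 1 + i)) = norm (Qi 0 (N 0) *v (Q 0 (N 0) *v pulled_err (ks 0 + 1 + i)))" by (simp add: Qi_Q)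
    also have "\<dots> \<le> mnorm (Qi 0 (N 0)) * norm (Q 0 (N 0) *v pulled_err (ks 0 + 1 + i))" by (rule norm_mv_le)
    also have "\<dots> \<le> mnorm (Qi 0 (N 0)) * (A1 * fterm 0 i)" by (rule mult_left_mono[OF norm_Q_pulled_err mnorm_nonneg])
    finally show ?thesis by (simp add: mult.assoc)
  qed
  then have "\<exists>n0. \<forall>i\<ge>n0. norm (pulled_err (ks 0 + 1 + i)) \<le> mnorm (Qi 0 (N 0)) * A1 * fterm 0 i" by blast
  then have "summable (\<lambda>i. pulled_err (ks 0 + 1 + i))"
    by (rule summable_comparison_test[OF _ summable_mult[OF forward_summable[of 0]]])
  then have "summable (\<lambda>i. pulled_err (Suc (i + ks 0)))" by (simp add: add.commute)
  then show ?thesis using summable_iff_shift[of "\<lambda>i. pulled_err (Suc i)" "ks 0"] by simp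
qed

text \<open>Pulled back to time 0, the unstable component of \<open>\<omega> (ns k)\<close> is a
  partial sum of this series. Its limit is thus the natural candidate for a vector whose orbit
  follows the log-slopes.\<close>

definition shadow :: "real ^ 'd" where
  "shadow = P 0 Unst (\<omega> 0) + (\<Sum>i. pulled_err (Suc i))"

lemma shadow_in: "shadow \<in> \<Gamma> Unst 0"
proof -
  have "(\<Sum>i. pulled_err (Suc i)) \<in> \<Gamma> Unst 0"
  proof (rule Lim_in_closed_set[OF closed_subspace[OF \<Gamma>_subspace]])
    show "(\<lambda>n. \<Sum>i<n. pulled_err (Suc i)) \<longlonglongrightarrow> (\<Sum>i. pulled_err (Suc i))" by (rule summable_LIMSEQ[OF summable_pulled_err])
    show "\<forall>\<^sub>F n in sequentially. (\<Sum>i<n. pulled_err (Suc i)) \<in> \<Gamma> Unst 0"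
      by (intro always_eventually allI subspace_sum[OF \<Gamma>_subspace] pulled_err_in)
  qed simp
  then show ?thesis unfolding shadow_def by (intro subspace_add \<Gamma>_subspace P_in)
qed

text \<open>The difference is the tail of the series carried forward to time \<open>N m\<close>. The
  forward condition based at \<open>m\<close> bounds just this tail, with a constant that does not
  depend on \<open>m\<close>.\<close>

lemma unstable_bound: "norm (P (N m) Unst (\<omega> (N m)) - Q 0 (N m) *v shadow) \<le> A1 * B"
proof -
  let ?M = "(*v) (Q 0 (N m))"
  have "P (N m) Unst (\<omega> (N m)) = ?M (P 0 Unst (\<omega> 0) + (\<Sum>j = 1..ks m. pulled_err j))"
  proof -
    have "Q (ns j) (N m) *v P (ns j) Unst (err j) = ?M (pulled_err j)" if "j \<in> {1..ks m}" for j
      using that Q_Q[of 0 "ns j" "N m" "pulled_err j"] ns_mono[of j "ks m"] by (simp add: pulled_err_def Qi_Q)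
    then show ?thesis unfolding P_expansion
      by (simp add: matrix_vector_right_distrib mv_sum)
  qed
  moreover have "(\<Sum>i. pulled_err (Suc i)) = (\<Sum>i. pulled_err (ks m + 1 + i)) + (\<Sum>j = 1..ks m. pulled_err j)"
  proof -
    have "(\<Sum>i<ks m. pulled_err (Suc i)) = (\<Sum>j = 1..ks m. pulled_err j)"
      by (simp add: lessThan_atLeast0 sum.shift_bounds_Suc_ivl[symmetric] atLeastLessThanSuc_atLeastAtMost)
    then show ?thesis using suminf_split_initial_segment[OF summable_pulled_err, of "ks m"] by (simp add: add.commute)
  qed
  ultimately have "P (N m) Unst (\<omega> (N m)) - ?M shadow = - ?M (\<Sum>i. pulled_err (ks m + 1 + i))"
    by (simp add: shadow_def matrix_vector_right_distrib)
  also have "norm \<dots> \<le> A1 * B"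
  proof -
    have s: "summable (\<lambda>i. pulled_err (ks m + 1 + i))"
      using summable_iff_shift[of "\<lambda>i. pulled_err (Suc i)" "ks m"] summable_pulled_err by (simp add: add.commute)
    have "\<exists>n0. \<forall>i\<ge>n0. norm (norm (?M (pulled_err (ks m + 1 + i)))) \<le> A1 * fterm m i"
      using norm_Q_pulled_err[of m] unfolding real_norm_def abs_norm_cancel by blast
    then have n: "summable (\<lambda>i. norm (?M (pulled_err (ks m + 1 + i))))"
      by (rule summable_comparison_test[OF _ summable_mult[OF forward_summable[of m]]])
    have "norm (?M (\<Sum>i. pulled_err (ks m + 1 + i))) = norm (\<Sum>i. ?M (pulled_err (ks m + 1 + i)))"
      by (simp only: bounded_linear.suminf[OF bounded_linear_mv s])
    also have "\<dots> \<le> (\<Sum>i. norm (?M (pulled_err (ks m + 1 + i))))" by (rule summable_norm[OF n])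
    also have "\<dots> \<le> (\<Sum>i. A1 * fterm m i)"
      by (rule suminf_le[OF norm_Q_pulled_err n summable_mult[OF forward_summable]])
    also have "\<dots> \<le> A1 * B"
      unfolding suminf_mult[OF forward_summable] by (intro mult_left_mono forward A1)
    finally show ?thesis by simp
  qed
  finally show ?thesis .
qed

end

section \<open>The central component and its detection\<close>

context regular_cocycle
begin

lemma dual_norm_0: "h \<in> K \<Longrightarrow> norm h \<le> A * norm (dual h n)" "h \<in> K \<Longrightarrow> norm (dual h n) \<le> A * norm h"
  using dual_norm[of h 0 n] dual_norm[of h n 0] by (simp_all add: dual_0)

text \<open>The pairing is constant in time, while the dual orbit stays bounded and the stable
  vector decays.\<close>

lemma K_stab: "h \<in> K \<Longrightarrow> v \<in> \<Gamma> Stab 0 \<Longrightarrow> h \<bullet> v = 0"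
proof (rule eq_0_if_le_decay[OF exp_decay[OF \<theta>]])
  assume h: "h \<in> K" and v: "v \<in> \<Gamma> Stab 0"
  have "\<bar>h \<bullet> v\<bar> \<le> (A * norm h * A * norm v) * exp (- \<theta> * real n)" for n
  proof -
    have "\<bar>h \<bullet> v\<bar> \<le> norm (dual h n) * norm (Q 0 n *v v)"
      unfolding dual_inner[OF h, of n v, symmetric] by (rule Cauchy_Schwarz_ineq2)
    also have "\<dots> \<le> (A * norm h) * (A * exp (- \<theta> * real n) * norm v)"
      using A by (intro mult_mono dual_norm_0 h stab v) auto
    finally show ?thesis by (simp add: mult_ac)
  qed
  then show "\<forall>\<^sub>F n in sequentially. \<bar>h \<bullet> v\<bar> \<le> (A * norm h * A * norm v) * exp (- \<theta> * real n)"
    by simp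
qed

lemma dual_eq_0:
  assumes "h \<in> K" "\<forall>v\<in>\<Gamma> x 0. h \<bullet> v = 0" "z \<in> \<Gamma> x n"
  shows "dual h n \<bullet> z = 0"
proof -
  have "z = Q 0 n *v (Qi 0 n *v z)" by (simp add: Qi_Q)
  then have "dual h n \<bullet> z = h \<bullet> (Qi 0 n *v z)" using dual_inner[OF assms(1), of n "Qi 0 n *v z"] by simp
  then show ?thesis using assms(2) Qi_\<Gamma>[OF _ assms(3), of 0] by simp
qed

text \<open>Unstable vectors shrink when pulled back to time \<open>0\<close>, whereas elements of \<open>K\<close> keep
  their size: at late times they almost vanish on the unstable space.\<close>

lemma dual_unst:
  assumes h: "h \<in> K" and z: "z \<in> \<Gamma> Unst n"
  shows "\<bar>dual h n \<bullet> z\<bar> \<le> A\<^sup>2 * exp (- \<theta> * real n) * norm (dual h n) * norm z"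
proof -
  have "dual h n \<bullet> z = h \<bullet> (Qi 0 n *v z)" using dual_inner[OF h, of n "Qi 0 n *v z"] by (simp add: Qi_Q)
  then have "\<bar>dual h n \<bullet> z\<bar> \<le> norm h * norm (Qi 0 n *v z)" by (simp add: Cauchy_Schwarz_ineq2)
  also have "\<dots> \<le> (A * norm (dual h n)) * (A * exp (- \<theta> * real n) * norm z)"
    using A by (intro mult_mono dual_norm_0 h unst z) auto
  finally show ?thesis by (simp add: power2_eq_square mult_ac)
qed

lemma late_times: "\<exists>M\<ge>1. \<forall>m\<ge>M. c * exp (- \<theta> * real (N m)) \<le> 1 / 2"
proof -
  have "(\<lambda>m. c * exp (- \<theta> * real (N m))) \<longlonglongrightarrow> 0"
    using tendsto_mult_right_zero[OF N_decay] .
  then have "\<forall>\<^sub>F m in sequentially. c * exp (- \<theta> * real (N m)) < 1 / 2"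
    by (rule order_tendstoD) simp
  then obtain M where "\<forall>m\<ge>M. c * exp (- \<theta> * real (N m)) < 1 / 2"
    by (auto simp: eventually_sequentially)
  then show ?thesis by (intro exI[of _ "Suc M"]) (auto intro: less_imp_le)
qed

text \<open>At a late time the dual vector annihilates the stable and the central space and is small
  on the unstable one compared with its own norm. Pairing it with itself gives at most half of its
  squared norm, so it vanishes.\<close>

lemma K_cent_inj:
  assumes h: "h \<in> K" and c: "\<forall>v\<in>\<Gamma> Cent 0. h \<bullet> v = 0"
  shows "h = 0"
proof -
  obtain C where C: "C \<ge> 0" "\<And>m x v. 1 \<le> m \<Longrightarrow> norm (P (N m) x v) \<le> C * norm v"
    using P_bound by blast
  obtain m where m: "1 \<le> m" "A\<^sup>2 * C * exp (- \<theta> * real (N m)) \<le> 1 / 2"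
    using late_times[of "A\<^sup>2 * C"] by blast
  let ?e = "A\<^sup>2 * exp (- \<theta> * real (N m))" and ?d = "dual h (N m)"
  have "?d \<bullet> ?d = ?d \<bullet> P (N m) Stab ?d + ?d \<bullet> P (N m) Cent ?d + ?d \<bullet> P (N m) Unst ?d"
    by (subst (2) P_sum[of ?d "N m"]) (simp add: inner_add_right)
  also have "\<dots> = ?d \<bullet> P (N m) Unst ?d"
    using dual_eq_0[OF h c P_in, of "N m"] dual_eq_0[OF h _ P_in, of Stab "N m"] K_stab[OF h] by simp
  also have "\<dots> \<le> ?e * norm ?d * norm (P (N m) Unst ?d)"
    using dual_unst[OF h P_in, of "N m" ?d] by linarith
  also have "\<dots> \<le> ?e * norm ?d * (C * norm ?d)"
    using C(2)[OF m(1)] by (intro mult_left_mono) auto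
  also have "\<dots> = (A\<^sup>2 * C * exp (- \<theta> * real (N m))) * (norm ?d)\<^sup>2" by (simp add: power2_eq_square mult_ac)
  also have "\<dots> \<le> 1 / 2 * (norm ?d)\<^sup>2" using m(2) by (intro mult_right_mono) auto
  finally have "(norm ?d)\<^sup>2 \<le> 1 / 2 * (norm ?d)\<^sup>2" by (simp add: power2_norm_eq_inner)
  then have "norm ?d = 0" by simp
  then show ?thesis using dual_norm_0(1)[OF h, of "N m"] by simp
qed

text \<open>By injectivity \<open>K\<close> meets the annihilator \<open>Gp\<close> of the central
  space only in 0. By \<open>dim_K\<close> the two dimensions add up to at least that of the whole
  space, so every functional on the central space is the restriction of an element of
  \<open>K\<close>.\<close>

lemma K_cent_surj: "\<exists>h\<in>K. \<forall>v\<in>\<Gamma> Cent 0. h \<bullet> v = z \<bullet> v"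
proof -
  let ?G = "\<Gamma> Cent 0"
  define Gp where "Gp = {y \<in> UNIV. \<forall>x\<in>?G. orthogonal x y}"
  have Gp: "subspace Gp" unfolding Gp_def subspace_def by (auto simp: orthogonal_def inner_add_right)
  have 1: "dim Gp + dim ?G = CARD('d)"
    using dim_subspace_orthogonal_to_vectors[OF \<Gamma>_subspace[of Cent 0] subspace_UNIV] by (simp add: Gp_def)
  have "K \<inter> Gp = {0}"
  proof (intro equalityI subsetI)
    fix h assume "h \<in> K \<inter> Gp"
    then show "h \<in> {0}" using K_cent_inj[of h] by (auto simp: Gp_def orthogonal_def inner_commute)
  qed (use subspace_0[OF K] subspace_0[OF Gp] in auto)
  then have "dim {x + y |x y. x \<in> K \<and> y \<in> Gp} = dim K + dim Gp"
    using dim_sums_Int[OF K Gp] by simp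
  also have "\<dots> \<ge> CARD('d)" using 1 dim_K splitting_dim[OF split[of 0]] by linarith
  finally have "dim {x + y |x y. x \<in> K \<and> y \<in> Gp} = dim (UNIV :: (real ^ 'd) set)"
    using dim_subset_UNIV_cart[of "{x + y |x y. x \<in> K \<and> y \<in> Gp}"] by simp
  then have "{x + y |x y. x \<in> K \<and> y \<in> Gp} = UNIV"
    by (intro subspace_dim_equal subspace_sums K Gp) auto
  then obtain h y where hy: "h \<in> K" "y \<in> Gp" "z = h + y" by blast
  then have "\<forall>v\<in>?G. h \<bullet> v = z \<bullet> v"
    by (auto simp: Gp_def orthogonal_def inner_add_left inner_commute[of y])
  then show ?thesis using hy(1) by blast
qed

text \<open>The central component is detected by \<open>K\<close>: some element of \<open>K\<close>, carried to time \<open>N m\<close>,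
  is close to the functional measuring the central component of \<open>w\<close>.\<close>

lemma central_detection:
  "\<exists>C\<ge>0. \<exists>M\<ge>1. \<forall>m\<ge>M. \<forall>w. \<exists>h\<in>K. norm (dual h (N m)) \<le> C \<and>
     norm (P (N m) Cent w) \<le> \<bar>dual h (N m) \<bullet> w\<bar> + C * norm (P (N m) Unst w)"
proof -
  obtain C where C: "C \<ge> 0" "\<And>m x v. 1 \<le> m \<Longrightarrow> norm (P (N m) x v) \<le> C * norm v"
    using P_bound by blast
  obtain M where M: "1 \<le> M" "\<And>m. M \<le> m \<Longrightarrow> A\<^sup>2 * C * exp (- \<theta> * real (N m)) \<le> 1 / 2"
    using late_times[of "A\<^sup>2 * C"] by blast
  have "\<exists>h\<in>K. norm (dual h (N m)) \<le> 2 * C \<and>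
     norm (P (N m) Cent w) \<le> \<bar>dual h (N m) \<bullet> w\<bar> + 2 * C * norm (P (N m) Unst w)"
    if m: "M \<le> m" for m w
  proof (cases "P (N m) Cent w = 0")
    case True
    have "dual 0 (N m) = 0" using dual_norm_0(2)[OF subspace_0[OF K], of "N m"] by simp
    then show ?thesis using True C(1) subspace_0[OF K] by (intro bexI[of _ 0]) auto
  next
    case False
    let ?n = "N m" and ?c = "P (N m) Cent w"
    have m1: "1 \<le> m" using M(1) m by simp
    define b where "b = ?c /\<^sub>R norm ?c"
    have nb: "norm b = 1" using False by (simp add: b_def)
    \<comment> \<open>\<open>g\<close> represents the functional that measures the central component
      in the direction \<open>b\<close> of that of \<open>w\<close>; the bound for the projections
      bounds its norm.\<close>
    define g where "g = adjoint (P ?n Cent) b"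
    have g: "g \<bullet> x = b \<bullet> P ?n Cent x" for x
      using adjoint_works[OF P_linear, of x ?n Cent b] by (simp add: g_def inner_commute)
    have PP: "P ?n Cent (P ?n Cent x) = P ?n Cent x" "P ?n Cent (P ?n Unst x) = 0" for x
      using split_proj_same[OF split P_in] by simp_all
    have "norm g * norm g = b \<bullet> P ?n Cent g" using g[of g] by (simp add: power2_norm_eq_inner[symmetric] power2_eq_square)
    also have "\<dots> \<le> norm b * norm (P ?n Cent g)" by (rule norm_cauchy_schwarz)
    also have "\<dots> \<le> C * norm g" using nb C(2)[OF m1] by simp
    finally have ng: "norm g \<le> C" using C(1) by (cases "g = 0") auto
    \<comment> \<open>The row vector \<open>g v* Q 0 ?n\<close> is the functional \<open>g\<close>
      pulled back to time 0, where \<open>K\<close> is known to realize it on the central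
      space.\<close>
    obtain h where h: "h \<in> K" "\<forall>v\<in>\<Gamma> Cent 0. h \<bullet> v = (g v* Q 0 ?n) \<bullet> v"
      using K_cent_surj by blast
    let ?d = "dual h ?n"
    have dc: "?d \<bullet> z = g \<bullet> z" if "z \<in> \<Gamma> Cent ?n" for z
    proof -
      have "?d \<bullet> z = h \<bullet> (Qi 0 ?n *v z)" using dual_inner[OF h(1), of ?n "Qi 0 ?n *v z"] by (simp add: Qi_Q)
      also have "\<dots> = g \<bullet> (Q 0 ?n *v (Qi 0 ?n *v z))"
        using h(2) Qi_\<Gamma>[OF _ that, of 0] by (simp add: dot_lmul_matrix)
      finally show ?thesis by (simp add: Qi_Q)
    qed
    have ds: "?d \<bullet> P ?n Stab x = 0" for x
      by (rule dual_eq_0[OF h(1) _ P_in]) (simp add: K_stab[OF h(1)])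
    have dx: "?d \<bullet> x = g \<bullet> x + ?d \<bullet> P ?n Unst x" for x
    proof -
      have "?d \<bullet> x = ?d \<bullet> P ?n Stab x + ?d \<bullet> P ?n Cent x + ?d \<bullet> P ?n Unst x"
        by (subst P_sum[of x ?n]) (simp add: inner_add_right)
      moreover have "?d \<bullet> P ?n Cent x = g \<bullet> x" unfolding dc[OF P_in] g PP ..
      ultimately show ?thesis using ds by simp
    qed
    \<comment> \<open>\<open>?d\<close> and \<open>g\<close> differ only by the values of
      \<open>?d\<close> on the unstable space. So \<open>?f\<close> is at most half as long as
      \<open>?d\<close>, and \<open>?d\<close> at most twice as long as \<open>g\<close>.\<close>
    let ?f = "?d - g"
    have "norm ?f * norm ?f = ?f \<bullet> ?f" by (simp add: power2_norm_eq_inner[symmetric] power2_eq_square)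
    also have "\<dots> = ?d \<bullet> P ?n Unst ?f"
      unfolding inner_diff_left[of ?d g ?f] using dx[of ?f] by linarith
    also have "\<dots> \<le> A\<^sup>2 * exp (- \<theta> * real ?n) * norm ?d * norm (P ?n Unst ?f)"
      using dual_unst[OF h(1) P_in, of ?n ?f] by linarith
    also have "\<dots> \<le> A\<^sup>2 * exp (- \<theta> * real ?n) * norm ?d * (C * norm ?f)"
      using C(2)[OF m1] by (intro mult_left_mono) auto
    also have "\<dots> = (A\<^sup>2 * C * exp (- \<theta> * real ?n)) * (norm ?d * norm ?f)" by (simp add: mult_ac)
    also have "\<dots> \<le> 1 / 2 * (norm ?d * norm ?f)" using M(2)[OF m] by (intro mult_right_mono) auto
    finally have "norm ?f \<le> 1 / 2 * norm ?d" by (cases "?f = 0") auto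
    moreover have "norm ?d \<le> norm ?f + norm g" using norm_triangle_sub[of ?d g] by simp
    ultimately have nd: "norm ?d \<le> 2 * C" using ng by linarith
    have "norm ?c = g \<bullet> w"
      unfolding g b_def using False by (simp add: power2_norm_eq_inner[symmetric] power2_eq_square)
    also have "\<dots> = ?d \<bullet> w - ?d \<bullet> P ?n Unst w" using dx[of w] by simp
    also have "\<dots> \<le> \<bar>?d \<bullet> w\<bar> + norm ?d * norm (P ?n Unst w)"
      using Cauchy_Schwarz_ineq2[of ?d "P ?n Unst w"] by linarith
    also have "\<dots> \<le> \<bar>?d \<bullet> w\<bar> + 2 * C * norm (P ?n Unst w)"
      using mult_right_mono[OF nd, of "norm (P ?n Unst w)"] by simp
    finally show ?thesis using h(1) nd by blast
  qed
  then show ?thesis using M(1) C(1) by (intro exI[of _ "2 * C"] conjI exI[of _ M]) auto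
qed

section \<open>The deviation from the shadow and the two alternatives\<close>

definition deviation :: "nat \<Rightarrow> real ^ 'd" where "deviation n = \<omega> n - Q 0 n *v shadow"

lemma deviation_bounded: "\<exists>W\<ge>0. \<forall>m. norm (deviation (N m)) \<le> W"
proof -
  obtain S where S: "\<And>m. norm (P (N m) Stab (\<omega> (N m))) \<le> S" using stable_bound by blast
  obtain C M where C: "C \<ge> 0" "\<And>m x. M \<le> m \<Longrightarrow> \<exists>h\<in>K. norm (dual h (N m)) \<le> C \<and>
     norm (P (N m) Cent x) \<le> \<bar>dual h (N m) \<bullet> x\<bar> + C * norm (P (N m) Unst x)"
    using central_detection by blast
  \<comment> \<open>The stable bound; the central bound, consisting of the pairing with the
    detecting functional and of the unstable part that this functional also sees; and the unstable
    bound.\<close>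
  define W where "W = S + ((A * C + A * C * norm shadow) + C * (A1 * B)) + A1 * B"
  have W: "norm (deviation (N m)) \<le> W" if mM: "M \<le> m" for m
  proof -
    let ?n = "N m"
    have sh: "Q 0 ?n *v shadow \<in> \<Gamma> Unst ?n" by (rule Q_\<Gamma>[OF _ shadow_in]) simp
    have Pw: "P ?n x (deviation ?n) = P ?n x (\<omega> ?n) - (if x = Unst then Q 0 ?n *v shadow else 0)" for x
      unfolding deviation_def linear_diff[OF P_linear] split_proj_same[OF split sh] ..
    obtain h where h: "h \<in> K" "norm (dual h ?n) \<le> C"
      "norm (P ?n Cent (deviation ?n)) \<le> \<bar>dual h ?n \<bullet> deviation ?n\<bar> + C * norm (P ?n Unst (deviation ?n))"
      using C(2)[OF mM, of "deviation ?n"] by blast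
    \<comment> \<open>The pairing with the orbit of \<open>shadow\<close> is constant in time, so
      subtracting this growing orbit does no damage.\<close>
    have "\<bar>dual h ?n \<bullet> deviation ?n\<bar> \<le> \<bar>dual h ?n \<bullet> \<omega> ?n\<bar> + \<bar>h \<bullet> shadow\<bar>"
      unfolding deviation_def inner_diff_right dual_inner[OF h(1)] by linarith
    also have "\<dots> \<le> A * C + A * C * norm shadow"
    proof (rule add_mono)
      show "\<bar>dual h ?n \<bullet> \<omega> ?n\<bar> \<le> A * C"
        using dual_\<omega>[OF h(1), of ?n] mult_left_mono[OF h(2) A] by linarith
      have "\<bar>h \<bullet> shadow\<bar> \<le> norm h * norm shadow" by (rule Cauchy_Schwarz_ineq2)
      also have "\<dots> \<le> (A * C) * norm shadow"
        using dual_norm_0(1)[OF h(1), of ?n] mult_left_mono[OF h(2) A] by (intro mult_right_mono) auto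
      finally show "\<bar>h \<bullet> shadow\<bar> \<le> A * C * norm shadow" .
    qed
    finally have d: "\<bar>dual h ?n \<bullet> deviation ?n\<bar> \<le> A * C + A * C * norm shadow" .
    have u: "norm (P ?n Unst (deviation ?n)) \<le> A1 * B" using unstable_bound[of m] by (simp add: Pw)
    have c: "norm (P ?n Cent (deviation ?n)) \<le> (A * C + A * C * norm shadow) + C * (A1 * B)"
      using h(3) d mult_left_mono[OF u C(1)] by linarith
    have s: "norm (P ?n Stab (deviation ?n)) \<le> S" using S[of m] by (simp add: Pw)
    have "norm (deviation ?n) \<le> norm (P ?n Stab (deviation ?n)) + norm (P ?n Cent (deviation ?n)) + norm (P ?n Unst (deviation ?n))"
      by (subst P_sum[of "deviation ?n" ?n]) (intro order_trans[OF norm_triangle_ineq] add_mono norm_triangle_ineq order_refl)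
    then show ?thesis unfolding W_def using s c u by linarith
  qed
  have W0: "0 \<le> W" by (rule order_trans[OF norm_ge_zero W[OF order_refl]])
  \<comment> \<open>Detection works from time \<open>M\<close> on; the finitely many earlier
    deviations are simply added to the bound.\<close>
  have "norm (deviation (N m)) \<le> W + (\<Sum>k<M. norm (deviation (N k)))" for m
  proof (cases "M \<le> m")
    case True
    then show ?thesis using W[of m] sum_nonneg[of "{..<M}" "\<lambda>k. norm (deviation (N k))"] by simp
  next
    case False
    then have "norm (deviation (N m)) \<le> (\<Sum>k<M. norm (deviation (N k)))" by (intro member_le_sum) auto
    then show ?thesis using W0 by simp
  qed
  moreover have "0 \<le> W + (\<Sum>k<M. norm (deviation (N k)))" by (intro add_nonneg_nonneg W0 sum_nonneg norm_ge_zero)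
  ultimately show ?thesis by blast
qed

lemma unst_growth:
  assumes "v \<in> \<Gamma> Unst 0"
  shows "norm v \<le> A * exp (- \<theta> * real n) * norm (Q 0 n *v v)"
  using unst[OF Q_\<Gamma>[OF _ assms], of n] by (simp add: Qi_Q)

text \<open>After a time \<open>N m\<close> with bounded deviation, both this deviation and the
  accumulated error are multiplied by at most a multiple of the norm of the next matrix, which [S]
  makes subexponential. The rate \<open>\<theta> / 2\<close> stays below the growth rate of unstable
  vectors, and the shift by 1 comes from \<open>m \<le> Suc n\<close>.\<close>

lemma deviation_subexp: "\<exists>C\<ge>0. \<forall>\<^sub>F n in sequentially. norm (deviation n) \<le> C * exp (\<theta> / 2 * (real n + 1))"
proof -
  obtain W where W: "W \<ge> 0" "\<And>m. norm (deviation (N m)) \<le> W" using deviation_bounded by blast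
  have "\<forall>\<^sub>F m in sequentially. 1 / real m * ln (mnorm (Q (N m) (N (Suc m)))) < \<theta> / 2"
    using subexp \<theta> by (intro order_tendstoD) auto
  then obtain M where M: "\<And>m. M \<le> m \<Longrightarrow> 1 / real m * ln (mnorm (Q (N m) (N (Suc m)))) < \<theta> / 2"
    by (auto simp: eventually_sequentially)
  \<comment> \<open>Starting at \<open>Suc M\<close> keeps \<open>m\<close> positive, so the
    denominator can be cleared.\<close>
  have Qm: "mnorm (Q (N m) (N (Suc m))) \<le> exp (\<theta> / 2 * real m)" if "Suc M \<le> m" for m
  proof -
    have "ln (mnorm (Q (N m) (N (Suc m)))) < \<theta> / 2 * real m"
      using M[of m] that by (simp add: field_simps)
    then have "exp (ln (mnorm (Q (N m) (N (Suc m))))) \<le> exp (\<theta> / 2 * real m)" by simp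
    moreover have "0 < mnorm (Q (N m) (N (Suc m)))"
      using mnorm_Q_ge_1[OF N_mono[of m "Suc m"]] by simp
    ultimately show ?thesis by (simp only: exp_ln)
  qed
  define C where "C = (A1 + W) * CARD('d) ^ 2"
  have "norm (deviation n) \<le> C * exp (\<theta> / 2 * (real n + 1))" if n: "N (Suc M) \<le> n" for n
  proof -
    have "\<exists>k. n < N k" using N_ge[of "n + 2"] by (intro exI[of _ "n + 2"]) simp
    \<comment> \<open>The first \<open>N k\<close> beyond \<open>n\<close>; its predecessor gives
      the bracket \<open>N m \<le> n < N (Suc m)\<close>.\<close>
    define k where "k = (LEAST k. n < N k)"
    have k: "n < N k" unfolding k_def by (rule LeastI_ex) fact
    have "k \<noteq> 0" using k n N_mono[of 0 "Suc M"] by (cases k) auto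
    then obtain m where m: "k = Suc m" by (cases k) auto
    have Nm: "N m \<le> n" using not_less_Least[of m "\<lambda>k. n < N k"] m unfolding k_def by simp
    have "Suc M \<le> m"
    proof (rule ccontr)
      assume "\<not> Suc M \<le> m"
      then have "N (Suc m) \<le> N (Suc M)" by (intro N_mono) simp
      then show False using k m n by simp
    qed
    have "deviation n = (\<omega> n - Q (N m) n *v \<omega> (N m)) + Q (N m) n *v deviation (N m)"
      by (simp add: deviation_def matrix_vector_mult_diff_distrib Q_Q[OF _ Nm])
    then have "norm (deviation n) \<le> norm (\<omega> n - Q (N m) n *v \<omega> (N m)) + norm (Q (N m) n *v deviation (N m))"
      by (simp only: norm_triangle_ineq)
    also have "\<dots> \<le> A1 * mnorm (Q (N m) n) + mnorm (Q (N m) n) * W"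
      by (intro add_mono \<omega>_err_norm Nm order_trans[OF norm_mv_le] mult_left_mono W(2) mnorm_nonneg)
    also have "\<dots> = (A1 + W) * mnorm (Q (N m) n)" by (simp add: algebra_simps)
    also have "\<dots> \<le> (A1 + W) * (CARD('d) ^ 2 * mnorm (Q (N m) (N (Suc m))))"
      using A1 W(1) k m by (intro mult_left_mono mnorm_Q_mono Nm) auto
    also have "\<dots> = C * mnorm (Q (N m) (N (Suc m)))" by (simp add: C_def mult.assoc)
    also have "\<dots> \<le> C * exp (\<theta> / 2 * (real n + 1))"
    proof (rule mult_left_mono)
      have "m \<le> Suc n" using N_ge[of m] Nm by simp
      then have "exp (\<theta> / 2 * real m) \<le> exp (\<theta> / 2 * (real n + 1))" using \<theta> by simp
      then show "mnorm (Q (N m) (N (Suc m))) \<le> exp (\<theta> / 2 * (real n + 1))"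
        using Qm[OF \<open>Suc M \<le> m\<close>] by linarith
    qed (use A1 W in \<open>simp add: C_def\<close>)
    finally show ?thesis .
  qed
  then show ?thesis
    using A1 W(1) by (intro exI[of _ C]) (auto simp: C_def eventually_sequentially)
qed

theorem dichotomy:
  "(\<exists>V>0. \<forall>m. norm (\<omega> (N m)) \<le> V) \<or>
   (\<exists>v\<in>\<Gamma> Unst 0. v \<noteq> 0 \<and> (\<lambda>n. norm (\<omega> n - Q 0 n *v v) / norm (Q 0 n *v v)) \<longlonglongrightarrow> 0)"
proof (cases "shadow = 0")
  case True
  obtain W where W: "W \<ge> 0" "\<And>m. norm (deviation (N m)) \<le> W" using deviation_bounded by blast
  then have "\<forall>m. norm (\<omega> (N m)) \<le> W + 1" unfolding deviation_def True by (simp add: add_increasing2)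
  then show ?thesis using W(1) by (intro disjI1 exI[of _ "W + 1"]) auto
next
  case False
  obtain C where C: "C \<ge> 0" "\<forall>\<^sub>F n in sequentially. norm (deviation n) \<le> C * exp (\<theta> / 2 * (real n + 1))"
    using deviation_subexp by blast
  let ?v = "\<lambda>n. norm (Q 0 n *v shadow)"
  \<comment> \<open>The deviation grows at most at rate \<open>\<theta> / 2\<close>, while the orbit
    of \<open>shadow\<close> has norm at least a multiple of \<open>exp (\<theta> * real n)\<close>;
    \<open>D\<close> collects the constants of the quotient.\<close>
  define D where "D = C * exp (\<theta> / 2) * A / norm shadow"
  have pos: "0 < ?v n" for n
    using unst_growth[OF shadow_in, of n] False by (cases "?v n = 0") auto
  have bound: "norm (deviation n) / ?v n \<le> D * exp (- (\<theta> / 2) * real n)"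
    if "norm (deviation n) \<le> C * exp (\<theta> / 2 * (real n + 1))" for n
  proof -
    have "norm (deviation n) * norm shadow \<le> (C * exp (\<theta> / 2 * (real n + 1))) * (A * exp (- \<theta> * real n) * ?v n)"
      using C(1) by (intro mult_mono that unst_growth shadow_in) auto
    also have "\<dots> = (C * exp (\<theta> / 2) * A) * exp (- (\<theta> / 2) * real n) * ?v n"
    proof -
      have "exp (\<theta> / 2 * (real n + 1)) * exp (- \<theta> * real n) = exp (\<theta> / 2) * exp (- (\<theta> / 2) * real n)"
        unfolding exp_add[symmetric] by (rule arg_cong[of _ _ exp]) (simp add: field_simps)
      then show ?thesis by (simp add: mult_ac)
    qed
    finally show ?thesis using pos[of n] False by (simp add: D_def field_simps)
  qed
  have "(\<lambda>n. norm (deviation n) / ?v n) \<longlonglongrightarrow> 0"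
  proof (rule tendsto_sandwich[of "\<lambda>_. 0"])
    show "\<forall>\<^sub>F n in sequentially. norm (deviation n) / ?v n \<le> D * exp (- (\<theta> / 2) * real n)"
      using C(2) by eventually_elim (rule bound)
    show "(\<lambda>n. D * exp (- (\<theta> / 2) * real n)) \<longlonglongrightarrow> 0"
      by (rule tendsto_mult_right_zero[OF exp_decay]) (use \<theta> in simp)
  qed auto
  then show ?thesis using shadow_in False unfolding deviation_def by blast
qed

text \<open>A relative error below one half at late times would bound the orbit of \<open>v\<close>
  by \<open>2 * V\<close> along \<open>N m\<close>, contradicting the exponential growth of unstable
  vectors.\<close>

theorem exclusion:
  assumes V: "\<forall>m. norm (\<omega> (N m)) \<le> V" and v: "v \<in> \<Gamma> Unst 0" "v \<noteq> 0"
    and lim: "(\<lambda>n. norm (\<omega> n - Q 0 n *v v) / norm (Q 0 n *v v)) \<longlonglongrightarrow> 0"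
  shows False
proof -
  let ?v = "\<lambda>n. Q 0 n *v v"
  have "\<forall>\<^sub>F n in sequentially. norm (\<omega> n - ?v n) / norm (?v n) < 1 / 2"
    using lim by (rule order_tendstoD) simp
  then have "\<forall>\<^sub>F m in sequentially. norm (\<omega> (N m) - ?v (N m)) / norm (?v (N m)) < 1 / 2"
    using N_at_top by (rule eventually_compose_filterlim)
  then have "\<forall>\<^sub>F m in sequentially. \<bar>norm v\<bar> \<le> (A * 2 * V) * exp (- \<theta> * real (N m))"
  proof eventually_elim
    case (elim m)
    have "0 < norm (?v (N m))" using unst_growth[OF v(1), of "N m"] v(2) by (cases "?v (N m) = 0") auto
    then have "norm (\<omega> (N m) - ?v (N m)) \<le> 1 / 2 * norm (?v (N m))" using elim by (simp add: divide_less_eq)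
    moreover have "norm (?v (N m)) \<le> norm (\<omega> (N m)) + norm (\<omega> (N m) - ?v (N m))"
      using norm_triangle_sub[of "?v (N m)" "\<omega> (N m)"] by (simp add: norm_minus_commute)
    ultimately have "norm (?v (N m)) \<le> 2 * V" using V[rule_format, of m] by linarith
    then have "A * exp (- \<theta> * real (N m)) * norm (?v (N m)) \<le> A * exp (- \<theta> * real (N m)) * (2 * V)"
      using A by (intro mult_left_mono) auto
    then show ?case using unst_growth[OF v(1), of "N m"] by (simp add: mult_ac)
  qed
  then have "norm v = 0" by (rule eq_0_if_le_decay[OF N_decay])
  then show False using v(2) by simp
qed

end

section \<open>The dichotomy\<close>

lemma invertible_elem_matrix:
  fixes w l :: "'d::finite"
  assumes "w \<noteq> l"
  shows "invertible (elem_matrix w l)"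
proof -
  have "v = 0" if "elem_matrix w l *v v = 0" for v
  proof -
    have e: "v $ i + (if i = l then v $ w else 0) = 0" for i
      using that elem_matrix_vec[OF assms, of v i] by simp
    have "v $ w = 0" using e[of w] assms by simp
    then have "v $ i = 0" for i using e[of i] by (cases "i = l") auto
    then show ?thesis by (simp add: vec_eq_iff)
  qed
  then have "inj ((*v) (elem_matrix w l))"
    using linear_injective_0[OF matrix_vector_mul_linear] by blast
  then show ?thesis
    by (simp add: invertible_left_inverse matrix_left_invertible_injective)
qed

lemma (in rauzy_orbit) invertible_rv_matrix: "invertible (rv_matrix \<gamma> m k)"
proof (induction k)
  case 0
  show ?case by (simp add: invertible_def)
next
  case (Suc k)
  then show ?case
    by (simp add: rotation_winner invertible_mult invertible_elem_matrix winner_neq_loser)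
qed

text \<open>The first good return time may itself be 0, so growth starts one index late; hence the
  successor in the second estimate.\<close>

lemma good_return_times_ge:
  assumes "good_return_times T ns" "ns 0 = 0"
  shows "ns k \<le> ns (Suc k)" "k \<le> Suc (ns k)"
proof -
  obtain p where p: "p \<ge> 1" "\<And>k. k \<ge> 1 \<Longrightarrow> ns (Suc k) \<ge> ns k + 2 * p"
    using assms(1) unfolding good_return_times_def by blast
  show "ns k \<le> ns (Suc k)" using p(2)[of k] assms(2) by (cases k) auto
  show "k \<le> Suc (ns k)"
  proof (induction k)
    case (Suc k)
    then show ?case using p(1) p(2)[of k] by (cases k) auto
  qed simp
qed

theorem theoremC:
  fixes T :: "'d::finite giet"
    and \<Gamma> :: "osel \<Rightarrow> nat \<Rightarrow> (real ^ 'd) set"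
    and ns ks :: "nat \<Rightarrow> nat"
    and \<omega> :: "nat \<Rightarrow> real ^ 'd"
  defines "\<omega> \<equiv> (\<lambda>n. shape_log_slope ((zorich ^^ n) T))"
  assumes "CARD('d) \<ge> 2"
    and "T \<in> giet_space 3"
    and "giet_rdc_data T \<Gamma> ns ks"
  defines "recurrence \<equiv> (\<exists>V>0. \<forall>m. norm (\<omega> (ns (ks m))) \<le> V)"
    and "shadowing \<equiv> (\<exists>v\<in>\<Gamma> Unst 0. v \<noteq> 0 \<and>
           (\<lambda>n. norm (\<omega> n - Q T 0 n *v v) / norm (Q T 0 n *v v)) \<longlonglongrightarrow> 0)"
  shows "(recurrence \<or> shadowing) \<and> \<not> (recurrence \<and> shadowing)"
proof -
  obtain S where S: "standard_iet S" "inf_renormalizable S" "rotation_number S = rotation_number T"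
      "rdc_data S \<Gamma> ns ks" and T: "inf_renormalizable T"
    using assms(4) unfolding giet_rdc_data_def rotation_rdc_data_def by blast
  obtain r where "S \<in> giet_space r" using S(1) by (auto simp: standard_iet_def)
  then obtain s' where s': "rauzy_orbit S s'" using giet_rauzy_orbit S(2) assms(2) by blast
  obtain s V where sV: "controlled_orbit T s V"
    using giet_controlled_orbit[OF assms(3) T assms(2)] by auto
  interpret T: controlled_orbit T s V by fact
  \<comment> \<open>From here on the data of the standard exchange are read as data for
    \<open>T\<close>: the rotation numbers agree, hence so do the matrices between ordered
    times.\<close>
  have QS: "Q S m n = Q T m n" if "m \<le> n" for m n
    by (rule Q_eq_if_same_rotation[OF T.rauzy_orbit_axioms s' S(3) that])
  have Q_rv: "Q S m n = rv_matrix T.\<gamma> (T.ztime m) (T.ztime n - T.ztime m)" if "m \<le> n" for m n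
    unfolding QS[OF that] by (rule T.Q_eq[OF that])
  have z0: "T.ztime 0 = 0" by (simp add: T.ztime_def)
  have \<omega>: "\<omega> n = T.\<omega> (T.ztime n)" for n by (simp add: \<omega>_def T.\<omega>_def T.zorich_pow)
  have datum: "datum S = datum T" using fun_cong[OF S(3), of 0] by (simp add: rotation_number_def)

  note rdc_data = S(4)[unfolded rdc_data_def]
  have osel: "oseledets_extension S \<Gamma>" and ns0: "ns 0 = 0" and good: "good_return_times S ns"
    and ks: "strict_mono ks"
    by (rule rdc_data[THEN conjunct1] rdc_data[THEN conjunct2, THEN conjunct1]
        rdc_data[THEN conjunct2, THEN conjunct2, THEN conjunct1]
        rdc_data[THEN conjunct2, THEN conjunct2, THEN conjunct2, THEN conjunct2, THEN conjunct1])+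
  from S(4) have sub: "(\<lambda>m. 1 / real m * ln (mnorm (Q S (ns (ks m)) (ns (ks (Suc m)))))) \<longlonglongrightarrow> 0"
    unfolding rdc_data_def Let_def by (elim conjE)
  from S(4) obtain Km Kp \<delta> where \<delta>: "\<delta> > 0"
    and rdc: "\<forall>m. (\<Sum>k = 1..ks m. backward_term (Q S) \<Gamma> ns (ks m) k) \<le> Km \<and>
      (summable (\<lambda>i. forward_term (Q S) \<Gamma> ns (ks m) (ks m + 1 + i)) \<and> (\<Sum>i. forward_term (Q S) \<Gamma> ns (ks m) (ks m + 1 + i)) \<le> Kp) \<and>
      (\<forall>x y. x \<noteq> y \<and> \<Gamma> x (ns (ks m)) \<noteq> {0} \<and> \<Gamma> y (ns (ks m)) \<noteq> {0} \<longrightarrow>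
        subspace_angle (\<Gamma> x (ns (ks m))) (\<Gamma> y (ns (ks m))) > \<delta>)"
    unfolding rdc_data_def Let_def backward_term_def forward_term_def by (elim conjE exE)
  note osel_data = osel[unfolded oseledets_extension_def]
  have split: "\<forall>n. splitting (\<lambda>x. \<Gamma> x n)"
    and inv: "\<forall>x m n. m \<le> n \<longrightarrow> (*v) (Q S m n) ` \<Gamma> x m = \<Gamma> x n"
    and dims: "\<forall>n. dim (\<Gamma> Stab n) = genus (datum S) \<and> dim (\<Gamma> Unst n) = genus (datum S)"
    by (rule osel_data[THEN conjunct1] osel_data[THEN conjunct2, THEN conjunct1]
        osel_data[THEN conjunct2, THEN conjunct2, THEN conjunct1])+
  from osel obtain \<theta> C where \<theta>: "\<theta> > 0" "C > 0"
    and stab: "\<forall>n. \<forall>v\<in>\<Gamma> Stab 0. norm (Q S 0 n *v v) \<le> C * exp (- \<theta> * real n) * norm v"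
    and unst: "\<forall>n. \<forall>v\<in>\<Gamma> Unst n. norm (matrix_inv (Q S 0 n) *v v) \<le> C * exp (- \<theta> * real n) * norm v"
    unfolding oseledets_extension_def by (elim conjE exE)
  obtain D where D: "D \<ge> 0"
    "\<And>h n. h \<in> coboundaries s \<Longrightarrow> \<bar>T.dual_orbit h n \<bullet> T.\<omega> n\<bar> \<le> D * norm (T.dual_orbit h n)"
    using T.dual_orbit_\<omega> by blast
  define E where "E = 2 * real CARD('d) ^ 2"
  \<comment> \<open>Large enough at once for the Oseledets estimates, the cocycle error, the pairing
    with log-slopes and the norms of dual orbits.\<close>
  define A where "A = C + 2 * V + D + E"
  have A: "C \<le> A" "2 * V \<le> A" "D \<le> A" "E \<le> A" "0 \<le> A"
    using \<theta>(2) T.V_nonneg D(1) by (auto simp: A_def E_def)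

  interpret R: regular_cocycle "Q S" \<Gamma> ns ks \<omega> "coboundaries s" "\<lambda>h n. T.dual_orbit h (T.ztime n)"
    A "max Km Kp" \<theta> \<delta>
  proof
    show "Q S n n = mat 1" for n by (simp add: Q_rv)
    show "Q S l n = Q S m n ** Q S l m" if "l \<le> m" "m \<le> n" for l m n
      using that T.ztime_mono[of l m] T.ztime_mono[of m n]
        rv_matrix_add[of T.\<gamma> "T.ztime l" "T.ztime m - T.ztime l" "T.ztime n - T.ztime m"]
      by (simp add: Q_rv)
    show "invertible (Q S m n)" if "m \<le> n" for m n
      unfolding Q_rv[OF that] by (rule T.invertible_rv_matrix)
    show "0 \<le> Q S m n $ i $ j" "1 \<le> Q S m n $ i $ i" if "m \<le> n" for m n i j
      unfolding Q_rv[OF that] by (rule T.rv_matrix_nonneg T.rv_matrix_diag)+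
    show "norm (Q S 0 n *v v) \<le> A * exp (- \<theta> * real n) * norm v" if "v \<in> \<Gamma> Stab 0" for v n
      by (rule order_trans[OF stab[rule_format, OF that]]) (intro mult_right_mono A; simp)
    show "norm (matrix_inv (Q S 0 n) *v v) \<le> A * exp (- \<theta> * real n) * norm v" if "v \<in> \<Gamma> Unst n" for v n
      by (rule order_trans[OF unst[rule_format, OF that]]) (intro mult_right_mono A; simp)
    show "\<bar>\<omega> n $ i - (Q S m n *v \<omega> m) $ i\<bar> \<le> A * (\<Sum>j\<in>UNIV. Q S m n $ i $ j)" if "m \<le> n" for m n i
    proof -
      have "\<bar>\<omega> n $ i - (Q S m n *v \<omega> m) $ i\<bar> \<le> 2 * V * (\<Sum>j\<in>UNIV. Q S m n $ i $ j)"
        using T.\<omega>_cocycle[of "T.ztime m" "T.ztime n - T.ztime m" i] T.ztime_mono[OF that]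
        by (simp add: \<omega> Q_rv[OF that])
      also have "\<dots> \<le> A * (\<Sum>j\<in>UNIV. Q S m n $ i $ j)"
        unfolding Q_rv[OF that] by (intro mult_right_mono A sum_nonneg T.rv_matrix_nonneg)
      finally show ?thesis .
    qed
    show "T.dual_orbit h (T.ztime n) \<bullet> (Q S 0 n *v u) = h \<bullet> u" for h n u
      by (simp add: Q_rv z0 T.dual_orbit_inner)
    show "norm (T.dual_orbit h (T.ztime m)) \<le> A * norm (T.dual_orbit h (T.ztime n))"
      if "h \<in> coboundaries s" for h m n
      by (rule order_trans[OF T.dual_orbit_norm[OF that, of "T.ztime m" "T.ztime n"]])
        (intro mult_right_mono norm_ge_zero A(4)[unfolded E_def])
    show "\<bar>T.dual_orbit h (T.ztime n) \<bullet> \<omega> n\<bar> \<le> A * norm (T.dual_orbit h (T.ztime n))"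
      if "h \<in> coboundaries s" for h n
      unfolding \<omega> by (rule order_trans[OF D(2)[OF that]]) (intro mult_right_mono A norm_ge_zero)
    show "CARD('d) \<le> dim (coboundaries s) + dim (\<Gamma> Stab 0) + dim (\<Gamma> Unst 0)"
      using dim_coboundaries_ge[OF T.rep0 T.wf0] by (simp add: dims datum)
    fix m
    note rdc = rdc[THEN spec, of m]
    show "(\<Sum>k = 1..ks m. backward_term (Q S) \<Gamma> ns (ks m) k) \<le> max Km Kp"
      using rdc[THEN conjunct1] by (rule max.coboundedI1)
    show "summable (\<lambda>i. forward_term (Q S) \<Gamma> ns (ks m) (ks m + 1 + i))"
      using rdc[THEN conjunct2, THEN conjunct1, THEN conjunct1] .
    show "(\<Sum>i. forward_term (Q S) \<Gamma> ns (ks m) (ks m + 1 + i)) \<le> max Km Kp"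
      using rdc[THEN conjunct2, THEN conjunct1, THEN conjunct2] by (rule max.coboundedI2)
    show "subspace_angle (\<Gamma> x (ns (ks m))) (\<Gamma> y (ns (ks m))) > \<delta>"
      if "x \<noteq> y" "\<Gamma> x (ns (ks m)) \<noteq> {0}" "\<Gamma> y (ns (ks m)) \<noteq> {0}" for x y
      using rdc[THEN conjunct2, THEN conjunct2] that by blast
    show "T.dual_orbit h (T.ztime 0) = h" for h by (simp add: z0)
  qed (fact split[rule_format] inv[rule_format] \<theta> \<delta> A ns0 ks sub subspace_coboundaries good_return_times_ge[OF good ns0])+
  have "shadowing \<longleftrightarrow> (\<exists>v\<in>\<Gamma> Unst 0. v \<noteq> 0 \<and>
      (\<lambda>n. norm (\<omega> n - Q S 0 n *v v) / norm (Q S 0 n *v v)) \<longlonglongrightarrow> 0)"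
    by (simp add: shadowing_def QS)
  then show ?thesis
    using R.dichotomy R.exclusion unfolding recurrence_def by blast
qed

end
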